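(* Let $\mathfrak{u}$ be a compact Lie algebra and let $I$ be a $\mathfrak{b}^+$-complex structure on $\mathfrak{u}$. Let $\Gamma$ be the stem of $\Delta^+$. Then $I$ is admissible if and only if $\dim(\mathfrak{u})$ is divisible by $4$ and $\gamma(IW_\delta)=0$ for all $\gamma,\delta\in\Gamma$.
   Context: $\mathfrak{u}$ is a compact Lie algebra, $\mathfrak{g}=\mathfrak{u}^{\mathbb C}$ its (reductive) complexification, $\tau$ the conjugation of $\mathfrak{g}$ with respect to $\mathfrak{u}$, $\mathfrak{h}$ a $\tau$-stable Cartan subalgebra of $\mathfrak{g}$, $\Delta\subset\mathfrak{h}^*$ the set of roots, $\Delta^+$ a system of positive roots, $\mathfrak{g}(\alpha)$ the root space of $\alpha$, $\mathfrak{n}^+=\bigoplus_{\alpha\in\Delta^+}\mathfrak{g}(\alpha)$, $\mathfrak{b}^+=\mathfrak{h}\oplus\mathfrak{n}^+$. For $\alpha\in\Delta$, $H_\alpha\in\mathfrak{h}$ is the coroot ($H_\alpha\in[\mathfrak{g}(\alpha),\mathfrak{g}(-\alpha)]$, $\alpha(H_\alpha)=2$), and $W_\alpha=\frac{i}{2}H_\alpha\in\mathfrak{u}$. Stem: for $\gamma\in\Delta^+$ put $\Phi_\gamma^+=\{\alpha\in\Delta^+\mid\gamma-\alpha\in\Delta^+\}$; the stem $\Gamma$ of $\Delta^+$ is the unique subset of $\Delta^+$ such that $\Delta^+=\Gamma\cup\bigcup_{\gamma\in\Gamma}\Phi^+_\gamma$ as a disjoint union. A complex structure on $\mathfrak{u}$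 is a linear map $I:\mathfrak{u}\to\mathfrak{u}$ with $I^2=-1$; it is extended $\mathbb{C}$-linearly to $\mathfrak{g}$. Put $\mathfrak{m}^{+}_I=\{X\in\mathfrak{g}\mid IX= iX\}$. $I$ is integrable if $\mathfrak{m}_I^+$ is a subalgebra of $\mathfrak{g}$. $I$ is a $\mathfrak{b}^+$-complex structure if it is integrable and the normalizer of $\mathfrak{m}_I^+$ in $\mathfrak{g}$ is $\mathfrak{b}^+$; then $\mathfrak{m}_I^+=(\mathfrak{h}\cap\mathfrak{m}_I^+)\oplus\mathfrak{n}^+$ and $I(\mathfrak{h})=\mathfrak{h}$. A complex structure $J$ on $\mathfrak{u}$ matches $I$ if $J$ is integrable and $IJ=-JI$. $I$ is admissible if there exists some $J$ which matches $I$. *)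

theory Defs
  imports "HOL-Analysis.Analysis" "HOL-Library.Function_Algebras"
begin

section \<open>Compact Lie algebras\<close>

locale real_lie_algebra =
  fixes br :: "'u::real_vector \<Rightarrow> 'u \<Rightarrow> 'u"
  assumes bilinear: "bilinear br"
    and alternating: "br x x = 0"
    and jacobi: "br x (br y z) + br y (br z x) + br z (br x y) = 0"

text \<open>Compact means finite-dimensional with an ad-invariant inner product; equivalently,
  the Lie algebra of a compact Lie group.\<close>

definition compact_lie_algebra :: "('u::real_vector \<Rightarrow> 'u \<Rightarrow> 'u) \<Rightarrow> bool" where
  "compact_lie_algebra br \<longleftrightarrow>
     real_lie_algebra br \<and>
     (\<exists>B :: 'u set. finite B \<and> span B = UNIV) \<and>
     (\<exists>ip :: 'u \<Rightarrow> 'u \<Rightarrow> real.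
        bilinear ip \<and> (\<forall>x y. ip x y = ip y x) \<and> (\<forall>x. x \<noteq> 0 \<longrightarrow> ip x x > 0) \<and>
        (\<forall>x y z. ip (br x y) z + ip y (br x z) = 0))"


section \<open>The complexification\<close>

text \<open>The pair \<open>(x, y)\<close> stands for \<open>x + i y\<close>. All subsets \<open>h\<close>, \<open>A\<close>, ... below are subsets of the
  complexification \<open>g\<close> of the Lie algebra with bracket \<open>br\<close>.\<close>

type_synonym 'u cpx = "'u \<times> 'u"

definition cscale :: "complex \<Rightarrow> 'u::real_vector cpx \<Rightarrow> 'u cpx" where
  "cscale c X = (Re c *\<^sub>R fst X - Im c *\<^sub>R snd X, Re c *\<^sub>R snd X + Im c *\<^sub>R fst X)"

definition cbr :: "('u::real_vector \<Rightarrow> 'u \<Rightarrow> 'u) \<Rightarrow> 'u cpx \<Rightarrow> 'u cpx \<Rightarrow> 'u cpx" where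
  "cbr br X Y = (br (fst X) (fst Y) - br (snd X) (snd Y), br (fst X) (snd Y) + br (snd X) (fst Y))"

definition conjugation :: "'u::real_vector cpx \<Rightarrow> 'u cpx" where
  "conjugation X = (fst X, - snd X)"

definition complexify :: "('u::real_vector \<Rightarrow> 'u) \<Rightarrow> 'u cpx \<Rightarrow> 'u cpx" where
  "complexify f = map_prod f f"

interpretation cx: vector_space "cscale :: complex \<Rightarrow> 'u::real_vector cpx \<Rightarrow> 'u cpx"
  by unfold_locales (simp_all add: cscale_def algebra_simps)


section \<open>Subalgebras and Cartan subalgebras\<close>

definition bracket_space ::
    "('u::real_vector \<Rightarrow> 'u \<Rightarrow> 'u) \<Rightarrow> 'u cpx set \<Rightarrow> 'u cpx set \<Rightarrow> 'u cpx set" where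
  "bracket_space br A B = cx.span {cbr br X Y | X Y. X \<in> A \<and> Y \<in> B}"

definition subalgebra :: "('u::real_vector \<Rightarrow> 'u \<Rightarrow> 'u) \<Rightarrow> 'u cpx set \<Rightarrow> bool" where
  "subalgebra br A \<longleftrightarrow> cx.subspace A \<and> (\<forall>X\<in>A. \<forall>Y\<in>A. cbr br X Y \<in> A)"

definition normalizer :: "('u::real_vector \<Rightarrow> 'u \<Rightarrow> 'u) \<Rightarrow> 'u cpx set \<Rightarrow> 'u cpx set" where
  "normalizer br A = {X. \<forall>Y\<in>A. cbr br X Y \<in> A}"

primrec lower_central ::
    "('u::real_vector \<Rightarrow> 'u \<Rightarrow> 'u) \<Rightarrow> 'u cpx set \<Rightarrow> nat \<Rightarrow> 'u cpx set" where
  "lower_central br A 0 = A"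
| "lower_central br A (Suc n) = bracket_space br A (lower_central br A n)"

definition cartan_subalgebra :: "('u::real_vector \<Rightarrow> 'u \<Rightarrow> 'u) \<Rightarrow> 'u cpx set \<Rightarrow> bool" where
  "cartan_subalgebra br h \<longleftrightarrow>
     subalgebra br h \<and> (\<exists>n. lower_central br h n = {0}) \<and> normalizer br h = h"


section \<open>Roots\<close>

text \<open>Elements of the dual of \<open>h\<close> are functions on \<open>g\<close> that are linear on \<open>h\<close> and, to make them
  unique, 0 outside \<open>h\<close> (so in general not linear on \<open>g\<close>). The pointwise operations on functions
  then agree with those of the dual space.\<close>

definition dual :: "'u::real_vector cpx set \<Rightarrow> ('u cpx \<Rightarrow> complex) set" where
  "dual h = {\<alpha>. (\<forall>X\<in>h. \<forall>Y\<in>h. \<alpha> (X + Y) = \<alpha> X + \<alpha> Y) \<and>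
                (\<forall>c. \<forall>X\<in>h. \<alpha> (cscale c X) = c * \<alpha> X) \<and> (\<forall>X. X \<notin> h \<longrightarrow> \<alpha> X = 0)}"

definition root_space ::
    "('u::real_vector \<Rightarrow> 'u \<Rightarrow> 'u) \<Rightarrow> 'u cpx set \<Rightarrow> ('u cpx \<Rightarrow> complex) \<Rightarrow> 'u cpx set" where
  "root_space br h \<alpha> = {X. \<forall>H\<in>h. cbr br H X = cscale (\<alpha> H) X}"

definition roots ::
    "('u::real_vector \<Rightarrow> 'u \<Rightarrow> 'u) \<Rightarrow> 'u cpx set \<Rightarrow> ('u cpx \<Rightarrow> complex) set" where
  "roots br h = {\<alpha> \<in> dual h. \<alpha> \<noteq> 0 \<and> root_space br h \<alpha> \<noteq> {0}}"

definition positive_system ::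
    "('u::real_vector \<Rightarrow> 'u \<Rightarrow> 'u) \<Rightarrow> 'u cpx set \<Rightarrow> ('u cpx \<Rightarrow> complex) set \<Rightarrow> bool" where
  "positive_system br h P \<longleftrightarrow>
     P \<union> uminus ` P = roots br h \<and> P \<inter> uminus ` P = {} \<and>
     (\<forall>\<alpha>\<in>P. \<forall>\<beta>\<in>P. \<alpha> + \<beta> \<in> roots br h \<longrightarrow> \<alpha> + \<beta> \<in> P)"

definition coroot ::
    "('u::real_vector \<Rightarrow> 'u \<Rightarrow> 'u) \<Rightarrow> 'u cpx set \<Rightarrow> ('u cpx \<Rightarrow> complex) \<Rightarrow> 'u cpx" where
  "coroot br h \<alpha> =
     (THE H. H \<in> h \<and> H \<in> bracket_space br (root_space br h \<alpha>) (root_space br h (- \<alpha>)) \<and> \<alpha> H = 2)"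

definition W ::
    "('u::real_vector \<Rightarrow> 'u \<Rightarrow> 'u) \<Rightarrow> 'u cpx set \<Rightarrow> ('u cpx \<Rightarrow> complex) \<Rightarrow> 'u cpx" where
  "W br h \<alpha> = cscale (\<i> / 2) (coroot br h \<alpha>)"

definition nilradical ::
    "('u::real_vector \<Rightarrow> 'u \<Rightarrow> 'u) \<Rightarrow> 'u cpx set \<Rightarrow> ('u cpx \<Rightarrow> complex) set \<Rightarrow> 'u cpx set" where
  "nilradical br h P = cx.span (\<Union>\<alpha>\<in>P. root_space br h \<alpha>)"

definition borel ::
    "('u::real_vector \<Rightarrow> 'u \<Rightarrow> 'u) \<Rightarrow> 'u cpx set \<Rightarrow> ('u cpx \<Rightarrow> complex) set \<Rightarrow> 'u cpx set" where
  "borel br h P = {H + X | H X. H \<in> h \<and> X \<in> nilradical br h P}"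

definition Phi ::
    "('u::real_vector cpx \<Rightarrow> complex) set \<Rightarrow> ('u cpx \<Rightarrow> complex) \<Rightarrow> ('u cpx \<Rightarrow> complex) set" where
  "Phi P \<gamma> = {\<alpha> \<in> P. \<gamma> - \<alpha> \<in> P}"

definition is_stem ::
    "('u::real_vector cpx \<Rightarrow> complex) set \<Rightarrow> ('u cpx \<Rightarrow> complex) set \<Rightarrow> bool" where
  "is_stem P \<Gamma> \<longleftrightarrow>
     \<Gamma> \<subseteq> P \<and> P = \<Gamma> \<union> (\<Union>\<gamma>\<in>\<Gamma>. Phi P \<gamma>) \<and>
     \<Gamma> \<inter> (\<Union>\<gamma>\<in>\<Gamma>. Phi P \<gamma>) = {} \<and> disjoint_family_on (Phi P) \<Gamma>"


section \<open>Complex structures\<close>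

definition complex_structure :: "('u::real_vector \<Rightarrow> 'u) \<Rightarrow> bool" where
  "complex_structure I \<longleftrightarrow> linear I \<and> (\<forall>x. I (I x) = - x)"

definition m_plus :: "('u::real_vector \<Rightarrow> 'u) \<Rightarrow> 'u cpx set" where
  "m_plus I = {X. complexify I X = cscale \<i> X}"

definition integrable_structure ::
    "('u::real_vector \<Rightarrow> 'u \<Rightarrow> 'u) \<Rightarrow> ('u \<Rightarrow> 'u) \<Rightarrow> bool" where
  "integrable_structure br I \<longleftrightarrow> complex_structure I \<and> subalgebra br (m_plus I)"

definition borel_complex_structure ::
    "('u::real_vector \<Rightarrow> 'u \<Rightarrow> 'u) \<Rightarrow> 'u cpx set \<Rightarrow> ('u cpx \<Rightarrow> complex) set \<Rightarrow> ('u \<Rightarrow> 'u) \<Rightarrow> bool" where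
  "borel_complex_structure br h P I \<longleftrightarrow>
     integrable_structure br I \<and> normalizer br (m_plus I) = borel br h P"

definition matches ::
    "('u::real_vector \<Rightarrow> 'u \<Rightarrow> 'u) \<Rightarrow> ('u \<Rightarrow> 'u) \<Rightarrow> ('u \<Rightarrow> 'u) \<Rightarrow> bool" where
  "matches br J I \<longleftrightarrow> integrable_structure br J \<and> (\<forall>x. I (J x) = - J (I x))"

definition admissible :: "('u::real_vector \<Rightarrow> 'u \<Rightarrow> 'u) \<Rightarrow> ('u \<Rightarrow> 'u) \<Rightarrow> bool" where
  "admissible br I \<longleftrightarrow> (\<exists>J. matches br J I)"

end

theory Submission
  imports Defs
begin

text \<open>
  Write \<open>m\<close> for the \<open>\<i>\<close>-eigenspace of \<open>I\<close> and \<open>\<tau>\<close> for the conjugation. If \<open>J\<close> anticommutes with \<open>I\<close>,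
  then \<open>\<psi> = \<tau> J\<close> is an antilinear map of \<open>m\<close> with \<open>\<psi>\<^sup>2 = -1\<close>, and \<open>J\<close> is integrable iff \<open>J\<close> is a
  1-cocycle of \<open>m\<close> with values in \<open>g / m\<close>. Roots are imaginary on \<open>h \<inter> u\<close>, so
  sums of roots that vanish on \<open>h \<inter> m\<close> are zero, and therefore every cocycle is a coboundary plus a map supported on \<open>h \<inter> m\<close>; hence \<open>\<psi>\<close> is
  given on \<open>n\<^sup>+\<close> by \<open>X \<mapsto> [\<tau> X, w]\<^sup>+\<close> for some \<open>w \<in> n\<^sup>+\<close>. Evaluating \<open>\<psi>\<^sup>2 = -1\<close> on the root vectors
  of the stem forces the support of \<open>w\<close> to be exactly \<open>\<Gamma>\<close> and yields \<open>\<gamma>(I W\<^sub>\<delta>) = 0\<close>.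
  Conversely, under these conditions \<open>w = \<Sum>\<^sub>\<gamma> E\<^sub>\<gamma>\<close> defines such a \<open>\<psi>\<close> on the sum of \<open>n\<^sup>+\<close> and the span of
  the \<open>(1,0)\<close>-parts of the coroots of \<open>\<Gamma>\<close>; the complement \<open>{H \<in> h \<inter> m | \<gamma>(H) = 0 for \<gamma> \<in> \<Gamma>}\<close> has even
  dimension when \<open>4\<close> divides \<open>dim u\<close>, so it carries a quaternionic structure as well.
\<close>

text \<open>All root theory is drawn from one source: the positive definite Hermitian form
  \<open>herm\<close>, for which ad Z has adjoint -ad(tau Z); norm identities then do the work of
  sl2-theory. Positive systems and the stem are known only through their axioms, so the order on
  roots is that of sums of positive roots (\<open>psum\<close>), and strong orthogonality of the
  stem is won from maximal elements of this order. Why the stem appears: if gamma is a stem root and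
  no root of the support of w exceeds it by a positive root, then the projection of [tau E_gamma, w]
  has a single term c (H_gamma)^+. Applying psi again and comparing coefficients gives 1 = |c|^2
  gamma((H_gamma)^-), where gamma((H_gamma)^-) = 1 + (i/2) gamma(I H_gamma). That |c|^2 is real is
  the diagonal condition; that it then equals 1 explains the coefficients of w in the converse. An
  h-valued summand of psi supported on h \<inter> m is invisible to the cocycle identity. This
  freedom is what the condition on the dimension has to fill.\<close>

declare split_paired_All [simp del] split_paired_Ex [simp del]

section \<open>Linear algebra in the complexification\<close>

notation cscale (infixr "*\<^sub>C" 75)

lemma fst_cscale [simp]: "fst (c *\<^sub>C X) = Re c *\<^sub>R fst X - Im c *\<^sub>R snd X"
  and snd_cscale [simp]: "snd (c *\<^sub>C X) = Re c *\<^sub>R snd X + Im c *\<^sub>R fst X"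
  by (simp_all add: cscale_def)

lemma conjugation_simps [simp]:
  "conjugation (conjugation X) = X"
  "conjugation (X + Y) = conjugation X + conjugation Y"
  "conjugation (X - Y) = conjugation X - conjugation Y"
  "conjugation (- X) = - conjugation X"
  "conjugation 0 = 0"
  "conjugation (c *\<^sub>C X) = cnj c *\<^sub>C conjugation X"
  by (simp_all add: conjugation_def cscale_def zero_prod_def)

lemma conjugation_eq_0_iff [simp]: "conjugation X = 0 \<longleftrightarrow> X = 0"
  by (metis conjugation_simps(1,5))

lemma in_conj_image: "X \<in> conjugation ` V \<longleftrightarrow> conjugation X \<in> V"
proof
  assume "conjugation X \<in> V"
  then have "conjugation (conjugation X) \<in> conjugation ` V" by (rule imageI)
  then show "X \<in> conjugation ` V" by simp
qed auto

lemma subspace_conj: "cx.subspace V \<Longrightarrow> cx.subspace (conjugation ` V)"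
  by (rule cx.subspaceI)
    (simp_all add: in_conj_image cx.subspace_0 cx.subspace_add cx.subspace_scale)

lemma span_conj: "cx.span (conjugation ` S) = conjugation ` cx.span S"
proof
  show "cx.span (conjugation ` S) \<subseteq> conjugation ` cx.span S"
    by (intro cx.span_minimal image_mono cx.span_superset subspace_conj cx.subspace_span)
  have "cx.span S \<subseteq> conjugation ` cx.span (conjugation ` S)"
  proof (intro cx.span_minimal subspace_conj cx.subspace_span subsetI)
    fix x assume "x \<in> S"
    then have "conjugation x \<in> cx.span (conjugation ` S)" by (intro cx.span_base) simp
    then show "x \<in> conjugation ` cx.span (conjugation ` S)" by (simp add: in_conj_image)
  qed
  then have "conjugation ` cx.span S \<subseteq> conjugation ` conjugation ` cx.span (conjugation ` S)"
    by (rule image_mono)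
  then show "conjugation ` cx.span S \<subseteq> cx.span (conjugation ` S)" by (simp add: image_image)
qed

lemma inj_conj: "inj_on conjugation S"
  by (rule inj_on_inverseI[of _ conjugation]) simp

lemma independent_conj:
  assumes "cx.independent S"
  shows "cx.independent (conjugation ` S)"
  unfolding cx.dependent_def
proof
  assume "\<exists>a\<in>conjugation ` S. a \<in> cx.span (conjugation ` S - {a})"
  then obtain x where x: "x \<in> S" "conjugation x \<in> cx.span (conjugation ` S - {conjugation x})" by blast
  have "conjugation ` S - {conjugation x} = conjugation ` (S - {x})"
    using inj_on_image_set_diff[OF inj_conj[of UNIV], of S "{x}"] by simp
  then have "conjugation x \<in> conjugation ` cx.span (S - {x})" using x by (simp add: span_conj)
  then have "x \<in> cx.span (S - {x})" by (simp add: in_conj_image)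
  then show False using assms x by (auto simp: cx.dependent_def)
qed

lemma dim_conj: "cx.dim (conjugation ` V) = cx.dim V"
proof -
  obtain C where C: "C \<subseteq> V" "cx.independent C" "V \<subseteq> cx.span C" "card C = cx.dim V"
    by (rule cx.basis_exists)
  show ?thesis
  proof (rule cx.dim_unique[of "conjugation ` C"])
    show "conjugation ` V \<subseteq> cx.span (conjugation ` C)" using C by (auto simp: span_conj)
    show "card (conjugation ` C) = cx.dim V" using C by (simp add: card_image inj_conj)
  qed (use C independent_conj in auto)
qed

text \<open>Precomposing with \<open>conjugation\<close> exchanges antilinear and linear maps, so a
  linear extension from the conjugated basis suffices.\<close>

lemma exists_antilinear:
  fixes C :: "'a::real_vector cpx set" and t :: "'a cpx \<Rightarrow> 'a cpx"
  assumes "cx.independent C"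
  obtains j :: "'a cpx \<Rightarrow> 'a cpx"
  where "\<And>X Y. j (X + Y) = j X + j Y" "\<And>c X. j (c *\<^sub>C X) = cnj c *\<^sub>C j X"
    "\<And>x. x \<in> C \<Longrightarrow> j x = t x"
proof -
  interpret vp: vector_space_pair "cscale :: complex \<Rightarrow> 'a cpx \<Rightarrow> 'a cpx" "cscale :: complex \<Rightarrow> 'a cpx \<Rightarrow> 'a cpx" ..
  obtain g where g: "Vector_Spaces.linear cscale cscale g" "\<forall>x\<in>conjugation ` C. g x = t (conjugation x)"
    using vp.linear_independent_extend[OF independent_conj[OF assms], of "\<lambda>x. t (conjugation x)"] by blast
  interpret g: Vector_Spaces.linear cscale cscale g by (rule g(1))
  show ?thesis
    by (rule that[of "\<lambda>X. g (conjugation X)"]) (use g(2) in \<open>simp_all add: g.add g.scale\<close>)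
qed

locale cpx_finite =
  finite_dimensional_vector_space "cscale :: complex \<Rightarrow> 'u::real_vector cpx \<Rightarrow> 'u cpx" B for B
begin

text \<open>A \<psi>-stable subspace of even dimension that is maximal must be all of V: any vector
  x outside it could be adjoined together with \<psi> x, raising the dimension by exactly
  two.\<close>

lemma even_dim_quaternionic:
  fixes V :: "'u cpx set"
  assumes V: "cx.subspace V" and in_V: "\<And>X. X \<in> V \<Longrightarrow> \<psi> X \<in> V"
    and sq: "\<And>X. X \<in> V \<Longrightarrow> \<psi> (\<psi> X) = - X"
    and scale: "\<And>c X. X \<in> V \<Longrightarrow> \<psi> (c *\<^sub>C X) = cnj c *\<^sub>C \<psi> X"
    and add: "\<And>X Y. X \<in> V \<Longrightarrow> Y \<in> V \<Longrightarrow> \<psi> (X + Y) = \<psi> X + \<psi> Y"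
  shows "even (cx.dim V)"
proof -
  define Q where "Q W \<longleftrightarrow> cx.subspace W \<and> W \<subseteq> V \<and> (\<forall>X\<in>W. \<psi> X \<in> W) \<and> even (cx.dim W)" for W
  have \<psi>0: "\<psi> 0 = 0" using scale[of 0 0] cx.subspace_0[OF V] by simp
  have Q0: "Q {0}" using cx.subspace_0[OF V] by (simp add: Q_def \<psi>0 cx.subspace_single_0)
  have bd: "\<forall>W. Q W \<longrightarrow> cx.dim W < Suc (cx.dim V)"
    using dim_subset by (simp add: Q_def less_Suc_eq_le)
  obtain W where W: "Q W" and max: "\<And>W'. Q W' \<Longrightarrow> cx.dim W' \<le> cx.dim W"
    using ex_has_greatest_nat[OF Q0 bd] by blast
  have W': "cx.subspace W" "W \<subseteq> V" "\<And>X. X \<in> W \<Longrightarrow> \<psi> X \<in> W" "even (cx.dim W)"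
    using W by (auto simp: Q_def)
  have "V \<subseteq> W"
  proof (rule ccontr)
    assume "\<not> V \<subseteq> W"
    then obtain x where x: "x \<in> V" "x \<notin> W" by blast
    have sW: "cx.span W = W" using W'(1) by (simp add: cx.span_eq_iff)
    have xs: "x \<notin> cx.span W" unfolding sW by (rule x(2))
    have nx: "\<psi> x \<notin> cx.span (insert x W)"
    proof
      assume "\<psi> x \<in> cx.span (insert x W)"
      then obtain k where k: "\<psi> x - k *\<^sub>C x \<in> W" by (auto simp: cx.span_breakdown_eq sW)
      define y where "y = \<psi> x - k *\<^sub>C x"
      have y: "y \<in> W" "y \<in> V" "\<psi> x = y + k *\<^sub>C x" using k W'(2) by (auto simp: y_def)
      have kx: "k *\<^sub>C x \<in> V" using cx.subspace_scale[OF V] x by blast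
      \<comment> \<open>Modulo W, x is an eigenvector with \<psi> x = k x; antilinearity turns
        \<psi>(\<psi> x) = -x into |k|^2 = -1, which is impossible.\<close>
      have "- x = \<psi> (y + k *\<^sub>C x)" using sq[OF x(1)] by (simp flip: y(3))
      also have "\<dots> = \<psi> y + cnj k *\<^sub>C \<psi> x"
        using add[OF y(2) kx] scale[OF x(1)] by simp
      also have "\<dots> = \<psi> y + cnj k *\<^sub>C y + (cnj k * k) *\<^sub>C x"
        unfolding y(3) by (simp add: cx.scale_right_distrib)
      finally have e: "- x = \<psi> y + cnj k *\<^sub>C y + (cnj k * k) *\<^sub>C x" .
      have "(- 1 - cnj k * k) *\<^sub>C x = - x - (cnj k * k) *\<^sub>C x"
        by (simp add: cx.scale_left_diff_distrib)
      also have "\<dots> = \<psi> y + cnj k *\<^sub>C y" unfolding e by simp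
      finally have "(- 1 - cnj k * k) *\<^sub>C x = \<psi> y + cnj k *\<^sub>C y" .
      moreover have "\<psi> y + cnj k *\<^sub>C y \<in> W"
        by (intro cx.subspace_add[OF W'(1)] cx.subspace_scale[OF W'(1)] W'(3) y)
      ultimately have m: "(- 1 - cnj k * k) *\<^sub>C x \<in> W" by simp
      have "Re (- 1 - cnj k * k) = - 1 - (Re k)\<^sup>2 - (Im k)\<^sup>2" by (simp add: power2_eq_square)
      also have "\<dots> < 0" using zero_le_power2[of "Re k"] zero_le_power2[of "Im k"] by linarith
      finally have nz: "- 1 - cnj k * k \<noteq> 0" by (metis less_irrefl zero_complex.sel(1))
      have "inverse (- 1 - cnj k * k) *\<^sub>C ((- 1 - cnj k * k) *\<^sub>C x) \<in> W"
        by (rule cx.subspace_scale[OF W'(1) m])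
      then show False using x(2) nz by simp
    qed
    define U where "U = cx.span (insert (\<psi> x) (insert x W))"
    have "cx.dim U = cx.dim W + 2"
      using nx xs by (simp add: U_def dim_insert)
    moreover have "Q U"
      unfolding Q_def
    proof (intro conjI ballI)
      show "cx.subspace U" by (simp add: U_def)
      show "even (cx.dim U)" using \<open>cx.dim U = cx.dim W + 2\<close> W'(4) by simp
      show "U \<subseteq> V" unfolding U_def using x in_V W'(2) V by (intro cx.span_minimal) auto
      fix X assume "X \<in> U"
      then obtain c d where "X - c *\<^sub>C \<psi> x - d *\<^sub>C x \<in> W"
        by (auto simp: U_def cx.span_breakdown_eq sW)
      moreover define y where "y = X - c *\<^sub>C \<psi> x - d *\<^sub>C x"
      ultimately have y: "y \<in> W" "X = y + d *\<^sub>C x + c *\<^sub>C \<psi> x" by (auto simp: algebra_simps)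
      have m: "y \<in> V" "\<psi> x \<in> V" "d *\<^sub>C x \<in> V" "c *\<^sub>C \<psi> x \<in> V"
        using y(1) W'(2) x(1) in_V[OF x(1)] cx.subspace_scale[OF V] by blast+
      moreover have "y + d *\<^sub>C x \<in> V" using cx.subspace_add[OF V] m by blast
      ultimately have "\<psi> X = \<psi> y + cnj d *\<^sub>C \<psi> x + cnj c *\<^sub>C (- x)"
        using y(2) x(1) by (simp add: add scale sq)
      also have "\<dots> \<in> U" unfolding U_def using W'(3)[OF y(1)]
        by (intro cx.span_add cx.span_scale cx.span_neg cx.span_base) auto
      finally show "\<psi> X \<in> U" .
    qed
    ultimately show False using max[of U] by simp
  qed
  then have "V = W" using W'(2) by blast
  then show ?thesis using W'(4) by simp
qed

text \<open>Split a basis into two halves matched by a bijection f; the antilinear map with x to f x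
  and f x to -x squares to -1.\<close>

lemma exists_quaternionic:
  fixes V :: "'u cpx set"
  assumes "cx.subspace V" "even (cx.dim V)"
  obtains j where "\<And>X Y. j (X + Y) = j X + j Y" "\<And>c X. j (c *\<^sub>C X) = cnj c *\<^sub>C j X"
    "\<And>X. X \<in> V \<Longrightarrow> j X \<in> V" "\<And>X. X \<in> V \<Longrightarrow> j (j X) = - X"
proof -
  obtain C where C: "C \<subseteq> V" "cx.independent C" "V \<subseteq> cx.span C" "card C = cx.dim V"
    by (rule cx.basis_exists)
  have fin: "finite C" using finiteI_independent C(2) by blast
  obtain n where n: "card C = 2 * n" using assms(2) C(4) by auto
  then obtain C1 where C1: "C1 \<subseteq> C" "card C1 = n"
    using obtain_subset_with_card_n[of n C] by auto
  define C2 where "C2 = C - C1"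
  have "card C2 = card C1" using C1 n fin by (simp add: C2_def card_Diff_subset finite_subset)
  then obtain f where f: "bij_betw f C1 C2"
    using finite_same_card_bij[of C1 C2] fin C1 by (metis C2_def finite_Diff finite_subset)
  define g where "g = inv_into C1 f"
  define t where "t x = (if x \<in> C1 then f x else - g x)" for x
  obtain j where j: "\<And>X Y. j (X + Y) = j X + j Y" "\<And>c X. j (c *\<^sub>C X) = cnj c *\<^sub>C j X"
    "\<And>x. x \<in> C \<Longrightarrow> j x = t x"
    using exists_antilinear[OF C(2), of t] by blast
  have j0: "j 0 = 0" using j(2)[of 0 0] by simp
  have jneg: "j (- X) = - j X" for X using j(2)[of "-1" X] by simp
  have f2: "f x \<in> C" "f x \<notin> C1" "g (f x) = x" if "x \<in> C1" for x
    using that f by (auto simp: g_def C2_def bij_betw_def)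
  have g1: "g x \<in> C1" "f (g x) = x" if "x \<in> C2" for x
    using that f by (auto simp: g_def bij_betw_def inv_into_into f_inv_into_f)
  have base: "j x \<in> V \<and> j (j x) = - x" if "x \<in> C" for x
  proof (cases "x \<in> C1")
    case True
    then have "j x = f x" "j (f x) = - x" using f2[OF True] j(3) that by (auto simp: t_def)
    then show ?thesis using f2(1)[OF True] C(1) by auto
  next
    case False
    then have x2: "x \<in> C2" using that by (simp add: C2_def)
    have "j (g x) = t (g x)" using j(3) C1(1) g1(1)[OF x2] by blast
    then have "j x = - g x" "j (g x) = x" using g1[OF x2] j(3)[OF that] False by (simp_all add: t_def)
    moreover have "- g x \<in> V"
      by (rule cx.subspace_neg[OF assms(1)]) (use g1(1)[OF x2] C(1) C1(1) in blast)
    ultimately show ?thesis by (simp add: jneg)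
  qed
  have "j X \<in> V \<and> j (j X) = - X" if "X \<in> V" for X
  proof -
    have "X \<in> cx.span C" using that C(3) by blast
    then show ?thesis
    proof (induction rule: cx.span_induct_alt)
      case base
      then show ?case using j0 cx.subspace_0[OF assms(1)] by simp
    next
      case (step c x y)
      then show ?case using base[OF step(1)] cx.subspace_add[OF assms(1)] cx.subspace_scale[OF assms(1)]
        by (simp add: j)
    qed
  qed
  with j(1,2) show ?thesis using that by blast
qed

end

lemma dim_cpx:
  fixes B :: "'u::real_vector set"
  assumes B: "finite B" "span B = UNIV"
  shows "cx.dim (UNIV :: 'u cpx set) = dim (UNIV :: 'u set)"
    and "\<exists>C. finite_dimensional_vector_space (cscale :: complex \<Rightarrow> 'u cpx \<Rightarrow> 'u cpx) C"
proof -
  obtain C :: "'u set" where C: "independent C" "UNIV \<subseteq> span C" "card C = dim (UNIV :: 'u set)"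
    by (rule real_vector.basis_exists)
  have fin: "finite C" using real_vector.independent_span_bound[OF B(1) C(1)] B(2) by simp
  define D :: "'u cpx set" where "D = (\<lambda>b. (b, 0)) ` C"
  have inj: "inj_on (\<lambda>b. (b, 0::'u)) C" by (rule inj_onI) simp
  have indep: "cx.independent D"
  proof (rule cx.independent_if_scalars_zero)
    show "finite D" using fin by (simp add: D_def)
    fix u v assume u: "(\<Sum>v\<in>D. u v *\<^sub>C v) = 0" and v: "v \<in> D"
    obtain b where b: "b \<in> C" "v = (b, 0)" using v by (auto simp: D_def)
    have "(\<Sum>b\<in>C. u (b, 0) *\<^sub>C (b, 0)) = 0" using u inj by (simp add: D_def sum.reindex)
    then have "(\<Sum>b\<in>C. Re (u (b, 0)) *\<^sub>R b) = 0" "(\<Sum>b\<in>C. Im (u (b, 0)) *\<^sub>R b) = 0"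
      by (auto simp: prod_eq_iff fst_sum snd_sum)
    then have "Re (u (b, 0)) = 0" "Im (u (b, 0)) = 0"
      using real_vector.independentD[OF C(1) fin subset_refl _ b(1), of "\<lambda>b. Re (u (b, 0))"]
        real_vector.independentD[OF C(1) fin subset_refl _ b(1), of "\<lambda>b. Im (u (b, 0))"] by blast+
    then show "u v = 0" by (simp add: b(2) complex_eq_iff)
  qed
  have 1: "(x, 0) \<in> cx.span D" for x
  proof -
    have "x \<in> span C" using C(2) by blast
    then show ?thesis
    proof (induction rule: span_induct_alt)
      case base
      show ?case using cx.span_zero by (simp add: zero_prod_def)
    next
      case (step c b y)
      have "(c *\<^sub>R b + y, 0) = of_real c *\<^sub>C (b, 0) + (y, 0)" by (simp add: prod_eq_iff)
      also have "\<dots> \<in> cx.span D"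
        using step by (intro cx.span_add cx.span_scale[OF cx.span_base]) (auto simp: D_def)
      finally show ?case .
    qed
  qed
  have span: "cx.span D = UNIV"
  proof -
    have "X \<in> cx.span D" for X
    proof -
      have "X = (fst X, 0) + \<i> *\<^sub>C (snd X, 0)" by (simp add: prod_eq_iff)
      also have "\<dots> \<in> cx.span D" by (intro cx.span_add cx.span_scale 1)
      finally show ?thesis .
    qed
    then show ?thesis by blast
  qed
  have "cx.dim (UNIV :: 'u cpx set) = card D" using indep span by (intro cx.dim_eq_card) simp_all
  also have "\<dots> = dim (UNIV :: 'u set)" using inj C(3) by (simp add: D_def card_image)
  finally show "cx.dim (UNIV :: 'u cpx set) = dim (UNIV :: 'u set)" .
  have "finite_dimensional_vector_space cscale D"
    by unfold_locales (use fin indep span in \<open>auto simp: D_def\<close>)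
  then show "\<exists>C. finite_dimensional_vector_space (cscale :: complex \<Rightarrow> 'u cpx \<Rightarrow> 'u cpx) C" by blast
qed

section \<open>Compact forms, Cartan subalgebras and root strings\<close>

locale compact_form = real_lie_algebra br for br :: "'u::real_vector \<Rightarrow> 'u \<Rightarrow> 'u" +
  fixes ip :: "'u \<Rightarrow> 'u \<Rightarrow> real"
  assumes ip_bilinear: "bilinear ip"
    and ip_sym: "ip x y = ip y x"
    and ip_pos: "x \<noteq> 0 \<Longrightarrow> ip x x > 0"
    and ip_inv: "ip (br x y) z + ip y (br x z) = 0"
    and finite_spanning: "\<exists>B :: 'u set. finite B \<and> span B = UNIV"
begin

abbreviation cb ("\<lbrace>_,_\<rbrace>") where "\<lbrace>X,Y\<rbrace> \<equiv> cbr br X Y"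

lemmas br_simps = bilinear_ladd[OF bilinear] bilinear_radd[OF bilinear]
  bilinear_lsub[OF bilinear] bilinear_rsub[OF bilinear]
  bilinear_lmul[OF bilinear] bilinear_rmul[OF bilinear]
  bilinear_lneg[OF bilinear] bilinear_rneg[OF bilinear]
  bilinear_lzero[OF bilinear] bilinear_rzero[OF bilinear]

lemmas ip_simps = bilinear_ladd[OF ip_bilinear] bilinear_radd[OF ip_bilinear]
  bilinear_lsub[OF ip_bilinear] bilinear_rsub[OF ip_bilinear]
  bilinear_lmul[OF ip_bilinear] bilinear_rmul[OF ip_bilinear]
  bilinear_lneg[OF ip_bilinear] bilinear_rneg[OF ip_bilinear]
  bilinear_lzero[OF ip_bilinear] bilinear_rzero[OF ip_bilinear]

lemma br_anticomm: "br x y = - br y x"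
proof -
  have "br (x + y) (x + y) = br x x + br y x + (br x y + br y y)"
    by (simp only: bilinear_ladd[OF bilinear] bilinear_radd[OF bilinear])
  then have "br x y + br y x = 0" by (simp add: alternating add.commute)
  then show ?thesis by (simp add: eq_neg_iff_add_eq_0)
qed

lemma cb_add_left: "\<lbrace>X + Y, Z\<rbrace> = \<lbrace>X,Z\<rbrace> + \<lbrace>Y,Z\<rbrace>"
  and cb_add_right: "\<lbrace>X, Y + Z\<rbrace> = \<lbrace>X,Y\<rbrace> + \<lbrace>X,Z\<rbrace>"
  and cb_scale_left: "\<lbrace>c *\<^sub>C X, Y\<rbrace> = c *\<^sub>C \<lbrace>X,Y\<rbrace>"
  and cb_scale_right: "\<lbrace>X, c *\<^sub>C Y\<rbrace> = c *\<^sub>C \<lbrace>X,Y\<rbrace>"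
  and cb_diff_left: "\<lbrace>X - Y, Z\<rbrace> = \<lbrace>X,Z\<rbrace> - \<lbrace>Y,Z\<rbrace>"
  and cb_diff_right: "\<lbrace>X, Y - Z\<rbrace> = \<lbrace>X,Y\<rbrace> - \<lbrace>X,Z\<rbrace>"
  and cb_minus_left: "\<lbrace>- X, Y\<rbrace> = - \<lbrace>X,Y\<rbrace>"
  and cb_minus_right: "\<lbrace>X, - Y\<rbrace> = - \<lbrace>X,Y\<rbrace>"
  and cb_zero_left [simp]: "\<lbrace>0, Y\<rbrace> = 0"
  and cb_zero_right [simp]: "\<lbrace>X, 0\<rbrace> = 0"
  by (simp_all add: cbr_def cscale_def br_simps zero_prod_def algebra_simps)

lemmas cb_simps = cb_add_left cb_add_right cb_scale_left cb_scale_right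
  cb_diff_left cb_diff_right cb_minus_left cb_minus_right

lemma cb_sum_right: "\<lbrace>X, sum f A\<rbrace> = (\<Sum>x\<in>A. \<lbrace>X, f x\<rbrace>)"
  by (induction A rule: infinite_finite_induct) (auto simp: cb_simps)

lemma cb_anticomm: "\<lbrace>X,Y\<rbrace> = - \<lbrace>Y,X\<rbrace>"
  by (simp add: cbr_def br_anticomm[of "fst X"] br_anticomm[of "snd X"])

lemma br_jacobi: "br x (br y z) = br (br x y) z + br y (br x z)"
proof -
  have "br (br x y) z = - br z (br x y)" "br y (br x z) = - br y (br z x)"
    by (simp_all add: br_anticomm[of "br x y"] br_anticomm[of x z] br_simps)
  moreover have "br x (br y z) = - (br y (br z x) + br z (br x y))"
    using jacobi[of x y z] by (simp only: eq_neg_iff_add_eq_0 add.assoc)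
  ultimately show ?thesis by simp
qed

lemma cb_jacobi: "\<lbrace>X, \<lbrace>Y,Z\<rbrace>\<rbrace> = \<lbrace>\<lbrace>X,Y\<rbrace>, Z\<rbrace> + \<lbrace>Y, \<lbrace>X,Z\<rbrace>\<rbrace>"
proof -
  have *: "br x (br y z) = br (br x y) z + br y (br x z)" for x y z by (rule br_jacobi)
  show ?thesis
    by (simp add: cbr_def br_simps *[of "fst X" "fst Y"] *[of "fst X" "snd Y"]
          *[of "snd X" "fst Y"] *[of "snd X" "snd Y"])
qed

lemma conjugation_cb: "conjugation \<lbrace>X,Y\<rbrace> = \<lbrace>conjugation X, conjugation Y\<rbrace>"
  by (simp add: conjugation_def cbr_def br_simps)

text \<open>The complex bilinear extension of \<open>ip\<close>, evaluated at X and the conjugate of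
  Y.\<close>

definition herm :: "'u cpx \<Rightarrow> 'u cpx \<Rightarrow> complex" where
  "herm X Y = Complex (ip (fst X) (fst Y) + ip (snd X) (snd Y)) (ip (snd X) (fst Y) - ip (fst X) (snd Y))"

lemma herm_add_left: "herm (X + Y) Z = herm X Z + herm Y Z"
  and herm_add_right: "herm X (Y + Z) = herm X Y + herm X Z"
  and herm_diff_left: "herm (X - Y) Z = herm X Z - herm Y Z"
  and herm_diff_right: "herm X (Y - Z) = herm X Y - herm X Z"
  and herm_minus_left: "herm (- X) Z = - herm X Z"
  and herm_minus_right: "herm X (- Z) = - herm X Z"
  and herm_scale_left: "herm (c *\<^sub>C X) Y = c * herm X Y"
  and herm_scale_right: "herm X (c *\<^sub>C Y) = cnj c * herm X Y"
  and herm_zero_left [simp]: "herm 0 Y = 0"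
  and herm_zero_right [simp]: "herm X 0 = 0"
  by (simp_all add: herm_def complex_eq_iff ip_simps algebra_simps)

lemmas herm_simps = herm_add_left herm_add_right herm_diff_left herm_diff_right
  herm_minus_left herm_minus_right herm_scale_left herm_scale_right

lemma cnj_herm: "cnj (herm X Y) = herm Y X"
  by (simp add: herm_def complex_eq_iff ip_sym)

definition nsq :: "'u cpx \<Rightarrow> real" where
  "nsq X = ip (fst X) (fst X) + ip (snd X) (snd X)"

lemma herm_self: "herm X X = of_real (nsq X)"
  by (simp add: herm_def nsq_def complex_eq_iff ip_sym)

lemma ip_nonneg: "ip x x \<ge> 0"
  using ip_pos[of x] by (cases "x = 0") (auto simp: ip_simps)

lemma nsq_nonneg [simp]: "nsq X \<ge> 0"
  by (simp add: nsq_def ip_nonneg)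

lemma nsq_eq_0_iff [simp]: "nsq X = 0 \<longleftrightarrow> X = 0"
  using ip_pos[of "fst X"] ip_pos[of "snd X"] ip_nonneg[of "fst X"] ip_nonneg[of "snd X"]
  by (cases "fst X = 0"; cases "snd X = 0") (auto simp: nsq_def prod_eq_iff ip_simps)

lemma nsq_0 [simp]: "nsq 0 = 0"
  by simp

lemma nsq_pos: "X \<noteq> 0 \<Longrightarrow> nsq X > 0"
  using nsq_nonneg[of X] nsq_eq_0_iff[of X] by linarith

lemma herm_self_eq_0_iff [simp]: "herm X X = 0 \<longleftrightarrow> X = 0"
  by (simp add: herm_self)

text \<open>Used in two ways: conjugation-fixed elements act skew-adjointly, and for a root vector E
  the operators ad E and -ad(tau E) are mutually adjoint.\<close>

lemma herm_inv: "herm \<lbrace>Z,X\<rbrace> Y = - herm X \<lbrace>conjugation Z, Y\<rbrace>"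
proof -
  have *: "ip (br x y) z = - ip y (br x z)" for x y z using ip_inv[of x y z] by linarith
  show ?thesis
    by (simp add: herm_def cbr_def conjugation_def complex_eq_iff ip_simps br_simps *)
qed

end

section \<open>Cartan subalgebra, weight spaces and functionals imaginary on the compact
  form\<close>

locale cartan_pair = compact_form br ip for br :: "'u::real_vector \<Rightarrow> 'u \<Rightarrow> 'u" and ip +
  fixes h :: "'u cpx set"
  assumes cartan: "cartan_subalgebra br h"
    and conj_h: "conjugation ` h = h"
begin

abbreviation rs where "rs \<equiv> root_space br h"
abbreviation R where "R \<equiv> roots br h"

lemma subspace_h: "cx.subspace h"
  using cartan by (simp add: cartan_subalgebra_def subalgebra_def)

lemmas h_closed = cx.subspace_add[OF subspace_h] cx.subspace_diff[OF subspace_h]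
  cx.subspace_scale[OF subspace_h] cx.subspace_0[OF subspace_h] cx.subspace_neg[OF subspace_h]
  cx.subspace_sum[OF subspace_h]

lemma conj_in_h: "X \<in> h \<Longrightarrow> conjugation X \<in> h"
  using conj_h by blast

text \<open>A skew-adjoint operator has the same kernel as its square.\<close>

lemma herm_conj_fixed_kernel:
  assumes "conjugation Z = Z" "\<lbrace>Z, \<lbrace>Z,Y\<rbrace>\<rbrace> = 0"
  shows "\<lbrace>Z,Y\<rbrace> = 0"
  using herm_inv[of Z "\<lbrace>Z,Y\<rbrace>" Y] assms by simp

text \<open>Nilpotency of h makes ad Z nilpotent on h. For conjugation-fixed Z it is also
  skew-adjoint, hence zero there; a tau-stable h is spanned by such Z.\<close>

lemma h_commute:
  assumes "X \<in> h" "Y \<in> h"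
  shows "\<lbrace>X,Y\<rbrace> = 0"
proof -
  obtain n where n: "lower_central br h n = {0}"
    using cartan by (auto simp: cartan_subalgebra_def)
  have fixed: "\<lbrace>Z,Y\<rbrace> = 0" if Z: "Z \<in> h" "conjugation Z = Z" and Y: "Y \<in> h" for Z Y
  proof -
    have "(cbr br Z ^^ k) Y \<in> lower_central br h k" for k
    proof (induction k)
      case (Suc k)
      then show ?case using Z(1) unfolding lower_central.simps bracket_space_def funpow.simps o_apply
        by (intro cx.span_base CollectI exI[of _ Z] exI[of _ "(cbr br Z ^^ k) Y"]) simp
    qed (use Y in simp)
    then have "(cbr br Z ^^ Suc n) Y = 0" using n by (metis cb_zero_right funpow.simps(2) o_apply singletonD)
    then show ?thesis
    proof (induction n)
      case (Suc n)
      then show ?case using herm_conj_fixed_kernel[OF Z(2)] by simp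
    qed simp
  qed
  let ?a = "(1/2) *\<^sub>C (X + conjugation X)" and ?b = "(- \<i>/2) *\<^sub>C (X - conjugation X)"
  have X: "X = ?a + \<i> *\<^sub>C ?b"
    by (simp add: prod_eq_iff conjugation_def algebra_simps flip: scaleR_add_left)
  have "\<lbrace>?a,Y\<rbrace> = 0" "\<lbrace>?b,Y\<rbrace> = 0"
    using assms by (auto intro!: fixed h_closed conj_in_h simp: algebra_simps cx.scale_right_diff_distrib)
  then show ?thesis by (subst X) (simp only: cb_simps cx.scale_zero_right add_0)
qed

lemma centralizer_h:
  assumes "\<And>H. H \<in> h \<Longrightarrow> \<lbrace>H,X\<rbrace> = 0"
  shows "X \<in> h"
proof -
  have "X \<in> normalizer br h"
    using assms cb_anticomm[of X] h_closed(4) by (auto simp: normalizer_def)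
  then show ?thesis using cartan by (simp add: cartan_subalgebra_def)
qed

lemma root_space_0: "rs 0 = h"
  using h_commute centralizer_h by (auto simp: root_space_def)

lemma subspace_rs: "cx.subspace (rs \<alpha>)"
  by (rule cx.subspaceI) (auto simp: root_space_def cb_simps cx.scale_right_distrib mult.commute)

lemmas rs_closed = cx.subspace_add[OF subspace_rs] cx.subspace_diff[OF subspace_rs]
  cx.subspace_scale[OF subspace_rs] cx.subspace_0[OF subspace_rs] cx.subspace_neg[OF subspace_rs]

lemma rsD: "X \<in> rs \<alpha> \<Longrightarrow> H \<in> h \<Longrightarrow> \<lbrace>H,X\<rbrace> = \<alpha> H *\<^sub>C X"
  by (simp add: root_space_def)

lemma rs_bracket: "X \<in> rs \<alpha> \<Longrightarrow> Y \<in> rs \<beta> \<Longrightarrow> \<lbrace>X,Y\<rbrace> \<in> rs (\<alpha> + \<beta>)"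
  by (simp add: root_space_def cb_jacobi[of _ X Y] cb_simps cx.scale_left_distrib)

text \<open>The functionals that are imaginary on h \<inter> u. Unlike the set of roots it is closed
  under sums and contains 0, so weights such as \<alpha> - \<beta> can be treated before it is known
  whether they are roots.\<close>

definition rdual :: "('u cpx \<Rightarrow> complex) set" where
  "rdual = {\<alpha> \<in> dual h. \<forall>H\<in>h. \<alpha> (conjugation H) = - cnj (\<alpha> H)}"

lemma dual_add: "\<alpha> \<in> dual h \<Longrightarrow> X \<in> h \<Longrightarrow> Y \<in> h \<Longrightarrow> \<alpha> (X + Y) = \<alpha> X + \<alpha> Y"
  and dual_scale: "\<alpha> \<in> dual h \<Longrightarrow> X \<in> h \<Longrightarrow> \<alpha> (c *\<^sub>C X) = c * \<alpha> X"
  by (auto simp: dual_def)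

lemma dual_minus: "\<alpha> \<in> dual h \<Longrightarrow> X \<in> h \<Longrightarrow> \<alpha> (- X) = - \<alpha> X"
  using dual_scale[of \<alpha> X "-1"] by simp

lemma dual_diff: "\<alpha> \<in> dual h \<Longrightarrow> X \<in> h \<Longrightarrow> Y \<in> h \<Longrightarrow> \<alpha> (X - Y) = \<alpha> X - \<alpha> Y"
  using dual_add[of \<alpha> X "- Y"] dual_minus[of \<alpha> Y] h_closed(5)[of Y] by simp

lemma dual_zero: "\<alpha> \<in> dual h \<Longrightarrow> \<alpha> 0 = 0"
  using dual_scale[of \<alpha> 0 0] h_closed(4) by simp

lemma dual_sum:
  assumes "\<alpha> \<in> dual h" "\<And>x. x \<in> A \<Longrightarrow> f x \<in> h"
  shows "\<alpha> (sum f A) = (\<Sum>x\<in>A. \<alpha> (f x))"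
  using assms by (induction A rule: infinite_finite_induct) 
    (auto simp: dual_zero[OF assms(1)] dual_add[OF assms(1)] h_closed(6))

lemma dual_eqI: "\<alpha> \<in> dual h \<Longrightarrow> \<beta> \<in> dual h \<Longrightarrow> (\<And>H. H \<in> h \<Longrightarrow> \<alpha> H = \<beta> H) \<Longrightarrow> \<alpha> = \<beta>"
proof (rule ext)
  fix X assume *: "\<alpha> \<in> dual h" "\<beta> \<in> dual h" "\<And>H. H \<in> h \<Longrightarrow> \<alpha> H = \<beta> H"
  show "\<alpha> X = \<beta> X"
  proof (cases "X \<in> h")
    case False
    then show ?thesis using *(1,2) by (cases X) (simp add: dual_def)
  qed (rule *)
qed

lemma rdual_dual: "\<alpha> \<in> rdual \<Longrightarrow> \<alpha> \<in> dual h"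
  and rdual_conj: "\<alpha> \<in> rdual \<Longrightarrow> H \<in> h \<Longrightarrow> \<alpha> (conjugation H) = - cnj (\<alpha> H)"
  by (simp_all add: rdual_def)

lemma rdual_add: "\<alpha> \<in> rdual \<Longrightarrow> \<beta> \<in> rdual \<Longrightarrow> \<alpha> + \<beta> \<in> rdual"
  and rdual_diff: "\<alpha> \<in> rdual \<Longrightarrow> \<beta> \<in> rdual \<Longrightarrow> \<alpha> - \<beta> \<in> rdual"
  and rdual_minus: "\<alpha> \<in> rdual \<Longrightarrow> - \<alpha> \<in> rdual"
  and rdual_0: "0 \<in> rdual"
  by (auto simp: rdual_def dual_def algebra_simps)

lemma roots_rdual: "\<alpha> \<in> R \<Longrightarrow> \<alpha> \<in> rdual"
proof -
  assume "\<alpha> \<in> R"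
  then obtain X where X: "\<alpha> \<in> dual h" "X \<in> rs \<alpha>" "X \<noteq> 0"
    using rs_closed(4)[of \<alpha>] by (auto simp: roots_def)
  have "\<alpha> (conjugation H) = - cnj (\<alpha> H)" if "H \<in> h" for H
  proof -
    have "\<alpha> H * herm X X = - cnj (\<alpha> (conjugation H)) * herm X X"
      using herm_inv[of H X X] X that conj_in_h by (simp add: rsD herm_simps)
    then have "\<alpha> H = - cnj (\<alpha> (conjugation H))"
      using X(3) by (metis herm_self_eq_0_iff mult_right_cancel)
    then show ?thesis by simp
  qed
  then show ?thesis using X by (simp add: rdual_def)
qed

lemmas root_dual = rdual_dual[OF roots_rdual]

lemma rootI: "\<alpha> \<in> rdual \<Longrightarrow> \<alpha> \<noteq> 0 \<Longrightarrow> X \<in> rs \<alpha> \<Longrightarrow> X \<noteq> 0 \<Longrightarrow> \<alpha> \<in> R"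
  by (auto simp: roots_def rdual_dual)

lemma rs_orthogonal:
  assumes "\<alpha> \<in> rdual" "\<beta> \<in> rdual" "\<alpha> \<noteq> \<beta>" "X \<in> rs \<alpha>" "Y \<in> rs \<beta>"
  shows "herm X Y = 0"
proof -
  obtain H where H: "H \<in> h" "\<alpha> H \<noteq> \<beta> H" using assms dual_eqI rdual_dual by metis
  have "\<alpha> H * herm X Y = \<beta> H * herm X Y"
    using herm_inv[of H X Y] assms H conj_in_h by (simp add: rsD herm_simps rdual_conj[OF assms(2)])
  then show ?thesis using H by simp
qed

lemma rs_conj: "\<alpha> \<in> rdual \<Longrightarrow> X \<in> rs \<alpha> \<Longrightarrow> conjugation X \<in> rs (- \<alpha>)"
proof -
  assume a: "\<alpha> \<in> rdual" "X \<in> rs \<alpha>"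
  have "\<lbrace>H, conjugation X\<rbrace> = (- \<alpha> H) *\<^sub>C conjugation X" if "H \<in> h" for H
    using conjugation_cb[of "conjugation H" X] that a conj_in_h by (simp add: rsD rdual_conj[OF a(1)])
  then show ?thesis by (simp add: root_space_def)
qed

lemma bracket_opposite:
  assumes "X \<in> rs \<alpha>" "Y \<in> rs (- \<alpha>)"
  shows "\<lbrace>X,Y\<rbrace> \<in> h"
  using rs_bracket[OF assms] by (simp add: root_space_0)

text \<open>Up to a scalar, the bracket of opposite root vectors is the vector of h that represents
  \<alpha> through \<open>herm\<close>, whichever vectors are taken.\<close>

lemma herm_bracket_opposite:
  assumes "\<alpha> \<in> rdual" "X \<in> rs \<alpha>" "Y \<in> rs (- \<alpha>)" "H \<in> h"
  shows "herm \<lbrace>Y,X\<rbrace> H = cnj (\<alpha> H) * herm X (conjugation Y)"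
proof -
  have "conjugation Y \<in> rs \<alpha>" using rs_conj[OF rdual_minus[OF assms(1)] assms(3)] by simp
  then show ?thesis
    using assms herm_inv[of Y X H] cb_anticomm[of "conjugation Y" H]
    by (simp add: rsD herm_simps)
qed

lemma orth_h_eq: "X \<in> h \<Longrightarrow> (\<And>H. H \<in> h \<Longrightarrow> herm X H = 0) \<Longrightarrow> X = 0"
  using herm_self_eq_0_iff by blast

text \<open>T represents \<alpha> up to the factor |X|^2, so it is nonzero; pairing T with itself
  gives \<alpha>(T) = |T|^2 / |X|^2.\<close>

lemma conj_bracket_pos:
  assumes "\<alpha> \<in> R" "X \<in> rs \<alpha>" "X \<noteq> 0"
  defines "T \<equiv> \<lbrace>conjugation X, X\<rbrace>"
  shows "T \<in> h" "\<alpha> T = of_real (Re (\<alpha> T))" "Re (\<alpha> T) > 0"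
proof -
  note r = roots_rdual[OF assms(1)]
  show T: "T \<in> h"
    using bracket_opposite[OF rs_conj[OF r assms(2)]] assms(2) by (simp add: T_def)
  have eq: "herm T H = cnj (\<alpha> H) * herm X X" if "H \<in> h" for H
    using herm_bracket_opposite[OF r assms(2) rs_conj[OF r assms(2)] that] by (simp add: T_def)
  have "T \<noteq> 0"
  proof
    assume "T = 0"
    then have "\<alpha> H = 0 H" if "H \<in> h" for H using eq[OF that] assms(3) by simp
    then have "\<alpha> = 0" using dual_eqI[OF rdual_dual[OF r] rdual_dual[OF rdual_0]] by blast
    then show False using assms(1) by (simp add: roots_def)
  qed
  then have "nsq T > 0" "nsq X > 0" using assms(3) nsq_pos by auto
  moreover have "complex_of_real (nsq T) = cnj (\<alpha> T) * of_real (nsq X)"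
    using eq[OF T] by (simp add: herm_self)
  ultimately have "cnj (\<alpha> T) = of_real (nsq T / nsq X)"
    using assms(3) by (simp add: field_simps)
  then have "\<alpha> T = of_real (nsq T / nsq X)" by (metis complex_cnj_cnj complex_cnj_complex_of_real)
  then show "\<alpha> T = of_real (Re (\<alpha> T))" "Re (\<alpha> T) > 0"
    using \<open>nsq T > 0\<close> \<open>nsq X > 0\<close> by auto
qed

section \<open>Coroots, normalized root vectors and root strings\<close>

abbreviation Hc where "Hc \<equiv> coroot br h"

text \<open>Root spaces are not yet known to be lines, but their brackets already are: every
  [X', Y'] is a multiple of the one vector representing \<alpha>. This makes the definite
  description in \<open>coroot\<close> meaningful.\<close>

lemma coroot_eq:
  assumes "\<alpha> \<in> R" "X \<in> rs \<alpha>" "X \<noteq> 0"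
  shows "Hc \<alpha> = (2 / \<alpha> \<lbrace>conjugation X, X\<rbrace>) *\<^sub>C \<lbrace>conjugation X, X\<rbrace>"
proof -
  define T where "T = \<lbrace>conjugation X, X\<rbrace>"
  note r = roots_rdual[OF assms(1)]
  note T = conj_bracket_pos[OF assms, folded T_def]
  have nz: "\<alpha> T \<noteq> 0" using T by auto
  have in_span: "\<exists>c. Z = c *\<^sub>C T" if "Z \<in> bracket_space br (rs \<alpha>) (rs (- \<alpha>))" for Z
    using that unfolding bracket_space_def
  proof (induction rule: cx.span_induct_alt)
    case base
    show ?case by (rule exI[of _ 0]) simp
  next
    case (step c Z Y)
    then obtain X' Y' d where Z: "Z = \<lbrace>X',Y'\<rbrace>" "X' \<in> rs \<alpha>" "Y' \<in> rs (- \<alpha>)" and Y: "Y = d *\<^sub>C T"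
      by blast
    define e where "e = herm X' (conjugation Y') / herm X X"
    have "\<lbrace>Y',X'\<rbrace> - e *\<^sub>C T = 0"
    proof (rule orth_h_eq)
      show "\<lbrace>Y',X'\<rbrace> - e *\<^sub>C T \<in> h"
        using bracket_opposite[OF Z(2,3)] T cb_anticomm[of Y' X'] by (auto intro!: h_closed)
      fix H assume H: "H \<in> h"
      show "herm (\<lbrace>Y',X'\<rbrace> - e *\<^sub>C T) H = 0"
        using herm_bracket_opposite[OF r Z(2,3) H] herm_bracket_opposite[OF r assms(2) rs_conj[OF r assms(2)] H]
          assms(3) by (simp add: herm_simps T_def e_def)
    qed
    then have "Z = (- e) *\<^sub>C T" using cb_anticomm[of X' Y'] Z by simp
    then show ?case using Y
      by (auto intro!: exI[of _ "c * - e + d"] simp: cx.scale_left_distrib cx.scale_left_diff_distrib)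
  qed
  have "(THE H. H \<in> h \<and> H \<in> bracket_space br (rs \<alpha>) (rs (- \<alpha>)) \<and> \<alpha> H = 2) = (2 / \<alpha> T) *\<^sub>C T"
  proof (rule the_equality)
    have "- T \<in> bracket_space br (rs \<alpha>) (rs (- \<alpha>))"
      unfolding bracket_space_def T_def using assms(2) rs_conj[OF r assms(2)]
      by (subst cb_anticomm) (simp only: minus_minus, blast intro: cx.span_base)
    then have "T \<in> bracket_space br (rs \<alpha>) (rs (- \<alpha>))"
      unfolding bracket_space_def using cx.span_neg by fastforce
    then show "(2 / \<alpha> T) *\<^sub>C T \<in> h \<and> (2 / \<alpha> T) *\<^sub>C T \<in> bracket_space br (rs \<alpha>) (rs (- \<alpha>)) \<and>
        \<alpha> ((2 / \<alpha> T) *\<^sub>C T) = 2"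
      using T nz by (auto simp: h_closed bracket_space_def cx.span_scale dual_scale[OF rdual_dual[OF r]])
  next
    fix H assume "H \<in> h \<and> H \<in> bracket_space br (rs \<alpha>) (rs (- \<alpha>)) \<and> \<alpha> H = 2"
    moreover then obtain c where "H = c *\<^sub>C T" using in_span by blast
    ultimately have "c * \<alpha> T = 2" "H = c *\<^sub>C T"
      using T by (auto simp: dual_scale[OF rdual_dual[OF r]])
    then show "H = (2 / \<alpha> T) *\<^sub>C T" using nz by (simp add: field_simps)
  qed
  then show ?thesis by (simp add: coroot_def T_def)
qed

text \<open>The sign is that of a compact form: E, \<open>Hc\<close> and -F form an sl2-triple, so F
  is minus the usual opposite root vector.\<close>

definition E :: "('u cpx \<Rightarrow> complex) \<Rightarrow> 'u cpx" where
  "E \<alpha> = (SOME X. X \<in> rs \<alpha> \<and> X \<noteq> 0 \<and> \<lbrace>conjugation X, X\<rbrace> = Hc \<alpha>)"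

abbreviation F where "F \<alpha> \<equiv> conjugation (E \<alpha>)"

lemma E_exists:
  assumes "\<alpha> \<in> R"
  shows "\<exists>X. X \<in> rs \<alpha> \<and> X \<noteq> 0 \<and> \<lbrace>conjugation X, X\<rbrace> = Hc \<alpha>"
proof -
  obtain X where X: "X \<in> rs \<alpha>" "X \<noteq> 0"
    using assms rs_closed(4)[of \<alpha>] by (auto simp: roots_def)
  define r where "r = Re (\<alpha> \<lbrace>conjugation X, X\<rbrace>)"
  note T = conj_bracket_pos[OF assms X, folded r_def]
  \<comment> \<open>Rescaling by s multiplies the bracket by s^2, and \<open>r\<close> is the value
    of \<alpha> on it; s^2 = 2/r moves this value to 2.\<close>
  let ?Y = "complex_of_real (sqrt (2 / r)) *\<^sub>C X"
  have "\<lbrace>conjugation ?Y, ?Y\<rbrace> = (of_real (sqrt (2/r)) * of_real (sqrt (2/r))) *\<^sub>C \<lbrace>conjugation X, X\<rbrace>"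
    by (simp add: cb_simps del: of_real_mult)
  also have "(of_real (sqrt (2/r)) * of_real (sqrt (2/r)) :: complex) = 2 / of_real r"
    using T(3) by (simp flip: of_real_mult)
  also have "(2 / of_real r) *\<^sub>C \<lbrace>conjugation X, X\<rbrace> = Hc \<alpha>"
    using coroot_eq[OF assms X] T(2) by simp
  finally have "\<lbrace>conjugation ?Y, ?Y\<rbrace> = Hc \<alpha>" .
  moreover have "?Y \<noteq> 0" "?Y \<in> rs \<alpha>" using X T(3) rs_closed(3) by auto
  ultimately show ?thesis by blast
qed

lemma E_props:
  assumes "\<alpha> \<in> R"
  shows E_rs: "E \<alpha> \<in> rs \<alpha>" and E_nz: "E \<alpha> \<noteq> 0" and E_bracket: "\<lbrace>F \<alpha>, E \<alpha>\<rbrace> = Hc \<alpha>"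
  using someI_ex[OF E_exists[OF assms], folded E_def] by blast+

lemma F_rs: "\<alpha> \<in> R \<Longrightarrow> F \<alpha> \<in> rs (- \<alpha>)"
  by (simp add: E_rs rs_conj roots_rdual)

lemma Hc_in_h: "\<alpha> \<in> R \<Longrightarrow> Hc \<alpha> \<in> h"
  using bracket_opposite[OF F_rs, of \<alpha> "E \<alpha>"] E_rs[of \<alpha>] E_bracket[of \<alpha>] by simp

lemma conj_Hc: "\<alpha> \<in> R \<Longrightarrow> conjugation (Hc \<alpha>) = - Hc \<alpha>"
  using conjugation_cb[of "F \<alpha>" "E \<alpha>"] cb_anticomm[of "E \<alpha>" "F \<alpha>"] E_bracket[of \<alpha>] by simp

lemma root_Hc_self: "\<alpha> \<in> R \<Longrightarrow> \<alpha> (Hc \<alpha>) = 2"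
proof -
  assume a: "\<alpha> \<in> R"
  note T = conj_bracket_pos[OF a E_rs[OF a] E_nz[OF a]]
  have "\<alpha> \<lbrace>F \<alpha>, E \<alpha>\<rbrace> \<noteq> 0" using T(3) by auto
  then show ?thesis
    by (subst coroot_eq[OF a E_rs[OF a] E_nz[OF a]]) (simp add: dual_scale[OF root_dual[OF a] T(1)])
qed

lemma rdual_Hc_real: "\<mu> \<in> rdual \<Longrightarrow> \<alpha> \<in> R \<Longrightarrow> \<mu> (Hc \<alpha>) = of_real (Re (\<mu> (Hc \<alpha>)))"
  using rdual_conj[of \<mu> "Hc \<alpha>"] Hc_in_h[of \<alpha>] conj_Hc[of \<alpha>] dual_minus[OF rdual_dual, of \<mu> "Hc \<alpha>"]
  by (simp add: complex_eq_iff)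

text \<open>The relation [F, E] = \<open>Hc\<close> read through adjointness. A sign of \<mu>(Hc
  \<alpha>) thereby forces one of the two brackets to be nonzero.\<close>

lemma string_norm:
  assumes "\<mu> \<in> rdual" "\<alpha> \<in> R" "X \<in> rs \<mu>"
  shows "nsq \<lbrace>E \<alpha>, X\<rbrace> - nsq \<lbrace>F \<alpha>, X\<rbrace> = - Re (\<mu> (Hc \<alpha>)) * nsq X"
proof -
  define m where "m = Re (\<mu> (Hc \<alpha>))"
  have m: "\<mu> (Hc \<alpha>) = of_real m" using rdual_Hc_real[OF assms(1,2)] by (simp only: m_def)
  have "herm \<lbrace>E \<alpha>, X\<rbrace> \<lbrace>E \<alpha>, X\<rbrace> - herm \<lbrace>F \<alpha>, X\<rbrace> \<lbrace>F \<alpha>, X\<rbrace>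
     = herm X (\<lbrace>E \<alpha>, \<lbrace>F \<alpha>, X\<rbrace>\<rbrace> - \<lbrace>F \<alpha>, \<lbrace>E \<alpha>, X\<rbrace>\<rbrace>)"
    by (simp add: herm_inv herm_simps)
  also have "\<lbrace>E \<alpha>, \<lbrace>F \<alpha>, X\<rbrace>\<rbrace> - \<lbrace>F \<alpha>, \<lbrace>E \<alpha>, X\<rbrace>\<rbrace> = - \<lbrace>Hc \<alpha>, X\<rbrace>"
    using cb_anticomm[of "E \<alpha>" "F \<alpha>"] assms(2)
    by (simp add: cb_jacobi[of "E \<alpha>" "F \<alpha>"] E_bracket cb_simps)
  also have "herm X (- \<lbrace>Hc \<alpha>, X\<rbrace>) = - of_real m * herm X X"
    using assms Hc_in_h by (simp add: rsD herm_simps m)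
  finally show ?thesis
    unfolding herm_self of_real_diff[symmetric] of_real_minus[symmetric] of_real_mult[symmetric] of_real_eq_iff m_def .
qed

lemma string_down:
  assumes "\<mu> \<in> R" "\<alpha> \<in> R" "Re (\<mu> (Hc \<alpha>)) > 0" "\<mu> \<noteq> \<alpha>"
  shows "\<mu> - \<alpha> \<in> R"
proof -
  have "nsq \<lbrace>F \<alpha>, E \<mu>\<rbrace> = nsq \<lbrace>E \<alpha>, E \<mu>\<rbrace> + Re (\<mu> (Hc \<alpha>)) * nsq (E \<mu>)"
    using string_norm[OF roots_rdual[OF assms(1)] assms(2) E_rs[OF assms(1)]] by simp
  also have "\<dots> > 0" using assms nsq_pos[OF E_nz] by (simp add: add_nonneg_pos)
  finally have "\<lbrace>F \<alpha>, E \<mu>\<rbrace> \<noteq> 0" by auto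
  moreover have "\<lbrace>F \<alpha>, E \<mu>\<rbrace> \<in> rs (\<mu> - \<alpha>)"
    using rs_bracket[OF F_rs E_rs, OF assms(2,1)] by simp
  ultimately show ?thesis
    using assms by (intro rootI[of _ "\<lbrace>F \<alpha>, E \<mu>\<rbrace>"]) (auto intro: rdual_diff roots_rdual)
qed

lemma string_up:
  assumes "\<mu> \<in> R" "\<alpha> \<in> R" "Re (\<mu> (Hc \<alpha>)) < 0" "\<mu> + \<alpha> \<noteq> 0"
  shows "\<mu> + \<alpha> \<in> R"
proof -
  have "nsq \<lbrace>E \<alpha>, E \<mu>\<rbrace> = nsq \<lbrace>F \<alpha>, E \<mu>\<rbrace> + - Re (\<mu> (Hc \<alpha>)) * nsq (E \<mu>)"
    using string_norm[OF roots_rdual[OF assms(1)] assms(2) E_rs[OF assms(1)]] by simp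
  also have "\<dots> > 0" using assms nsq_pos[OF E_nz] by (intro add_nonneg_pos mult_pos_pos) auto
  finally have "\<lbrace>E \<alpha>, E \<mu>\<rbrace> \<noteq> 0" by auto
  moreover have "\<lbrace>E \<alpha>, E \<mu>\<rbrace> \<in> rs (\<mu> + \<alpha>)"
    using rs_bracket[OF E_rs E_rs, OF assms(2,1)] by (simp add: add.commute)
  ultimately show ?thesis
    using assms by (intro rootI[of _ "\<lbrace>E \<alpha>, E \<mu>\<rbrace>"]) (auto intro: rdual_add roots_rdual)
qed

text \<open>The vector of weight \<mu> has to come from below: X = [E, Y] with Y of weight \<mu> -
  \<alpha> is nonzero because \<mu> - \<alpha> is negative on the coroot, and [F, X] is nonzero by
  adjointness. The norm identity then carries the string one step further, even when \<mu>(Hc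
  \<alpha>) = 0.\<close>

lemma string_through:
  assumes "\<mu> \<in> R" "\<alpha> \<in> R" "\<mu> - \<alpha> \<in> R" "Re (\<mu> (Hc \<alpha>)) \<le> 0" "\<mu> + \<alpha> \<noteq> 0"
  shows "\<mu> + \<alpha> \<in> R"
proof -
  define Y where "Y = E (\<mu> - \<alpha>)"
  define X where "X = \<lbrace>E \<alpha>, Y\<rbrace>"
  have X: "X \<in> rs \<mu>" using rs_bracket[OF E_rs E_rs, OF assms(2,3)] by (simp add: X_def Y_def)
  have "nsq X = nsq \<lbrace>F \<alpha>, Y\<rbrace> + - Re ((\<mu> - \<alpha>) (Hc \<alpha>)) * nsq Y"
    using string_norm[OF roots_rdual[OF assms(3)] assms(2) E_rs[OF assms(3)]] by (simp add: X_def Y_def)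
  also have "\<dots> > 0" using assms nsq_pos[OF E_nz[OF assms(3)]]
    by (intro add_nonneg_pos mult_pos_pos) (auto simp: root_Hc_self Y_def)
  finally have nz: "X \<noteq> 0" by auto
  have "herm Y \<lbrace>F \<alpha>, X\<rbrace> = - herm X X" using herm_inv[of "E \<alpha>" Y X] by (simp add: X_def)
  with nz have FX: "\<lbrace>F \<alpha>, X\<rbrace> \<noteq> 0" by fastforce
  have "nsq \<lbrace>E \<alpha>, X\<rbrace> = nsq \<lbrace>F \<alpha>, X\<rbrace> + - Re (\<mu> (Hc \<alpha>)) * nsq X"
    using string_norm[OF roots_rdual[OF assms(1)] assms(2) X] by simp
  also have "\<dots> > 0" using assms nsq_pos[OF FX]
    by (intro add_pos_nonneg mult_nonneg_nonneg) auto
  finally have "\<lbrace>E \<alpha>, X\<rbrace> \<noteq> 0" by auto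
  moreover have "\<lbrace>E \<alpha>, X\<rbrace> \<in> rs (\<mu> + \<alpha>)"
    using rs_bracket[OF E_rs X, OF assms(2)] by (simp add: add.commute)
  ultimately show ?thesis
    using assms by (intro rootI[of _ "\<lbrace>E \<alpha>, X\<rbrace>"]) (auto intro: rdual_add roots_rdual)
qed

text \<open>The component Y orthogonal to E satisfies [F, Y] = 0, since this bracket lies in h and
  is orthogonal to h. The norm identity becomes |[E, Y]|^2 = -2 |Y|^2, so Y = 0.\<close>

lemma root_space_line:
  assumes "\<alpha> \<in> R" "X \<in> rs \<alpha>"
  shows "X = (herm X (E \<alpha>) / herm (E \<alpha>) (E \<alpha>)) *\<^sub>C E \<alpha>"
proof -
  define Y where "Y = X - (herm X (E \<alpha>) / herm (E \<alpha>) (E \<alpha>)) *\<^sub>C E \<alpha>"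
  note r = roots_rdual[OF assms(1)]
  have Y: "Y \<in> rs \<alpha>" unfolding Y_def using assms E_rs by (intro rs_closed) auto
  have orth: "herm Y (E \<alpha>) = 0" using E_nz[OF assms(1)] by (simp add: Y_def herm_simps)
  have "\<lbrace>F \<alpha>, Y\<rbrace> = 0"
  proof (rule orth_h_eq)
    show "\<lbrace>F \<alpha>, Y\<rbrace> \<in> h" using bracket_opposite[OF F_rs] Y assms(1) by simp
    show "herm \<lbrace>F \<alpha>, Y\<rbrace> H = 0" if "H \<in> h" for H
      using herm_bracket_opposite[OF r Y F_rs[OF assms(1)] that] orth by simp
  qed
  then have "nsq \<lbrace>E \<alpha>, Y\<rbrace> = - 2 * nsq Y"
    using string_norm[OF r assms(1) Y] assms(1) by (simp add: root_Hc_self)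
  then have "nsq Y = 0" using nsq_nonneg[of Y] nsq_nonneg[of "\<lbrace>E \<alpha>, Y\<rbrace>"] by linarith
  then show ?thesis by (simp add: Y_def)
qed

lemma roots_uminus: "\<alpha> \<in> R \<Longrightarrow> - \<alpha> \<in> R"
  using F_rs[of \<alpha>] E_nz[of \<alpha>] 
  by (intro rootI[of _ "F \<alpha>"]) (auto simp: rdual_minus roots_rdual, auto simp: roots_def)

lemma finite_roots: "finite R"
proof -
  obtain A :: "'u set" where A: "finite A" "span A = UNIV" using finite_spanning by blast
  obtain B :: "'u cpx set" where "finite_dimensional_vector_space cscale B" using dim_cpx(2)[OF A] by blast
  then have B: "finite B" "cx.span B = UNIV"
    by (simp_all add: finite_dimensional_vector_space.finite_Basis finite_dimensional_vector_space.span_Basis)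
  have orth: "herm (E \<alpha>) (E \<beta>) = 0" if "\<alpha> \<in> R" "\<beta> \<in> R" "\<alpha> \<noteq> \<beta>" for \<alpha> \<beta>
    using rs_orthogonal that E_rs roots_rdual by blast
  have inj: "inj_on E R"
    using orth E_nz by (metis inj_onI herm_self_eq_0_iff)
  have "cx.independent (E ` R)"
    unfolding cx.dependent_def
  proof
    assume "\<exists>a\<in>E ` R. a \<in> cx.span (E ` R - {a})"
    then obtain \<alpha> where \<alpha>: "\<alpha> \<in> R" "E \<alpha> \<in> cx.span (E ` R - {E \<alpha>})" by blast
    have "herm X (E \<alpha>) = 0" if "X \<in> cx.span (E ` R - {E \<alpha>})" for X
      using that
    proof (induction rule: cx.span_induct_alt)
      case (step c X Y)
      then have "herm X (E \<alpha>) = 0" using orth \<alpha>(1) by fastforce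
      with step show ?case by (simp add: herm_simps)
    qed simp
    from this[OF \<alpha>(2)] show False using E_nz \<alpha>(1) by simp
  qed
  then have "finite (E ` R)" using cx.independent_span_bound[OF B(1)] B(2) by auto
  then show ?thesis using inj finite_imageD by blast
qed

end

section \<open>Positive roots and the stem\<close>

locale positive_roots = cartan_pair br ip h
  for br :: "'u::real_vector \<Rightarrow> 'u \<Rightarrow> 'u" and ip and h :: "'u cpx set" +
  fixes P :: "('u cpx \<Rightarrow> complex) set"
  assumes positive: "positive_system br h P"
begin

lemma P_roots: "\<alpha> \<in> P \<Longrightarrow> \<alpha> \<in> R"
  and P_not_minus: "\<alpha> \<in> P \<Longrightarrow> - \<alpha> \<notin> P"
  and P_add: "\<alpha> \<in> P \<Longrightarrow> \<beta> \<in> P \<Longrightarrow> \<alpha> + \<beta> \<in> R \<Longrightarrow> \<alpha> + \<beta> \<in> P"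
  and roots_cases: "\<alpha> \<in> R \<Longrightarrow> \<alpha> \<in> P \<or> - \<alpha> \<in> P"
proof -
  have s: "P \<union> uminus ` P = R" "P \<inter> uminus ` P = {}" "\<forall>\<alpha>\<in>P. \<forall>\<beta>\<in>P. \<alpha> + \<beta> \<in> R \<longrightarrow> \<alpha> + \<beta> \<in> P"
    using positive unfolding positive_system_def by blast+
  show "\<alpha> \<in> P \<Longrightarrow> \<alpha> \<in> R" using s(1) by blast
  show "\<alpha> \<in> P \<Longrightarrow> - \<alpha> \<notin> P" using s(2) by force
  show "\<alpha> \<in> P \<Longrightarrow> \<beta> \<in> P \<Longrightarrow> \<alpha> + \<beta> \<in> R \<Longrightarrow> \<alpha> + \<beta> \<in> P" using s(3) by blast
  show "\<alpha> \<in> R \<Longrightarrow> \<alpha> \<in> P \<or> - \<alpha> \<in> P" unfolding s(1)[symmetric] by auto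
qed

lemma finite_P: "finite P"
  by (rule finite_subset[OF _ finite_roots]) (use P_roots in blast)

text \<open>Provides the order on roots: \<alpha> lies below \<alpha>' when \<alpha>' - \<alpha> is
  in \<open>psum\<close>. It is transitive by \<open>psum_add\<close> and irreflexive by
  \<open>psum_nonzero\<close>.\<close>

definition psum :: "('u cpx \<Rightarrow> complex) set" where
  "psum = {sum_list xs | xs. xs \<noteq> [] \<and> set xs \<subseteq> P}"

lemma psumI: "xs \<noteq> [] \<Longrightarrow> set xs \<subseteq> P \<Longrightarrow> sum_list xs \<in> psum"
  unfolding psum_def by blast

lemma P_psum: "\<alpha> \<in> P \<Longrightarrow> \<alpha> \<in> psum"
  unfolding psum_def by (intro CollectI exI[of _ "[\<alpha>]"]) simp

lemma psum_add: "\<sigma> \<in> psum \<Longrightarrow> \<rho> \<in> psum \<Longrightarrow> \<sigma> + \<rho> \<in> psum"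
proof -
  assume "\<sigma> \<in> psum" "\<rho> \<in> psum"
  then obtain xs ys where "\<sigma> = sum_list xs" "xs \<noteq> []" "set xs \<subseteq> P" "\<rho> = sum_list ys" "set ys \<subseteq> P"
    by (auto simp: psum_def)
  then show ?thesis unfolding psum_def by (intro CollectI exI[of _ "xs @ ys"]) simp
qed

lemma Re_sum_list_apply_nonpos:
  "(\<And>x. x \<in> set xs \<Longrightarrow> Re (x H) \<le> 0) \<Longrightarrow> Re (sum_list xs H) \<le> 0"
  by (induction xs) (auto simp: add_nonpos_nonpos)

lemma Re_sum_list_apply_nonneg:
  "(\<And>x. x \<in> set xs \<Longrightarrow> Re (x H) \<ge> 0) \<Longrightarrow> Re (sum_list xs H) \<ge> 0"
  by (induction xs) auto

text \<open>If \<open>x + y\<^sub>1 + \<dots> + y\<^sub>k = 0\<close>, some \<open>y\<^sub>i\<close> is negative on the coroot of \<open>x\<close>, so \<open>x + y\<^sub>i\<close> is a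
  positive root and the sum can be shortened.\<close>

lemma psum_nonzero: "0 \<notin> psum"
proof -
  have "sum_list xs \<noteq> 0" if "xs \<noteq> []" "set xs \<subseteq> P" for xs
    using that
  proof (induction "length xs" arbitrary: xs rule: less_induct)
    case less
    then obtain x ys where xs: "xs = x # ys" by (cases xs) auto
    have x: "x \<in> P" "x \<in> R" using less.prems xs P_roots by auto
    show ?case
    proof
      assume z: "sum_list xs = 0"
      have "(x + sum_list ys) (Hc x) = 0" using z xs by (simp add: zero_fun_def)
      then have "Re (sum_list ys (Hc x)) = -2" using root_Hc_self[OF x(2)]
        by (simp add: complex_eq_iff)
      then obtain y where y: "y \<in> set ys" "Re (y (Hc x)) < 0"
        using Re_sum_list_apply_nonneg[of ys "Hc x"] by force
      obtain as bs where ys: "ys = as @ y # bs" using y(1) split_list by metis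
      have yP: "y \<in> P" using y(1) less.prems xs by auto
      have "y + x \<noteq> 0" using P_not_minus[OF yP] x(1) by (metis add_eq_0_iff)
      then have "y + x \<in> P" using string_up[OF P_roots[OF yP] x(2) y(2)] P_add yP x by blast
      then have "sum_list ((y + x) # as @ bs) \<noteq> 0"
        using less.prems by (intro less.hyps) (auto simp: xs ys)
      moreover have "sum_list ((y + x) # as @ bs) = sum_list xs" by (simp add: xs ys algebra_simps)
      ultimately show False using z by simp
    qed
  qed
  then show ?thesis by (auto simp: psum_def)
qed

lemma psum_not_both: "\<sigma> \<in> psum \<Longrightarrow> - \<sigma> \<notin> psum"
  using psum_add[of \<sigma> "- \<sigma>"] psum_nonzero by auto

text \<open>The number of positive roots strictly below \<alpha>, a strictly monotone rank that
  yields maximal elements.\<close>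

definition height :: "('u cpx \<Rightarrow> complex) \<Rightarrow> nat" where
  "height \<alpha> = card {\<beta> \<in> P. \<alpha> - \<beta> \<in> psum}"

lemma height_less:
  assumes "\<alpha> \<in> P" "\<alpha>' - \<alpha> \<in> psum"
  shows "height \<alpha> < height \<alpha>'"
  unfolding height_def
proof (rule psubset_card_mono)
  have "\<alpha>' - \<beta> \<in> psum" if "\<alpha> - \<beta> \<in> psum" for \<beta>
    using psum_add[OF assms(2) that] by simp
  moreover have "\<alpha> \<notin> {\<beta> \<in> P. \<alpha> - \<beta> \<in> psum}" using psum_nonzero by simp
  ultimately show "{\<beta> \<in> P. \<alpha> - \<beta> \<in> psum} \<subset> {\<beta> \<in> P. \<alpha>' - \<beta> \<in> psum}"
    using assms by blast
qed (simp add: finite_P)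

lemma exists_maximal:
  assumes "T \<subseteq> P" "T \<noteq> {}"
  obtains \<sigma> where "\<sigma> \<in> T" "\<And>\<sigma>'. \<sigma>' \<in> T \<Longrightarrow> \<sigma>' - \<sigma> \<notin> psum"
proof -
  have fin: "finite (height ` T)" using assms finite_P finite_subset by blast
  then have "Max (height ` T) \<in> height ` T" using assms by (intro Max_in) auto
  then obtain \<sigma> where \<sigma>: "\<sigma> \<in> T" "height \<sigma> = Max (height ` T)" by fastforce
  have "\<sigma>' - \<sigma> \<notin> psum" if "\<sigma>' \<in> T" for \<sigma>'
  proof
    assume "\<sigma>' - \<sigma> \<in> psum"
    then have "height \<sigma> < height \<sigma>'" using height_less \<sigma> assms by blast
    moreover have "height \<sigma>' \<le> height \<sigma>" using that fin by (simp add: \<sigma>(2))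
    ultimately show False by simp
  qed
  with \<sigma> show ?thesis using that by blast
qed

end

section \<open>Strong orthogonality of the stem and the action of stem roots on
  \<open>Phi\<close>\<close>

locale stem_roots = positive_roots br ip h P
  for br :: "'u::real_vector \<Rightarrow> 'u \<Rightarrow> 'u" and ip and h :: "'u cpx set" and P +
  fixes \<Gamma> :: "('u cpx \<Rightarrow> complex) set"
  assumes stem: "is_stem P \<Gamma>"
begin

lemma stem_P: "\<gamma> \<in> \<Gamma> \<Longrightarrow> \<gamma> \<in> P"
  and stem_cases: "\<alpha> \<in> P \<Longrightarrow> \<alpha> \<in> \<Gamma> \<or> (\<exists>\<gamma>\<in>\<Gamma>. \<alpha> \<in> Phi P \<gamma>)"
  and stem_not_Phi: "\<alpha> \<in> \<Gamma> \<Longrightarrow> \<gamma> \<in> \<Gamma> \<Longrightarrow> \<alpha> \<notin> Phi P \<gamma>"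
proof -
  have s: "\<Gamma> \<subseteq> P" "P = \<Gamma> \<union> (\<Union>\<gamma>\<in>\<Gamma>. Phi P \<gamma>)" "\<Gamma> \<inter> (\<Union>\<gamma>\<in>\<Gamma>. Phi P \<gamma>) = {}"
    using stem by (simp_all only: is_stem_def)
  show "\<gamma> \<in> \<Gamma> \<Longrightarrow> \<gamma> \<in> P" using s(1) by blast
  show "\<alpha> \<in> P \<Longrightarrow> \<alpha> \<in> \<Gamma> \<or> (\<exists>\<gamma>\<in>\<Gamma>. \<alpha> \<in> Phi P \<gamma>)" by (subst (asm) s(2)) blast
  show "\<alpha> \<in> \<Gamma> \<Longrightarrow> \<gamma> \<in> \<Gamma> \<Longrightarrow> \<alpha> \<notin> Phi P \<gamma>" using s(3) by blast
qed

lemma Phi_disjoint: "\<gamma> \<in> \<Gamma> \<Longrightarrow> \<delta> \<in> \<Gamma> \<Longrightarrow> \<alpha> \<in> Phi P \<gamma> \<Longrightarrow> \<alpha> \<in> Phi P \<delta> \<Longrightarrow> \<gamma> = \<delta>"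
proof -
  have "disjoint_family_on (Phi P) \<Gamma>" using stem by (simp add: is_stem_def)
  then show "\<gamma> \<in> \<Gamma> \<Longrightarrow> \<delta> \<in> \<Gamma> \<Longrightarrow> \<alpha> \<in> Phi P \<gamma> \<Longrightarrow> \<alpha> \<in> Phi P \<delta> \<Longrightarrow> \<gamma> = \<delta>"
    unfolding disjoint_family_on_def by blast
qed

lemma Phi_iff: "\<alpha> \<in> Phi P \<gamma> \<longleftrightarrow> \<alpha> \<in> P \<and> \<gamma> - \<alpha> \<in> P"
  by (simp add: Phi_def)

lemmas stem_root = P_roots[OF stem_P]

lemma finite_stem: "finite \<Gamma>"
  by (rule finite_subset[OF _ finite_P]) (use stem_P in blast)

lemma stem_diff_not_root: "\<gamma> \<in> \<Gamma> \<Longrightarrow> \<delta> \<in> \<Gamma> \<Longrightarrow> \<gamma> - \<delta> \<notin> R"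
  using roots_cases[of "\<gamma> - \<delta>"] stem_not_Phi[of \<gamma> \<delta>] stem_not_Phi[of \<delta> \<gamma>] stem_P[of \<gamma>] stem_P[of \<delta>]
  by (auto simp: Phi_iff)

lemma stem_coroot_nonpos: "\<gamma> \<in> \<Gamma> \<Longrightarrow> \<delta> \<in> \<Gamma> \<Longrightarrow> \<gamma> \<noteq> \<delta> \<Longrightarrow> Re (\<gamma> (Hc \<delta>)) \<le> 0"
  using string_down[OF stem_root stem_root] stem_diff_not_root[of \<gamma> \<delta>] by force

text \<open>A root \<open>x\<close> as below would give an infinite ascending sequence \<open>x, x + \<epsilon>\<^sub>1, x + \<epsilon>\<^sub>1 + \<epsilon>\<^sub>2, \<dots>\<close>
  of positive roots with \<open>\<epsilon>\<^sub>i \<in> \<Gamma>\<close>.\<close>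

lemma not_positive_root:
  assumes x: "x \<notin> \<Gamma>"
    and neg: "\<And>\<epsilon>. \<epsilon> \<in> \<Gamma> \<Longrightarrow> \<epsilon> - x \<in> psum \<Longrightarrow> Re (x (Hc \<epsilon>)) \<le> 0"
  shows "x \<notin> P"
proof
  assume xP: "x \<in> P"
  define T where "T = {\<sigma> \<in> P. \<exists>xs. set xs \<subseteq> \<Gamma> \<and> \<sigma> = x + sum_list xs}"
  have "x \<in> T" unfolding T_def using xP by (auto intro!: exI[of _ "[]"])
  then obtain \<sigma> where \<sigma>: "\<sigma> \<in> T" and max: "\<And>\<sigma>'. \<sigma>' \<in> T \<Longrightarrow> \<sigma>' - \<sigma> \<notin> psum"
    using exists_maximal[of T] unfolding T_def by blast
  then obtain xs where xs: "set xs \<subseteq> \<Gamma>" "\<sigma> = x + sum_list xs" and \<sigma>P: "\<sigma> \<in> P" by (auto simp: T_def)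
  have sub: "sum_list xs \<in> psum" if "xs \<noteq> []"
    using that xs(1) stem_P by (intro psumI) auto
  \<comment> \<open>In both cases \<epsilon> lies above x, so \<open>neg\<close> controls the
    contribution of x; it remains to see that the summands of \<open>xs\<close> contribute nothing
    positive. The case \<epsilon> = \<sigma> serves to exclude that \<sigma> enters the
    stem.\<close>
  have le: "Re (\<sigma> (Hc \<epsilon>)) \<le> 0" if \<epsilon>: "\<epsilon> \<in> \<Gamma>" "\<epsilon> - \<sigma> \<in> psum \<or> \<epsilon> = \<sigma> \<and> xs \<noteq> []" for \<epsilon>
  proof -
    have e: "\<epsilon> - x = (\<epsilon> - \<sigma>) + sum_list xs" by (simp add: xs)
    have ex: "\<epsilon> - x \<in> psum" unfolding e using \<epsilon> sub psum_add[of "\<epsilon> - \<sigma>" "sum_list xs"] by (cases "xs = []") auto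
    have "Re (sum_list xs (Hc \<epsilon>)) \<le> 0"
    proof (rule Re_sum_list_apply_nonpos)
      fix g assume g: "g \<in> set xs"
      \<comment> \<open>A summand equal to \<epsilon> could be deleted from \<open>xs\<close>,
        leaving \<sigma> - \<epsilon> as a sum of positive roots; this excludes both alternatives
        for \<epsilon>.\<close>
      have "g \<noteq> \<epsilon>"
      proof
        assume "g = \<epsilon>"
        obtain as bs where ab: "xs = as @ g # bs" using g split_list by metis
        have "x + sum_list (as @ bs) \<in> psum"
        proof (cases "as @ bs = []")
          case False
          then have "sum_list (as @ bs) \<in> psum" using xs(1) ab stem_P by (intro psumI) auto
          then show ?thesis using psum_add P_psum[OF xP] by blast
        qed (use P_psum[OF xP] in simp)
        moreover have "x + sum_list (as @ bs) = - (\<epsilon> - \<sigma>)"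
          by (simp add: xs(2) ab \<open>g = \<epsilon>\<close> algebra_simps)
        ultimately have *: "- (\<epsilon> - \<sigma>) \<in> psum" by simp
        then have "\<epsilon> - \<sigma> \<notin> psum" using psum_not_both by fastforce
        with \<epsilon>(2) have "\<epsilon> = \<sigma>" by blast
        then show False using * psum_nonzero by simp
      qed
      then show "Re (g (Hc \<epsilon>)) \<le> 0" using stem_coroot_nonpos g xs \<epsilon> by blast
    qed
    then show ?thesis using neg[OF \<epsilon>(1) ex] by (simp add: xs)
  qed
  show False
  proof (cases "\<sigma> \<in> \<Gamma>")
    case True
    then have "xs \<noteq> []" using x xs by auto
    then show False using le[OF True] root_Hc_self[OF stem_root[OF True]] by simp
  next
    case False
    then obtain \<epsilon> where \<epsilon>: "\<epsilon> \<in> \<Gamma>" "\<epsilon> - \<sigma> \<in> P" using stem_cases[OF \<sigma>P] by (auto simp: Phi_iff)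
    \<comment> \<open>As \<sigma> - \<epsilon> is a root and the pairing is not positive, the
      \<epsilon>-string runs on through \<sigma>, so \<sigma> + \<epsilon> contradicts
      maximality.\<close>
    have "Re (\<sigma> (Hc \<epsilon>)) \<le> 0" using le \<epsilon> P_psum by blast
    moreover have "\<sigma> - \<epsilon> \<in> R" using roots_uminus[OF P_roots[OF \<epsilon>(2)]] by simp
    moreover have "\<sigma> + \<epsilon> \<noteq> 0"
      using psum_add[OF P_psum P_psum, OF \<sigma>P stem_P[OF \<epsilon>(1)]] psum_nonzero by auto
    ultimately have "\<sigma> + \<epsilon> \<in> P"
      using string_through P_add P_roots \<sigma>P stem_P \<epsilon>(1) by blast
    then have "\<sigma> + \<epsilon> \<in> T" using xs \<epsilon> by (auto simp: T_def intro!: exI[of _ "xs @ [\<epsilon>]"])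
    then show False using max[of "\<sigma> + \<epsilon>"] P_psum stem_P \<epsilon> by auto
  qed
qed

text \<open>Each stem root above \<gamma> + \<delta> differs from both summands, so each pairs
  nonpositively with its coroot. If the sum itself were in the stem, \<gamma> would belong to its
  \<open>Phi\<close>.\<close>

lemma stem_add_not_root:
  assumes "\<gamma> \<in> \<Gamma>" "\<delta> \<in> \<Gamma>" "\<gamma> \<noteq> \<delta>"
  shows "\<gamma> + \<delta> \<notin> R"
proof
  assume r: "\<gamma> + \<delta> \<in> R"
  have "\<gamma> + \<delta> \<notin> P"
  proof (rule not_positive_root)
    show "\<gamma> + \<delta> \<notin> \<Gamma>" using stem_not_Phi[OF assms(1), of "\<gamma> + \<delta>"] stem_P[OF assms(1)] stem_P[OF assms(2)] by (auto simp: Phi_iff)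
    fix \<epsilon> assume \<epsilon>: "\<epsilon> \<in> \<Gamma>" "\<epsilon> - (\<gamma> + \<delta>) \<in> psum"
    have "\<epsilon> \<noteq> \<gamma>" "\<epsilon> \<noteq> \<delta>"
      using \<epsilon>(2) psum_not_both[OF P_psum[OF stem_P[OF assms(1)]]] psum_not_both[OF P_psum[OF stem_P[OF assms(2)]]]
      by auto
    then show "Re ((\<gamma> + \<delta>) (Hc \<epsilon>)) \<le> 0"
      using stem_coroot_nonpos \<epsilon>(1) assms by (simp add: add_nonpos_nonpos)
  qed
  with r show False using P_add stem_P assms by blast
qed

lemma stem_orthogonal:
  assumes "\<gamma> \<in> \<Gamma>" "\<delta> \<in> \<Gamma>" "\<gamma> \<noteq> \<delta>"
  shows "\<gamma> (Hc \<delta>) = 0"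
proof -
  have "\<gamma> + \<delta> \<noteq> 0"
    using psum_add[OF P_psum P_psum, OF stem_P stem_P, OF assms(1,2)] psum_nonzero by auto
  then have "Re (\<gamma> (Hc \<delta>)) \<ge> 0"
    using string_up[OF stem_root stem_root, OF assms(1,2)] stem_add_not_root[OF assms] by force
  then have "Re (\<gamma> (Hc \<delta>)) = 0" using stem_coroot_nonpos[OF assms] by simp
  then show ?thesis
    using rdual_Hc_real[OF roots_rdual[OF stem_root[OF assms(1)]] stem_root[OF assms(2)]] by (metis of_real_0)
qed

text \<open>Again an application of \<open>not_positive_root\<close>: a stem root \<epsilon> above
  \<gamma> + \<alpha> is orthogonal to \<gamma>, and only a positive pairing with \<alpha> could do
  harm.\<close>

lemma Phi_add_not_root:
  assumes "\<gamma> \<in> \<Gamma>" "\<alpha> \<in> Phi P \<gamma>"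
  shows "\<gamma> + \<alpha> \<notin> R"
proof
  assume r: "\<gamma> + \<alpha> \<in> R"
  have \<alpha>: "\<alpha> \<in> P" using assms by (simp add: Phi_iff)
  have "\<gamma> + \<alpha> \<notin> P"
  proof (rule not_positive_root)
    show "\<gamma> + \<alpha> \<notin> \<Gamma>" using stem_not_Phi[OF assms(1), of "\<gamma> + \<alpha>"] stem_P[OF assms(1)] \<alpha> by (auto simp: Phi_iff)
    fix \<epsilon> assume \<epsilon>: "\<epsilon> \<in> \<Gamma>" "\<epsilon> - (\<gamma> + \<alpha>) \<in> psum"
    have ne: "\<epsilon> \<noteq> \<gamma>" using \<epsilon>(2) psum_not_both[OF P_psum[OF \<alpha>]] by auto
    have "\<not> Re (\<alpha> (Hc \<epsilon>)) > 0"
    proof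
      assume "Re (\<alpha> (Hc \<epsilon>)) > 0"
      moreover have "\<alpha> \<noteq> \<epsilon>" using assms stem_not_Phi \<epsilon> by blast
      ultimately have "\<alpha> - \<epsilon> \<in> R" using string_down P_roots \<alpha> stem_root \<epsilon>(1) by blast
      \<comment> \<open>The first alternative writes 0 as a sum of positive roots; the second puts
        \<alpha> into the disjoint sets \<open>Phi P \<epsilon>\<close> and
        \<open>Phi P \<gamma>\<close>.\<close>
      then consider "\<alpha> - \<epsilon> \<in> P" | "\<epsilon> - \<alpha> \<in> P" using roots_cases by fastforce
      then show False
      proof cases
        case 1
        have "(\<epsilon> - (\<gamma> + \<alpha>)) + (\<gamma> + (\<alpha> - \<epsilon>)) \<in> psum"
          using \<epsilon>(2) 1 P_psum stem_P assms(1) by (intro psum_add) auto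
        then show False using psum_nonzero by simp
      next
        case 2
        then have "\<alpha> \<in> Phi P \<epsilon>" using \<alpha> by (simp add: Phi_iff)
        then show False using Phi_disjoint assms \<epsilon> ne by blast
      qed
    qed
    then show "Re ((\<gamma> + \<alpha>) (Hc \<epsilon>)) \<le> 0"
      using stem_orthogonal[OF assms(1) \<epsilon>(1)] ne by simp
  qed
  with r show False using P_add stem_P assms \<alpha> by blast
qed

lemma Phi_reflect: "\<alpha> \<in> Phi P \<gamma> \<Longrightarrow> \<gamma> - \<alpha> \<in> Phi P \<gamma>"
  by (simp add: Phi_iff)

text \<open>Since \<gamma> + \<alpha> is neither zero nor a root, [E \<gamma>, X] = 0, and the
  Jacobi identity reduces the double bracket to [X, Hc \<gamma>].\<close>

lemma Phi_twice:
  assumes "\<gamma> \<in> \<Gamma>" "\<alpha> \<in> Phi P \<gamma>" "X \<in> rs \<alpha>"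
  shows "\<lbrace>conjugation \<lbrace>conjugation X, E \<gamma>\<rbrace>, E \<gamma>\<rbrace> = (- \<alpha> (Hc \<gamma>)) *\<^sub>C X"
proof -
  have r: "\<gamma> \<in> R" "\<alpha> \<in> R" using assms stem_root P_roots by (auto simp: Phi_iff)
  have EX: "\<lbrace>E \<gamma>, X\<rbrace> = 0"
  proof (rule ccontr)
    assume "\<lbrace>E \<gamma>, X\<rbrace> \<noteq> 0"
    moreover have "\<gamma> + \<alpha> \<noteq> 0"
      using psum_nonzero psum_add[OF P_psum P_psum, OF stem_P[OF assms(1)], of \<alpha>] assms(2) by (auto simp: Phi_iff)
    ultimately have "\<gamma> + \<alpha> \<in> R"
      using rs_bracket[OF E_rs[OF r(1)] assms(3)] r by (intro rootI) (auto intro: rdual_add roots_rdual)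
    then show False using Phi_add_not_root assms by blast
  qed
  have "\<lbrace>conjugation \<lbrace>conjugation X, E \<gamma>\<rbrace>, E \<gamma>\<rbrace> = - \<lbrace>E \<gamma>, \<lbrace>X, F \<gamma>\<rbrace>\<rbrace>"
    by (simp add: conjugation_cb cb_anticomm[of "\<lbrace>X, F \<gamma>\<rbrace>"])
  also have "\<dots> = \<lbrace>X, \<lbrace>F \<gamma>, E \<gamma>\<rbrace>\<rbrace>"
    using cb_anticomm[of "E \<gamma>" "F \<gamma>"] by (simp add: cb_jacobi[of "E \<gamma>" X] EX cb_simps)
  also have "\<dots> = - \<lbrace>Hc \<gamma>, X\<rbrace>" using r cb_anticomm[of X "Hc \<gamma>"] by (simp add: E_bracket)
  also have "\<dots> = (- \<alpha> (Hc \<gamma>)) *\<^sub>C X" using r Hc_in_h assms by (simp add: rsD)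
  finally show ?thesis .
qed

text \<open>Let A be the antilinear map X to [tau X, E \<gamma>]. By \<open>Phi_twice\<close>, A^2
  is -\<beta>(Hc \<gamma>) on weight \<beta> and \<beta>(Hc \<gamma>) - 2 on weight \<gamma> -
  \<beta>. As A commutes with A^2, these agree or A vanishes, so the value is 1 or 0; the values for
  \<alpha> and \<gamma> - \<alpha> add up to 2.\<close>

lemma Phi_coroot:
  assumes "\<gamma> \<in> \<Gamma>" "\<alpha> \<in> Phi P \<gamma>"
  shows "\<alpha> (Hc \<gamma>) = 1"
proof -
  have r: "\<gamma> \<in> R" using assms stem_root by blast
  have *: "\<beta> (Hc \<gamma>) = 0 \<or> \<beta> (Hc \<gamma>) = 1" if b: "\<beta> \<in> Phi P \<gamma>" for \<beta>
  proof -
    have b': "\<beta> \<in> R" using b P_roots by (auto simp: Phi_iff)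
    define X where "X = E \<beta>"
    define Y where "Y = \<lbrace>conjugation X, E \<gamma>\<rbrace>"
    have X: "X \<in> rs \<beta>" "X \<noteq> 0" using E_rs E_nz b' by (auto simp: X_def)
    have "conjugation X \<in> rs (- \<beta>)" using X rs_conj roots_rdual b' by blast
    then have Y: "Y \<in> rs (\<gamma> - \<beta>)" using rs_bracket[OF _ E_rs[OF r]] by (fastforce simp: Y_def)
    define b where "b = Re (\<beta> (Hc \<gamma>))"
    have b: "\<beta> (Hc \<gamma>) = of_real b" using rdual_Hc_real[OF roots_rdual[OF b'] r] by (simp only: b_def)
    have 1: "\<lbrace>conjugation Y, E \<gamma>\<rbrace> = (- of_real b) *\<^sub>C X"
      using Phi_twice[OF assms(1) that X(1)] by (simp add: Y_def b)
    \<comment> \<open>The third power of A at X, once as A applied to A^2 X and next as A^2 applied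
      to Y = A X.\<close>
    then have "\<lbrace>conjugation \<lbrace>conjugation Y, E \<gamma>\<rbrace>, E \<gamma>\<rbrace> = (- of_real b) *\<^sub>C Y"
      by (simp add: cb_simps Y_def)
    moreover have "\<lbrace>conjugation \<lbrace>conjugation Y, E \<gamma>\<rbrace>, E \<gamma>\<rbrace> = (- (2 - of_real b)) *\<^sub>C Y"
      using Phi_twice[OF assms(1) Phi_reflect[OF that] Y] root_Hc_self[OF r] by (simp add: b)
    ultimately have "Y = 0 \<or> complex_of_real b = 2 - of_real b"
      by (metis cx.scale_right_imp_eq neg_equal_iff_equal)
    then show ?thesis
    proof
      assume "Y = 0"
      then show ?thesis using 1 X b by simp
    next
      assume "complex_of_real b = 2 - of_real b"
      then have "2 * complex_of_real b = 2" by simp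
      then show ?thesis using b by simp
    qed
  qed
  from *[OF assms(2)] *[OF Phi_reflect[OF assms(2)]] root_Hc_self[OF r]
  show ?thesis by auto
qed

end

section \<open>Borel complex structures\<close>

lemma fst_complexify [simp]: "fst (complexify f X) = f (fst X)"
  and snd_complexify [simp]: "snd (complexify f X) = f (snd X)"
  by (simp_all add: complexify_def)

context
  fixes K :: "'u::real_vector \<Rightarrow> 'u"
  assumes K: "complex_structure K"
begin

lemma complexify_simps:
  "complexify K (X + Y) = complexify K X + complexify K Y"
  "complexify K (X - Y) = complexify K X - complexify K Y"
  "complexify K (- X) = - complexify K X"
  "complexify K (c *\<^sub>C X) = c *\<^sub>C complexify K X"
  "complexify K (conjugation X) = conjugation (complexify K X)"
  "complexify K (complexify K X) = - X"
proof -
  have l: "linear K" and s: "K (K x) = - x" for x using K by (auto simp: complex_structure_def)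
  note [simp] = linear_add[OF l] linear_diff[OF l] linear_neg[OF l] linear_scale[OF l] s
  show
    "complexify K (X + Y) = complexify K X + complexify K Y"
    "complexify K (X - Y) = complexify K X - complexify K Y"
    "complexify K (- X) = - complexify K X"
    "complexify K (c *\<^sub>C X) = c *\<^sub>C complexify K X"
    "complexify K (conjugation X) = conjugation (complexify K X)"
    "complexify K (complexify K X) = - X"
    by (simp_all add: prod_eq_iff conjugation_def)
qed

end

locale borel_structure = stem_roots br ip h P \<Gamma>
  for br :: "'u::real_vector \<Rightarrow> 'u \<Rightarrow> 'u" and ip and h :: "'u cpx set" and P \<Gamma> +
  fixes I :: "'u \<Rightarrow> 'u"
  assumes borel_structure: "borel_complex_structure br h P I"
begin

abbreviation Ic where "Ic \<equiv> complexify I"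
abbreviation M where "M \<equiv> m_plus I"
abbreviation nplus where "nplus \<equiv> nilradical br h P"

lemma structure_I: "complex_structure I"
  using borel_structure by (simp add: borel_complex_structure_def integrable_structure_def)

lemmas Ic_simps = complexify_simps[OF structure_I]

text \<open>\<open>prp\<close> and \<open>prm\<close> project onto \<open>M\<close> and its
  conjugate, the eigenspaces of I for i and -i; \<open>prp\<close> is the superscript + of the
  overview.\<close>

definition prp where "prp X = (1/2) *\<^sub>C (X - \<i> *\<^sub>C Ic X)"
definition prm where "prm X = (1/2) *\<^sub>C (X + \<i> *\<^sub>C Ic X)"

lemma prp_simps:
  "prp (X + Y) = prp X + prp Y" "prp (X - Y) = prp X - prp Y"
  "prp (- X) = - prp X" "prp (c *\<^sub>C X) = c *\<^sub>C prp X"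
  by (simp_all add: prp_def Ic_simps algebra_simps)

lemma prm_simps:
  "prm (X + Y) = prm X + prm Y" "prm (X - Y) = prm X - prm Y"
  "prm (- X) = - prm X" "prm (c *\<^sub>C X) = c *\<^sub>C prm X"
  by (simp_all add: prm_def Ic_simps algebra_simps)

lemma prp_0 [simp]: "prp 0 = 0" and prm_0 [simp]: "prm 0 = 0"
  using prp_simps(4)[of 0 0] prm_simps(4)[of 0 0] by simp_all

lemma prp_sum: "prp (sum f A) = (\<Sum>x\<in>A. prp (f x))"
  by (induction A rule: infinite_finite_induct) (auto simp: prp_simps)

lemma prp_add_prm: "prp X + prm X = X"
proof -
  have "prp X + prm X = (1/2) *\<^sub>C X + (1/2) *\<^sub>C X"
    by (simp add: prp_def prm_def cx.scale_right_distrib cx.scale_right_diff_distrib)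
  then show ?thesis by (simp flip: cx.scale_left_distrib)
qed

lemma conj_prp: "conjugation (prp X) = prm (conjugation X)"
  and conj_prm: "conjugation (prm X) = prp (conjugation X)"
  by (simp_all add: prp_def prm_def Ic_simps)

lemma M_iff: "X \<in> M \<longleftrightarrow> Ic X = \<i> *\<^sub>C X"
  by (simp add: m_plus_def)

lemma prm_eq_0_iff: "prm X = 0 \<longleftrightarrow> X \<in> M"
proof
  assume "prm X = 0"
  then have "\<i> *\<^sub>C Ic X = - X" by (simp add: prm_def add_eq_0_iff)
  then have "\<i> *\<^sub>C (\<i> *\<^sub>C Ic X) = \<i> *\<^sub>C (- X)" by simp
  then show "X \<in> M" by (simp add: M_iff)
qed (simp add: M_iff prm_def)

lemma prp_eq_0_iff: "prp X = 0 \<longleftrightarrow> conjugation X \<in> M"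
  by (simp flip: prm_eq_0_iff conj_prp)

lemma prp_M: "X \<in> M \<Longrightarrow> prp X = X"
  using prp_add_prm[of X] prm_eq_0_iff[of X] by simp

lemma prp_in_M: "prp X \<in> M"
  by (simp add: M_iff prp_def Ic_simps cx.scale_right_diff_distrib)

lemma subspace_M: "cx.subspace M"
  and M_bracket: "X \<in> M \<Longrightarrow> Y \<in> M \<Longrightarrow> \<lbrace>X,Y\<rbrace> \<in> M"
  using borel_structure
  by (auto simp: borel_complex_structure_def integrable_structure_def subalgebra_def)

lemmas M_closed = cx.subspace_add[OF subspace_M] cx.subspace_diff[OF subspace_M]
  cx.subspace_scale[OF subspace_M] cx.subspace_0[OF subspace_M] cx.subspace_neg[OF subspace_M]
  cx.subspace_sum[OF subspace_M]

lemma subspace_nplus: "cx.subspace nplus"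
  by (simp add: nilradical_def)

lemmas nplus_closed = cx.subspace_add[OF subspace_nplus] cx.subspace_diff[OF subspace_nplus]
  cx.subspace_scale[OF subspace_nplus] cx.subspace_0[OF subspace_nplus] cx.subspace_neg[OF subspace_nplus]
  cx.subspace_sum[OF subspace_nplus]

lemma rs_nplus: "\<alpha> \<in> P \<Longrightarrow> X \<in> rs \<alpha> \<Longrightarrow> X \<in> nplus"
  unfolding nilradical_def by (rule cx.span_base) blast

lemma E_nplus: "\<alpha> \<in> P \<Longrightarrow> E \<alpha> \<in> nplus"
  using rs_nplus E_rs P_roots by blast

lemma normalizer_M: "normalizer br M = borel br h P"
  using borel_structure by (simp add: borel_complex_structure_def)

lemma h_normalizes_M: "H \<in> h \<Longrightarrow> X \<in> M \<Longrightarrow> \<lbrace>H,X\<rbrace> \<in> M"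
proof -
  assume a: "H \<in> h" "X \<in> M"
  have "H \<in> borel br h P" unfolding borel_def using a nplus_closed(4) by force
  then show ?thesis using a by (simp add: normalizer_def flip: normalizer_M)
qed

text \<open>A subalgebra lies in its own normalizer, which here is the Borel subalgebra.\<close>

lemma M_borel: "X \<in> M \<Longrightarrow> \<exists>H N. X = H + N \<and> H \<in> h \<and> N \<in> nplus"
proof -
  assume "X \<in> M"
  then have "X \<in> normalizer br M" using M_bracket by (simp add: normalizer_def)
  then show ?thesis unfolding normalizer_M borel_def by blast
qed

lemma nplus_orth_h: "X \<in> nplus \<Longrightarrow> H \<in> h \<Longrightarrow> herm X H = 0"
  unfolding nilradical_def
proof (induction rule: cx.span_induct_alt)
  case (step c X Y)
  then obtain \<alpha> where "\<alpha> \<in> P" "X \<in> rs \<alpha>" by blast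
  moreover from this have "\<alpha> \<noteq> 0" using P_roots by (auto simp: roots_def)
  ultimately have "herm X H = 0"
    using rs_orthogonal[of \<alpha> 0 X H] step.prems roots_rdual P_roots rdual_0 by (auto simp: root_space_0)
  then show ?case using step by (simp add: herm_simps)
qed simp

lemma nplus_orth_rs_minus:
  assumes "X \<in> nplus" "\<beta> \<in> P" "Y \<in> rs (- \<beta>)"
  shows "herm X Y = 0"
  using assms(1) unfolding nilradical_def
proof (induction rule: cx.span_induct_alt)
  case (step c X Z)
  then obtain \<alpha> where \<alpha>: "\<alpha> \<in> P" "X \<in> rs \<alpha>" by blast
  have "\<alpha> \<noteq> - \<beta>" using \<alpha> assms P_not_minus by blast
  then have "herm X Y = 0"
    using rs_orthogonal[of \<alpha> "- \<beta>" X Y] \<alpha> assms roots_rdual P_roots rdual_minus by blast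
  then show ?case using step by (simp add: herm_simps)
qed simp

lemma nplus_orth_conj:
  assumes "X \<in> nplus" "Y \<in> nplus"
  shows "herm X (conjugation Y) = 0"
  using assms(2) unfolding nilradical_def
proof (induction rule: cx.span_induct_alt)
  case (step c Y Z)
  then obtain \<beta> where \<beta>: "\<beta> \<in> P" "Y \<in> rs \<beta>" by blast
  then have "conjugation Y \<in> rs (- \<beta>)" using rs_conj roots_rdual P_roots by blast
  then have "herm X (conjugation Y) = 0" using nplus_orth_rs_minus[OF assms(1) \<beta>(1)] by blast
  then show ?case using step by (simp add: herm_simps)
qed simp

lemma nplus_trivial:
  assumes "X \<in> nplus" "X = H + conjugation Y" "H \<in> h" "Y \<in> nplus"
  shows "X = 0"
proof -
  have "herm X X = herm X H + herm X (conjugation Y)" using assms(2) by (metis herm_add_right)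
  then show ?thesis using nplus_orth_h nplus_orth_conj assms by simp
qed

lemma triangular:
  obtains H N H' N' where "prp X = H + N" "prm X = conjugation H' + conjugation N'"
    "H \<in> h" "H' \<in> h" "N \<in> nplus" "N' \<in> nplus"
proof -
  obtain H N where 1: "prp X = H + N" "H \<in> h" "N \<in> nplus" using M_borel[OF prp_in_M] by blast
  obtain H' N' where 2: "prp (conjugation X) = H' + N'" "H' \<in> h" "N' \<in> nplus"
    using M_borel[OF prp_in_M] by blast
  then have "prm X = conjugation H' + conjugation N'"
    using conj_prp[of "conjugation X"] by simp
  with 1 2 show ?thesis using that by blast
qed

text \<open>Split both projections of H by the Borel subalgebra and its conjugate. The resulting
  element of \<open>nplus\<close> is also a sum of elements of h and of the conjugate of
  \<open>nplus\<close>, so it is orthogonal to itself.\<close>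

lemma prp_h: "H \<in> h \<Longrightarrow> prp H \<in> h"
proof -
  assume H: "H \<in> h"
  obtain H1 N H2 N' where d: "prp H = H1 + N" "prm H = conjugation H2 + conjugation N'"
    "H1 \<in> h" "H2 \<in> h" "N \<in> nplus" "N' \<in> nplus" using triangular by blast
  have eq: "N = (H - H1 - conjugation H2) + conjugation (- N')"
    using prp_add_prm[of H] d(1,2) by (simp add: algebra_simps)
  have "H - H1 - conjugation H2 \<in> h" by (intro h_closed(2) conj_in_h H d(3,4))
  then have "N = 0" using nplus_trivial[OF d(5) eq] nplus_closed(5)[OF d(6)] by blast
  then show ?thesis using d by simp
qed

lemma prm_h: "H \<in> h \<Longrightarrow> prm H \<in> h"
  using conj_in_h[OF prp_h[OF conj_in_h]] by (simp add: conj_prp)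

lemma Ic_h: "H \<in> h \<Longrightarrow> Ic H \<in> h"
proof -
  assume H: "H \<in> h"
  have "prm H - prp H = (\<i>/2) *\<^sub>C Ic H + (\<i>/2) *\<^sub>C Ic H"
    by (simp add: prm_def prp_def cx.scale_right_distrib cx.scale_right_diff_distrib)
  also have "\<dots> = \<i> *\<^sub>C Ic H" by (simp flip: cx.scale_left_distrib)
  finally have "Ic H = (- \<i>) *\<^sub>C (prm H - prp H)" by simp
  also have "\<dots> \<in> h" by (intro h_closed(2,3) prm_h prp_h H)
  finally show ?thesis .
qed

text \<open>Comparing triangular components shows that M contains E \<alpha> up to an element of h.
  Bracketing with the coroot, which normalizes M, removes that element and doubles E
  \<alpha>.\<close>

lemma E_in_M:
  assumes "\<alpha> \<in> P"
  shows "E \<alpha> \<in> M"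
proof -
  have r: "\<alpha> \<in> R" using assms P_roots by blast
  obtain H1 N H2 N' where d: "prp (E \<alpha>) = H1 + N" "prm (E \<alpha>) = conjugation H2 + conjugation N'"
    "H1 \<in> h" "H2 \<in> h" "N \<in> nplus" "N' \<in> nplus" using triangular by blast
  have eq: "E \<alpha> - N = (H1 + conjugation H2) + conjugation N'"
    using prp_add_prm[of "E \<alpha>"] d(1,2) by (simp add: algebra_simps)
  have "H1 + conjugation H2 \<in> h" by (intro h_closed(1) conj_in_h d(3,4))
  then have "E \<alpha> - N = 0"
    using nplus_trivial[OF nplus_closed(2)[OF E_nplus[OF assms] d(5)] eq _ d(6)] by blast
  then have "H1 + E \<alpha> \<in> M" using d(1) prp_in_M[of "E \<alpha>"] by simp
  then have "\<lbrace>Hc \<alpha>, H1 + E \<alpha>\<rbrace> \<in> M" using h_normalizes_M Hc_in_h r by blast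
  also have "\<lbrace>Hc \<alpha>, H1 + E \<alpha>\<rbrace> = 2 *\<^sub>C E \<alpha>"
    using d(3) rsD[OF E_rs[OF r] Hc_in_h[OF r]]
    by (simp add: cb_simps h_commute Hc_in_h[OF r] root_Hc_self[OF r])
  finally have "(1/2) *\<^sub>C (2 *\<^sub>C E \<alpha>) \<in> M" by (rule M_closed(3))
  then show ?thesis by simp
qed

lemma rs_scale_E: "\<alpha> \<in> R \<Longrightarrow> X \<in> rs \<alpha> \<Longrightarrow> \<exists>c. X = c *\<^sub>C E \<alpha>"
  using root_space_line by blast

lemma nplus_M: "X \<in> nplus \<Longrightarrow> X \<in> M"
proof -
  have "(\<Union>\<alpha>\<in>P. rs \<alpha>) \<subseteq> M"
    using rs_scale_E P_roots E_in_M M_closed(3) by fastforce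
  then show "X \<in> nplus \<Longrightarrow> X \<in> M"
    unfolding nilradical_def using cx.span_minimal[OF _ subspace_M] by blast
qed

lemma M_decomp:
  assumes "X \<in> M"
  obtains H N where "X = H + N" "H \<in> h" "H \<in> M" "N \<in> nplus"
proof -
  obtain H N where d: "X = H + N" "H \<in> h" "N \<in> nplus" using M_borel assms by blast
  then have "H = X - N" by simp
  then have "H \<in> M" using assms d nplus_M M_closed(2) by blast
  with d show ?thesis using that by blast
qed

text \<open>Since \<mu>(tau H) = -cnj(\<mu> H), vanishing on h \<inter> M passes to its conjugate,
  and the two spaces span h. Thus h \<inter> M, although only half of h, still detects nonzero
  weights.\<close>

lemma exists_prp_nonzero:
  assumes "\<mu> \<in> rdual" "\<mu> \<noteq> 0"
  obtains H where "H \<in> h" "H \<in> M" "\<mu> H \<noteq> 0"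
proof -
  have "\<exists>H\<in>h. \<mu> (prp H) \<noteq> 0"
  proof (rule ccontr)
    assume "\<not> (\<exists>H\<in>h. \<mu> (prp H) \<noteq> 0)"
    then have z: "\<mu> (prp H) = 0" if "H \<in> h" for H using that by blast
    have "\<mu> H = 0 H" if H: "H \<in> h" for H
    proof -
      have "\<mu> (prm H) = 0"
        using z[OF conj_in_h[OF H]] rdual_conj[OF assms(1) prm_h[OF H]] by (simp add: conj_prm)
      then have "\<mu> (prp H + prm H) = 0"
        using dual_add[OF rdual_dual[OF assms(1)] prp_h[OF H] prm_h[OF H]] z[OF H] by simp
      then show ?thesis by (simp add: prp_add_prm)
    qed
    then have "\<mu> = 0" using dual_eqI[OF rdual_dual[OF assms(1)] rdual_dual[OF rdual_0]] by blast
    then show False using assms by simp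
  qed
  then show ?thesis using that prp_h prp_in_M by blast
qed

definition cf where "cf \<alpha> X = herm X (E \<alpha>) / herm (E \<alpha>) (E \<alpha>)"

lemma cf_simps:
  "cf \<alpha> (X + Y) = cf \<alpha> X + cf \<alpha> Y" "cf \<alpha> (X - Y) = cf \<alpha> X - cf \<alpha> Y"
  "cf \<alpha> (- X) = - cf \<alpha> X" "cf \<alpha> (c *\<^sub>C X) = c * cf \<alpha> X" "cf \<alpha> 0 = 0"
  by (simp_all add: cf_def herm_simps add_divide_distrib diff_divide_distrib)

lemma cf_sum: "cf \<alpha> (sum f A) = (\<Sum>x\<in>A. cf \<alpha> (f x))"
  by (induction A rule: infinite_finite_induct) (auto simp: cf_simps)

lemma cf_E: "\<alpha> \<in> P \<Longrightarrow> \<beta> \<in> P \<Longrightarrow> cf \<alpha> (E \<beta>) = (if \<alpha> = \<beta> then 1 else 0)"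
  using E_nz[OF P_roots, of \<alpha>]
    rs_orthogonal[OF roots_rdual[OF P_roots, of \<beta>] roots_rdual[OF P_roots, of \<alpha>] _
      E_rs[OF P_roots, of \<beta>] E_rs[OF P_roots, of \<alpha>]]
  by (auto simp: cf_def)

lemma cf_h: "\<alpha> \<in> P \<Longrightarrow> H \<in> h \<Longrightarrow> cf \<alpha> H = 0"
  using nplus_orth_h[OF E_nplus, of \<alpha> H] cnj_herm[of "E \<alpha>" H] by (simp add: cf_def)

lemma cf_bracket: "\<alpha> \<in> P \<Longrightarrow> H \<in> h \<Longrightarrow> cf \<alpha> \<lbrace>H, X\<rbrace> = \<alpha> H * cf \<alpha> X"
  using E_rs[OF P_roots, of \<alpha>] conj_in_h[of H] rdual_conj[OF roots_rdual[OF P_roots, of \<alpha>], of H]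
  by (simp add: cf_def herm_inv rsD herm_simps)

lemma nplus_expansion:
  assumes "X \<in> nplus"
  shows "X = (\<Sum>\<alpha>\<in>P. cf \<alpha> X *\<^sub>C E \<alpha>)"
  using assms unfolding nilradical_def
proof (induction rule: cx.span_induct_alt)
  case base
  show ?case by (simp add: cf_simps)
next
  case (step c X Y)
  then obtain \<beta> where \<beta>: "\<beta> \<in> P" "X \<in> rs \<beta>" by blast
  then obtain d where X: "X = d *\<^sub>C E \<beta>" using rs_scale_E P_roots by blast
  have "(\<Sum>\<alpha>\<in>P. cf \<alpha> X *\<^sub>C E \<alpha>) = (\<Sum>\<alpha>\<in>P. if \<alpha> = \<beta> then X else 0)"
    using \<beta> by (intro sum.cong) (auto simp: X cf_simps cf_E)
  also have "\<dots> = X" using \<beta> finite_P by simp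
  finally have "(\<Sum>\<alpha>\<in>P. cf \<alpha> X *\<^sub>C E \<alpha>) = X" .
  moreover have "(\<Sum>\<alpha>\<in>P. cf \<alpha> (c *\<^sub>C X + Y) *\<^sub>C E \<alpha>)
     = c *\<^sub>C (\<Sum>\<alpha>\<in>P. cf \<alpha> X *\<^sub>C E \<alpha>) + (\<Sum>\<alpha>\<in>P. cf \<alpha> Y *\<^sub>C E \<alpha>)"
    by (simp add: cf_simps cx.scale_left_distrib sum.distrib cx.scale_sum_right)
  ultimately show ?case using step by simp
qed

text \<open>Only the components at positive roots are removed, so this is the h-component on
  \<open>M\<close> and on the Borel subalgebra, not on all of g.\<close>

definition hpart where "hpart X = X - (\<Sum>\<alpha>\<in>P. cf \<alpha> X *\<^sub>C E \<alpha>)"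

lemma hpart_simps:
  "hpart (X + Y) = hpart X + hpart Y" "hpart (c *\<^sub>C X) = c *\<^sub>C hpart X"
  by (simp_all add: hpart_def cf_simps cx.scale_left_distrib sum.distrib cx.scale_sum_right
      cx.scale_right_diff_distrib)

lemma hpart_nplus: "X \<in> nplus \<Longrightarrow> hpart X = 0"
  using nplus_expansion[of X] by (simp add: hpart_def)

lemma hpart_h: "H \<in> h \<Longrightarrow> hpart H = H"
  by (simp add: hpart_def cf_h)

lemma hpart_M: "X \<in> M \<Longrightarrow> hpart X \<in> h \<and> hpart X \<in> M \<and> X - hpart X \<in> nplus"
  by (erule M_decomp) (simp add: hpart_simps hpart_nplus hpart_h)

lemma M_cf_0: "X \<in> M \<Longrightarrow> (\<And>\<alpha>. \<alpha> \<in> P \<Longrightarrow> cf \<alpha> X = 0) \<Longrightarrow> X \<in> h"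
  using hpart_M[of X] by (simp add: hpart_def)

text \<open>The bracket is zero or a root vector for the negative root \<alpha> - \<beta>; the
  latter lies in the conjugate of \<open>nplus\<close>, hence of M, which \<open>prp\<close>
  annihilates.\<close>

lemma prp_bracket_F_E:
  assumes "\<alpha> \<in> P" "\<beta> \<in> P" "\<alpha> \<noteq> \<beta>" "\<alpha> - \<beta> \<notin> P" "Y \<in> rs \<alpha>" "X \<in> rs \<beta>"
  shows "prp \<lbrace>conjugation X, Y\<rbrace> = 0"
proof (cases "\<lbrace>conjugation X, Y\<rbrace> = 0")
  case False
  have "conjugation X \<in> rs (- \<beta>)" using assms rs_conj roots_rdual P_roots by blast
  then have 1: "\<lbrace>conjugation X, Y\<rbrace> \<in> rs (\<alpha> - \<beta>)" using rs_bracket assms(5) by fastforce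
  have d: "\<alpha> - \<beta> \<in> rdual" using assms P_roots roots_rdual rdual_diff by blast
  then have "\<alpha> - \<beta> \<in> R" using rootI[OF d _ 1 False] assms by simp
  then have "\<beta> - \<alpha> \<in> P" using roots_cases assms by fastforce
  moreover have "conjugation \<lbrace>conjugation X, Y\<rbrace> \<in> rs (\<beta> - \<alpha>)" using rs_conj[OF d 1] by simp
  ultimately show ?thesis using rs_nplus nplus_M prp_eq_0_iff by blast
qed simp

section \<open>Matching structures as quaternionic cocycles on M\<close>

text \<open>\<open>qstruct \<psi>\<close> characterises the restrictions \<open>\<psi> = \<tau> J\<close> to \<open>M\<close> of the structures \<open>J\<close> matching \<open>I\<close>;
  the last clause is the cocycle condition.\<close>

definition qstruct :: "('u cpx \<Rightarrow> 'u cpx) \<Rightarrow> bool" where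
  "qstruct \<psi> \<longleftrightarrow> (\<forall>X\<in>M. \<psi> X \<in> M \<and> \<psi> (\<psi> X) = - X \<and> (\<forall>c. \<psi> (c *\<^sub>C X) = cnj c *\<^sub>C \<psi> X) \<and>
     (\<forall>Y\<in>M. \<psi> (X + Y) = \<psi> X + \<psi> Y \<and>
        \<psi> \<lbrace>X,Y\<rbrace> = prp (\<lbrace>conjugation X, \<psi> Y\<rbrace> + \<lbrace>\<psi> X, conjugation Y\<rbrace>)))"

lemma matches_qstruct:
  assumes "matches br J I"
  shows "qstruct (\<lambda>X. conjugation (complexify J X))"
proof -
  have J: "complex_structure J" and sub: "subalgebra br (m_plus J)" and anti: "I (J x) = - J (I x)" for x
    using assms by (auto simp: matches_def integrable_structure_def)
  let ?J = "complexify J"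
  note Js = complexify_simps[OF J]
  have IJ: "Ic (?J X) = - ?J (Ic X)" for X by (simp add: prod_eq_iff anti)
  have JM: "conjugation (?J X) \<in> M" if "X \<in> M" for X
    using that by (simp add: M_iff Ic_simps IJ) (simp add: Js)
  have sub1: "?J \<lbrace>X,Y\<rbrace> = \<i> *\<^sub>C \<lbrace>X,Y\<rbrace>" if "?J X = \<i> *\<^sub>C X" "?J Y = \<i> *\<^sub>C Y" for X Y
    using sub that by (simp add: subalgebra_def m_plus_def)
  have sub2: "?J \<lbrace>X,Y\<rbrace> = (- \<i>) *\<^sub>C \<lbrace>X,Y\<rbrace>" if "?J X = (- \<i>) *\<^sub>C X" "?J Y = (- \<i>) *\<^sub>C Y" for X Y
  proof -
    have "?J (conjugation X) = \<i> *\<^sub>C conjugation X" "?J (conjugation Y) = \<i> *\<^sub>C conjugation Y"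
      using that by (simp_all add: Js)
    from sub1[OF this] have "?J (conjugation \<lbrace>X,Y\<rbrace>) = \<i> *\<^sub>C conjugation \<lbrace>X,Y\<rbrace>"
      by (simp add: conjugation_cb)
    then have "conjugation (?J (conjugation \<lbrace>X,Y\<rbrace>)) = conjugation (\<i> *\<^sub>C conjugation \<lbrace>X,Y\<rbrace>)" by simp
    then show ?thesis by (simp add: Js)
  qed
  \<comment> \<open>The vanishing Nijenhuis tensor. With A and B as below, A - iB is a bracket of
    vectors of the i-eigenspace and A + iB one of vectors of the -i-eigenspace; adding the two
    eigenvalue equations isolates J A = B.\<close>
  have nij: "?J (\<lbrace>X,Y\<rbrace> - \<lbrace>?J X, ?J Y\<rbrace>) = \<lbrace>X, ?J Y\<rbrace> + \<lbrace>?J X, Y\<rbrace>" for X Y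
  proof -
    define A where "A = \<lbrace>X,Y\<rbrace> - \<lbrace>?J X, ?J Y\<rbrace>"
    define B where "B = \<lbrace>X, ?J Y\<rbrace> + \<lbrace>?J X, Y\<rbrace>"
    have 1: "?J (A - \<i> *\<^sub>C B) = \<i> *\<^sub>C (A - \<i> *\<^sub>C B)"
      using sub1[of "X - \<i> *\<^sub>C ?J X" "Y - \<i> *\<^sub>C ?J Y"]
      by (simp add: A_def B_def Js cb_simps algebra_simps)
    have 2: "?J (A + \<i> *\<^sub>C B) = (- \<i>) *\<^sub>C (A + \<i> *\<^sub>C B)"
      using sub2[of "X + \<i> *\<^sub>C ?J X" "Y + \<i> *\<^sub>C ?J Y"]
      by (simp add: A_def B_def Js cb_simps algebra_simps)
    have "2 *\<^sub>C ?J A = ?J (A - \<i> *\<^sub>C B) + ?J (A + \<i> *\<^sub>C B)"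
      by (simp add: Js cx.scale_left_distrib[of 1 1, simplified])
    also have "\<dots> = 2 *\<^sub>C B" unfolding 1 2
      by (simp add: cx.scale_left_distrib[of 1 1, simplified] algebra_simps)
    finally show ?thesis by (simp add: A_def B_def)
  qed
  have coc: "conjugation (?J \<lbrace>X,Y\<rbrace>) =
      prp (\<lbrace>conjugation X, conjugation (?J Y)\<rbrace> + \<lbrace>conjugation (?J X), conjugation Y\<rbrace>)"
    if XY: "X \<in> M" "Y \<in> M" for X Y
  proof -
    \<comment> \<open>J maps the conjugate of M into M, so J [J X, J Y] lies in M and its conjugate
      drops out under \<open>prp\<close>. This is how the quadratic integrability condition becomes
      linear in J.\<close>
    have "conjugation \<lbrace>?J X, ?J Y\<rbrace> \<in> M"
      using M_bracket JM XY by (simp add: conjugation_cb)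
    then have "conjugation (?J (conjugation \<lbrace>?J X, ?J Y\<rbrace>)) \<in> M" by (rule JM)
    then have 1: "prp (conjugation (?J \<lbrace>?J X, ?J Y\<rbrace>)) = 0"
      by (simp add: Js prp_eq_0_iff)
    have 2: "prp (conjugation (?J \<lbrace>X,Y\<rbrace>)) = conjugation (?J \<lbrace>X,Y\<rbrace>)"
      using prp_M JM M_bracket XY by blast
    have "prp (conjugation (?J (\<lbrace>X,Y\<rbrace> - \<lbrace>?J X, ?J Y\<rbrace>))) = conjugation (?J \<lbrace>X,Y\<rbrace>)"
      using 1 2 by (simp add: Js prp_simps)
    then show ?thesis unfolding nij by (simp add: conjugation_cb)
  qed
  show ?thesis
    unfolding qstruct_def
  proof (intro ballI conjI allI)
    fix X c assume X: "X \<in> M"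
    show "conjugation (?J X) \<in> M" using JM X .
    show "conjugation (?J (conjugation (?J X))) = - X" by (simp add: Js)
    show "conjugation (?J (c *\<^sub>C X)) = cnj c *\<^sub>C conjugation (?J X)" by (simp add: Js)
    fix Y assume Y: "Y \<in> M"
    show "conjugation (?J (X + Y)) = conjugation (?J X) + conjugation (?J Y)" by (simp add: Js)
    show "conjugation (?J \<lbrace>X,Y\<rbrace>) =
      prp (\<lbrace>conjugation X, conjugation (?J Y)\<rbrace> + \<lbrace>conjugation (?J X), conjugation Y\<rbrace>)"
      by (rule coc[OF X Y])
  qed
qed

text \<open>The vanishing of the Nijenhuis tensor on M has components in M and in its conjugate. The
  cocycle identity at X, Y gives one of them, and at \<psi> X, \<psi> Y, through \<psi>^2 = -1, the
  other.\<close>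

lemma qstruct_admissible:
  assumes "qstruct \<psi>"
  shows "admissible br I"
proof -
  have \<psi>: "\<psi> X \<in> M" "\<psi> (\<psi> X) = - X" "\<psi> (c *\<^sub>C X) = cnj c *\<^sub>C \<psi> X" if "X \<in> M" for X c
    using assms that by (auto simp: qstruct_def)
  have \<psi>_add: "\<psi> (X + Y) = \<psi> X + \<psi> Y"
    and coc: "\<psi> \<lbrace>X,Y\<rbrace> = prp (\<lbrace>conjugation X, \<psi> Y\<rbrace> + \<lbrace>\<psi> X, conjugation Y\<rbrace>)"
    if "X \<in> M" "Y \<in> M" for X Y
    using assms that by (auto simp: qstruct_def)
  have l: "linear I" and s: "I (I x) = - x" for x using structure_I by (auto simp: complex_structure_def)
  \<comment> \<open>The real isomorphism x to x - i I x from u onto M, with inverse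
    \<open>fst\<close>; it transports \<psi> to u.\<close>
  define p where "p x = (x, - I x)" for x
  define J where "J x = fst (\<psi> (p x))" for x
  have pM: "p x \<in> M" for x by (simp add: M_iff p_def prod_eq_iff s linear_neg[OF l])
  have p_fst: "p (fst X) = X" if "X \<in> M" for X
  proof -
    have "I (fst X) = - snd X" using that by (simp add: M_iff prod_eq_iff)
    then show ?thesis by (simp add: p_def)
  qed
  have pJ: "p (J x) = \<psi> (p x)" for x unfolding J_def using p_fst \<psi> pM by blast
  have p_add: "p (x + y) = p x + p y" for x y by (simp add: p_def linear_add[OF l])
  have p_scale: "p (r *\<^sub>R x) = of_real r *\<^sub>C p x" for r x
    by (simp add: p_def prod_eq_iff linear_scale[OF l])
  have p_I: "p (I x) = \<i> *\<^sub>C p x" for x by (simp add: p_def prod_eq_iff s)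
  have p_inj: "x = y" if "p x = p y" for x y using that by (simp add: p_def)
  have lJ: "linear J"
    by (rule linearI) (simp_all add: J_def p_add \<psi>_add pM p_scale \<psi>(3))
  have JJ: "J (J x) = - x" for x
    by (rule p_inj) (simp add: pJ \<psi> pM, simp add: p_def linear_neg[OF l])
  have IJ: "I (J x) = - J (I x)" for x
  proof (rule p_inj)
    have "p (- J (I x)) = - p (J (I x))" by (simp add: p_def linear_neg[OF l])
    then show "p (I (J x)) = p (- J (I x))" by (simp add: p_I pJ \<psi> pM)
  qed
  have csJ: "complex_structure J" using lJ JJ by (simp add: complex_structure_def)
  note Js = complexify_simps[OF csJ]
  let ?J = "complexify J"
  have J_M: "?J X = conjugation (\<psi> X)" if "X \<in> M" for X
  proof -
    have "?J X = ?J (p (fst X))" using p_fst that by simp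
    also have "\<dots> = conjugation (p (J (fst X)))"
      using IJ[of "fst X"] by (simp add: p_def prod_eq_iff conjugation_def linear_neg[OF lJ])
    also have "\<dots> = conjugation (\<psi> X)" using p_fst that by (simp add: pJ)
    finally show ?thesis .
  qed
  have IJc: "Ic (?J X) = - ?J (Ic X)" for X by (simp add: prod_eq_iff IJ)
  have prp_J: "prp (?J X) = ?J (prm X)" and prm_J: "prm (?J X) = ?J (prp X)" for X
    by (simp_all add: prp_def prm_def IJc Js)
  have nij: "?J (\<lbrace>X,Y\<rbrace> - \<lbrace>?J X, ?J Y\<rbrace>) = \<lbrace>X, ?J Y\<rbrace> + \<lbrace>?J X, Y\<rbrace>" if XY: "X \<in> M" "Y \<in> M" for X Y
  proof -
    define B where "B = \<lbrace>X, ?J Y\<rbrace> + \<lbrace>?J X, Y\<rbrace>"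
    have "prp (conjugation B) = \<psi> \<lbrace>X,Y\<rbrace>"
      using XY by (simp add: B_def conjugation_cb J_M coc)
    then have 1: "prm B = ?J \<lbrace>X,Y\<rbrace>"
      using conj_prp[of "conjugation B"] J_M M_bracket XY by simp
    have "\<psi> \<lbrace>\<psi> X, \<psi> Y\<rbrace> = - prp B"
      using XY by (simp add: coc \<psi> B_def cb_simps J_M) (simp add: prp_simps)
    moreover have "?J \<lbrace>?J X, ?J Y\<rbrace> = \<psi> \<lbrace>\<psi> X, \<psi> Y\<rbrace>"
      using XY \<psi> M_bracket by (simp add: J_M Js flip: conjugation_cb)
    ultimately have "?J (\<lbrace>X,Y\<rbrace> - \<lbrace>?J X, ?J Y\<rbrace>) = prm B + prp B" by (simp add: Js 1)
    then show ?thesis using prp_add_prm[of B] by (simp add: B_def add.commute)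
  qed
  \<comment> \<open>The i-eigenspace of J is a graph over M, so closure under brackets only concerns
    arguments from M.\<close>
  have graph: "Z = prp Z - \<i> *\<^sub>C ?J (prp Z)" if "Z \<in> m_plus J" for Z
  proof -
    have "?J Z = \<i> *\<^sub>C Z" using that by (simp add: m_plus_def)
    then have "?J (prp Z) = \<i> *\<^sub>C prm Z" by (simp add: prm_simps flip: prm_J)
    then show ?thesis using prp_add_prm[of Z] by simp
  qed
  have "\<lbrace>Z,Z'\<rbrace> \<in> m_plus J" if Z: "Z \<in> m_plus J" "Z' \<in> m_plus J" for Z Z'
  proof -
    define X where "X = prp Z"
    define Y where "Y = prp Z'"
    define A where "A = \<lbrace>X,Y\<rbrace> - \<lbrace>?J X, ?J Y\<rbrace>"
    define B where "B = \<lbrace>X, ?J Y\<rbrace> + \<lbrace>?J X, Y\<rbrace>"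
    have AB: "?J A = B" unfolding A_def B_def X_def Y_def by (intro nij prp_in_M)
    then have BA: "?J B = - A" using Js(6)[of A] by simp
    have "\<lbrace>Z,Z'\<rbrace> = \<lbrace>X - \<i> *\<^sub>C ?J X, Y - \<i> *\<^sub>C ?J Y\<rbrace>"
      using graph[OF Z(1)] graph[OF Z(2)] by (simp add: X_def Y_def)
    also have "\<dots> = A - \<i> *\<^sub>C B" by (simp add: A_def B_def cb_simps algebra_simps)
    finally show ?thesis by (simp add: m_plus_def Js AB BA cx.scale_right_diff_distrib)
  qed
  moreover have "cx.subspace (m_plus J)"
    by (rule cx.subspaceI) (auto simp: m_plus_def Js algebra_simps, simp add: prod_eq_iff linear_0[OF lJ])
  ultimately have "matches br J I"
    using csJ IJ by (simp add: matches_def integrable_structure_def subalgebra_def)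
  then show ?thesis by (auto simp: admissible_def)
qed

section \<open>Necessity\<close>

text \<open>Through \<open>prp\<close>, M is the quotient of g by the conjugate of M. The action of
  tau X descends to this quotient, which is the coefficient module of the cocycles.\<close>

lemma prp_conj_bracket: "X \<in> M \<Longrightarrow> prp \<lbrace>conjugation X, prp Z\<rbrace> = prp \<lbrace>conjugation X, Z\<rbrace>"
proof -
  assume X: "X \<in> M"
  have "conjugation (prm Z) \<in> M" by (simp add: conj_prm prp_in_M)
  then have "prp \<lbrace>conjugation X, prm Z\<rbrace> = 0"
    using M_bracket[OF X] by (simp add: prp_eq_0_iff conjugation_cb)
  moreover have "prp \<lbrace>conjugation X, Z\<rbrace> = prp \<lbrace>conjugation X, prp Z + prm Z\<rbrace>"
    by (simp only: prp_add_prm)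
  ultimately show ?thesis by (simp add: cb_simps prp_simps)
qed

text \<open>The 0-cochain w has coboundary X to
  \<open>prp \<lbrace>conjugation X, w\<rbrace>\<close>; that it is a cocycle is the Jacobi identity
  in the quotient module.\<close>

lemma coboundary:
  assumes "X \<in> M" "Y \<in> M"
  shows "prp \<lbrace>conjugation \<lbrace>X,Y\<rbrace>, w\<rbrace> =
    prp (\<lbrace>conjugation X, prp \<lbrace>conjugation Y, w\<rbrace>\<rbrace> + \<lbrace>prp \<lbrace>conjugation X, w\<rbrace>, conjugation Y\<rbrace>)"
proof -
  have "\<lbrace>prp \<lbrace>conjugation X, w\<rbrace>, conjugation Y\<rbrace> = - \<lbrace>conjugation Y, prp \<lbrace>conjugation X, w\<rbrace>\<rbrace>"
    by (rule cb_anticomm)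
  then have "prp (\<lbrace>conjugation X, prp \<lbrace>conjugation Y, w\<rbrace>\<rbrace> + \<lbrace>prp \<lbrace>conjugation X, w\<rbrace>, conjugation Y\<rbrace>)
     = prp (\<lbrace>conjugation X, \<lbrace>conjugation Y, w\<rbrace>\<rbrace> - \<lbrace>conjugation Y, \<lbrace>conjugation X, w\<rbrace>\<rbrace>)"
    using assms by (simp add: prp_simps prp_conj_bracket)
  also have "\<lbrace>conjugation X, \<lbrace>conjugation Y, w\<rbrace>\<rbrace> - \<lbrace>conjugation Y, \<lbrace>conjugation X, w\<rbrace>\<rbrace>
     = \<lbrace>conjugation \<lbrace>X,Y\<rbrace>, w\<rbrace>"
    using cb_jacobi[of "conjugation X" "conjugation Y" w] by (simp add: conjugation_cb)
  finally show ?thesis by simp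
qed

lemma prp_conj_nplus: "X \<in> nplus \<Longrightarrow> prp (conjugation X) = 0"
  by (simp add: prp_eq_0_iff nplus_M)

lemma bracket_h_F: "\<alpha> \<in> P \<Longrightarrow> H \<in> h \<Longrightarrow> \<lbrace>H, F \<alpha>\<rbrace> = (- \<alpha> H) *\<^sub>C F \<alpha>"
  using rsD[OF F_rs[OF P_roots]] by simp

lemma bracket_h_nplus:
  assumes "w \<in> nplus" "H \<in> h"
  shows "\<lbrace>H, w\<rbrace> \<in> nplus"
  using assms(1) unfolding nilradical_def
proof (induction rule: cx.span_induct_alt)
  case (step c X Y)
  then obtain \<alpha> where "\<alpha> \<in> P" "X \<in> rs \<alpha>" by blast
  then have "(c * \<alpha> H) *\<^sub>C X \<in> nplus" "\<lbrace>H, c *\<^sub>C X\<rbrace> = (c * \<alpha> H) *\<^sub>C X"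
    using rsD[of X \<alpha> H] assms(2) nplus_closed(3) rs_nplus by (auto simp: cb_simps)
  then have "\<lbrace>H, c *\<^sub>C X\<rbrace> \<in> cx.span (\<Union> (rs ` P))" by (simp add: nilradical_def)
  then show ?case using step by (simp add: cb_simps cx.span_add)
qed (simp add: cx.span_zero)

section \<open>Solving the cocycle equation on the Borel part\<close>

context
  fixes \<psi>
  assumes \<psi>: "qstruct \<psi>"
begin

lemma \<psi>_M: "X \<in> M \<Longrightarrow> \<psi> X \<in> M"
  and \<psi>_\<psi>: "X \<in> M \<Longrightarrow> \<psi> (\<psi> X) = - X"
  and \<psi>_scale: "X \<in> M \<Longrightarrow> \<psi> (c *\<^sub>C X) = cnj c *\<^sub>C \<psi> X"
  and \<psi>_add: "X \<in> M \<Longrightarrow> Y \<in> M \<Longrightarrow> \<psi> (X + Y) = \<psi> X + \<psi> Y"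
  and \<psi>_bracket: "X \<in> M \<Longrightarrow> Y \<in> M \<Longrightarrow>
    \<psi> \<lbrace>X,Y\<rbrace> = prp (\<lbrace>conjugation X, \<psi> Y\<rbrace> + \<lbrace>\<psi> X, conjugation Y\<rbrace>)"
  using \<psi> unfolding qstruct_def by blast+

lemma \<psi>_0: "\<psi> 0 = 0"
  using \<psi>_scale[of 0 0] M_closed(4) by simp

text \<open>\<open>\<psi>\<close> is a cocycle on \<open>M\<close>, and on a component of nonzero weight every cocycle is a coboundary.\<close>

lemma exists_w_h:
  obtains w where "w \<in> nplus" "\<And>H. H \<in> h \<Longrightarrow> H \<in> M \<Longrightarrow> \<psi> H - \<lbrace>conjugation H, w\<rbrace> \<in> h"
proof -
  have "\<exists>H. H \<in> h \<and> H \<in> M \<and> \<alpha> (conjugation H) \<noteq> 0" if a: "\<alpha> \<in> P" for \<alpha>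
  proof -
    have r: "\<alpha> \<in> rdual" "\<alpha> \<noteq> 0" using a P_roots roots_rdual by (auto simp: roots_def)
    obtain H where "H \<in> h" "H \<in> M" "\<alpha> H \<noteq> 0" using exists_prp_nonzero[OF r] by blast
    then show ?thesis using rdual_conj[OF r(1), of H] by (intro exI[of _ H]) simp
  qed
  \<comment> \<open>For each \<alpha> one test element of h \<inter> M that sees \<alpha> after
    conjugation; the \<alpha>-coefficient of w is read off from \<psi> there.\<close>
  then obtain T where T: "T \<alpha> \<in> h" "T \<alpha> \<in> M" "\<alpha> (conjugation (T \<alpha>)) \<noteq> 0" if "\<alpha> \<in> P" for \<alpha>
    by metis
  define v where "v \<alpha> = cf \<alpha> (\<psi> (T \<alpha>)) / \<alpha> (conjugation (T \<alpha>))" for \<alpha>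
  define w where "w = (\<Sum>\<alpha>\<in>P. v \<alpha> *\<^sub>C E \<alpha>)"
  have w: "w \<in> nplus" unfolding w_def by (intro nplus_closed(3,6) E_nplus)
  have cfw: "cf \<alpha> w = v \<alpha>" if "\<alpha> \<in> P" for \<alpha>
  proof -
    have "cf \<alpha> w = (\<Sum>\<beta>\<in>P. if \<alpha> = \<beta> then v \<beta> else 0)"
      unfolding w_def cf_sum by (intro sum.cong) (use that in \<open>auto simp: cf_simps cf_E\<close>)
    then show ?thesis using that finite_P by simp
  qed
  have "\<psi> H - \<lbrace>conjugation H, w\<rbrace> \<in> h" if H: "H \<in> h" "H \<in> M" for H
  proof (rule M_cf_0)
    show "\<psi> H - \<lbrace>conjugation H, w\<rbrace> \<in> M"
      by (intro M_closed(2) \<psi>_M nplus_M[OF bracket_h_nplus] conj_in_h H w)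
    fix \<alpha> assume a: "\<alpha> \<in> P"
    \<comment> \<open>The cocycle identity on commuting elements makes the \<alpha>-coefficient of
      \<psi> H proportional to \<alpha>(tau H), so that one test element determines it for all
      H.\<close>
    have "0 = \<psi> \<lbrace>T \<alpha>, H\<rbrace>" using T(1)[OF a] H h_commute \<psi>_0 by simp
    also have "\<dots> = prp (\<lbrace>conjugation (T \<alpha>), \<psi> H\<rbrace> - \<lbrace>conjugation H, \<psi> (T \<alpha>)\<rbrace>)"
      using \<psi>_bracket[OF T(2)[OF a] H(2)] cb_anticomm[of "\<psi> (T \<alpha>)" "conjugation H"] by simp
    also have "\<dots> = \<lbrace>conjugation (T \<alpha>), \<psi> H\<rbrace> - \<lbrace>conjugation H, \<psi> (T \<alpha>)\<rbrace>"
      using H T[OF a] by (intro prp_M M_closed(2) h_normalizes_M conj_in_h \<psi>_M)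
    finally have "cf \<alpha> (\<lbrace>conjugation (T \<alpha>), \<psi> H\<rbrace> - \<lbrace>conjugation H, \<psi> (T \<alpha>)\<rbrace>) = 0"
      by (metis cf_simps(5))
    then have "\<alpha> (conjugation (T \<alpha>)) * cf \<alpha> (\<psi> H) = \<alpha> (conjugation H) * cf \<alpha> (\<psi> (T \<alpha>))"
      using a cf_bracket[OF a conj_in_h[OF T(1)[OF a]]] cf_bracket[OF a conj_in_h[OF H(1)]]
      by (simp add: cf_simps)
    then have "cf \<alpha> (\<psi> H) = \<alpha> (conjugation H) * v \<alpha>"
      using T(3)[OF a] by (simp add: v_def field_simps)
    then show "cf \<alpha> (\<psi> H - \<lbrace>conjugation H, w\<rbrace>) = 0"
      using cf_bracket[OF a conj_in_h[OF H(1)]] by (simp add: cf_simps cfw[OF a])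
  qed
  with w show ?thesis using that by blast
qed

text \<open>The defect D of \<psi> from the coboundary of w at E \<alpha> is a vector on which each
  tau H, for H in h \<inter> M, acts by cnj(\<alpha> H). A component of D at a positive root \<beta>
  would need \<alpha> + \<beta> = 0 on h \<inter> M, and a component in h would need \<alpha> = 0
  there. The discrepancy allowed on h \<inter> M is harmless, as it brackets F \<alpha> to a
  multiple of F \<alpha>.\<close>

lemma exists_w:
  obtains w where "w \<in> nplus" "\<And>H. H \<in> h \<Longrightarrow> H \<in> M \<Longrightarrow> \<psi> H - \<lbrace>conjugation H, w\<rbrace> \<in> h"
    "\<And>\<alpha>. \<alpha> \<in> P \<Longrightarrow> \<psi> (E \<alpha>) = prp \<lbrace>F \<alpha>, w\<rbrace>"
proof -
  obtain w where w: "w \<in> nplus" "\<And>H. H \<in> h \<Longrightarrow> H \<in> M \<Longrightarrow> \<psi> H - \<lbrace>conjugation H, w\<rbrace> \<in> h"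
    using exists_w_h by blast
  have "\<psi> (E \<alpha>) = prp \<lbrace>F \<alpha>, w\<rbrace>" if a: "\<alpha> \<in> P" for \<alpha>
  proof -
    have r: "\<alpha> \<in> R" using a P_roots by blast
    define D where "D = \<psi> (E \<alpha>) - prp \<lbrace>F \<alpha>, w\<rbrace>"
    have EM: "E \<alpha> \<in> M" by (rule E_in_M[OF a])
    have DM: "D \<in> M" unfolding D_def by (intro M_closed(2) \<psi>_M EM prp_in_M)
    have D: "\<lbrace>conjugation H, D\<rbrace> = cnj (\<alpha> H) *\<^sub>C D" if H: "H \<in> h" "H \<in> M" for H
    proof -
      define DH where "DH = \<psi> H - \<lbrace>conjugation H, w\<rbrace>"
      have DH: "DH \<in> h" using w(2) H by (simp add: DH_def)
      have wH: "prp \<lbrace>conjugation H, w\<rbrace> = \<lbrace>conjugation H, w\<rbrace>"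
        by (intro prp_M nplus_M bracket_h_nplus w conj_in_h H)
      have HE: "\<lbrace>H, E \<alpha>\<rbrace> = \<alpha> H *\<^sub>C E \<alpha>" using rsD[OF E_rs[OF r] H(1)] .
      have "cnj (\<alpha> H) *\<^sub>C \<psi> (E \<alpha>) = prp (\<lbrace>conjugation H, \<psi> (E \<alpha>)\<rbrace> + \<lbrace>\<psi> H, F \<alpha>\<rbrace>)"
        using \<psi>_bracket[OF H(2) EM] by (simp add: HE \<psi>_scale[OF EM])
      moreover have "cnj (\<alpha> H) *\<^sub>C prp \<lbrace>F \<alpha>, w\<rbrace> =
          prp (\<lbrace>conjugation H, prp \<lbrace>F \<alpha>, w\<rbrace>\<rbrace> + \<lbrace>\<lbrace>conjugation H, w\<rbrace>, F \<alpha>\<rbrace>)"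
        using coboundary[OF H(2) EM, of w] by (simp add: HE wH cb_simps prp_simps)
      ultimately have "cnj (\<alpha> H) *\<^sub>C D = prp (\<lbrace>conjugation H, D\<rbrace> + \<lbrace>DH, F \<alpha>\<rbrace>)"
        by (simp add: D_def DH_def cx.scale_right_diff_distrib cb_simps prp_simps)
      moreover have "prp \<lbrace>DH, F \<alpha>\<rbrace> = 0"
        using prp_conj_nplus[OF E_nplus[OF a]] by (simp add: bracket_h_F[OF a DH] prp_simps)
      moreover have "prp \<lbrace>conjugation H, D\<rbrace> = \<lbrace>conjugation H, D\<rbrace>"
        by (intro prp_M h_normalizes_M conj_in_h H DM)
      ultimately show ?thesis by (simp add: prp_simps)
    qed
    have "D \<in> h"
    proof (rule M_cf_0[OF DM])
      fix \<beta> assume b: "\<beta> \<in> P"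
      have "\<alpha> + \<beta> \<noteq> 0" using psum_add[OF P_psum[OF a] P_psum[OF b]] psum_nonzero by auto
      moreover have ab: "\<alpha> \<in> rdual" "\<beta> \<in> rdual" using a b P_roots roots_rdual by auto
      ultimately obtain H where H: "H \<in> h" "H \<in> M" "(\<alpha> + \<beta>) H \<noteq> 0"
        using exists_prp_nonzero[OF rdual_add[OF ab]] by blast
      have "\<beta> (conjugation H) * cf \<beta> D = cnj (\<alpha> H) * cf \<beta> D"
        using D[OF H(1,2)] cf_bracket[OF b conj_in_h[OF H(1)], of D] cf_simps(4)[of \<beta> "cnj (\<alpha> H)" D]
        by metis
      then have "cnj ((\<alpha> + \<beta>) H) * cf \<beta> D = 0"
        using rdual_conj[OF ab(2) H(1)] by (simp add: distrib_right) (metis add.left_inverse)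
      then show "cf \<beta> D = 0" using H(3) by (metis complex_cnj_zero_iff mult_eq_0_iff)
    qed
    obtain H where H: "H \<in> h" "H \<in> M" "\<alpha> H \<noteq> 0"
      using exists_prp_nonzero[OF roots_rdual[OF r]] r by (auto simp: roots_def)
    have "cnj (\<alpha> H) *\<^sub>C D = 0" using D[OF H(1,2)] h_commute[OF conj_in_h[OF H(1)] \<open>D \<in> h\<close>] by simp
    then have "D = 0" using H(3) by simp
    then show ?thesis by (simp add: D_def)
  qed
  with w show ?thesis using that by blast
qed

text \<open>Evaluate \<psi>^2 = -1 at E \<gamma>, with \<psi> E \<gamma> computed from w. The result
  pairs the coefficients of w with the values of roots on \<open>prm (Hc \<gamma>)\<close>, whose
  real and imaginary parts carry the values on the coroot and on its image under I.\<close>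

lemma stem_conditions:
  assumes "\<gamma> \<in> \<Gamma>" "\<delta> \<in> \<Gamma>"
  shows "\<delta> (Ic (Hc \<gamma>)) = 0"
proof -
  obtain w where w: "w \<in> nplus" and wh: "\<And>H. H \<in> h \<Longrightarrow> H \<in> M \<Longrightarrow> \<psi> H - \<lbrace>conjugation H, w\<rbrace> \<in> h"
    and wE: "\<And>\<alpha>. \<alpha> \<in> P \<Longrightarrow> \<psi> (E \<alpha>) = prp \<lbrace>F \<alpha>, w\<rbrace>"
    using exists_w by blast
  define S where "S = {\<alpha> \<in> P. cf \<alpha> w \<noteq> 0}"
  \<comment> \<open>Under \<open>top\<close> the only surviving term of [F \<gamma>, w] after
    projection is the one at \<gamma>, a multiple of the (1,0)-part T of the coroot. Its image under
    \<psi> is known up to h, so the coefficient of -E \<gamma> at each positive root can be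
    compared.\<close>
  have key: "(if \<alpha> = \<gamma> then 1 else 0) = cnj (cf \<gamma> w) * \<alpha> (prm (Hc \<gamma>)) * cf \<alpha> w"
    if g: "\<gamma> \<in> \<Gamma>" and top: "\<And>\<beta>. \<beta> \<in> S \<Longrightarrow> \<beta> - \<gamma> \<notin> P" and a: "\<alpha> \<in> P" for \<gamma> \<alpha>
  proof -
    have gP: "\<gamma> \<in> P" and r: "\<gamma> \<in> R" using g stem_P stem_root by auto
    have EM: "E \<gamma> \<in> M" by (rule E_in_M[OF gP])
    define c where "c = cf \<gamma> w"
    have "\<psi> (E \<gamma>) = (\<Sum>\<beta>\<in>P. cf \<beta> w *\<^sub>C prp \<lbrace>F \<gamma>, E \<beta>\<rbrace>)"
      unfolding wE[OF gP] by (subst nplus_expansion[OF w]) (simp add: cb_sum_right prp_sum cb_simps prp_simps)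
    also have "\<dots> = (\<Sum>\<beta>\<in>P. if \<beta> = \<gamma> then c *\<^sub>C prp (Hc \<gamma>) else 0)"
    proof (intro sum.cong refl)
      fix \<beta> assume b: "\<beta> \<in> P"
      show "cf \<beta> w *\<^sub>C prp \<lbrace>F \<gamma>, E \<beta>\<rbrace> = (if \<beta> = \<gamma> then c *\<^sub>C prp (Hc \<gamma>) else 0)"
      proof (cases "\<beta> = \<gamma> \<or> \<beta> \<notin> S")
        case True
        then show ?thesis using b r by (auto simp: S_def c_def E_bracket)
      next
        case False
        then show ?thesis
          using prp_bracket_F_E[OF b gP _ _ E_rs[OF P_roots[OF b]] E_rs[OF r]] top by auto
      qed
    qed
    also have "\<dots> = c *\<^sub>C prp (Hc \<gamma>)" using gP finite_P by simp
    finally have 1: "\<psi> (E \<gamma>) = c *\<^sub>C prp (Hc \<gamma>)" .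
    define T where "T = prp (Hc \<gamma>)"
    have T: "T \<in> h" "T \<in> M" using prp_h[OF Hc_in_h[OF r]] prp_in_M by (auto simp: T_def)
    have cT: "conjugation T = - prm (Hc \<gamma>)"
      using conj_Hc[OF r] by (simp add: T_def conj_prp prm_simps)
    have "- E \<gamma> = cnj c *\<^sub>C \<psi> T" using \<psi>_\<psi>[OF EM] \<psi>_scale[OF T(2)] by (simp add: 1 flip: T_def)
    then have "cf \<alpha> (- E \<gamma>) = cnj c * cf \<alpha> (\<psi> T)" by (simp add: cf_simps)
    moreover have "cf \<alpha> (\<psi> T) = \<alpha> (conjugation T) * cf \<alpha> w"
      using cf_h[OF a wh[OF T]] cf_bracket[OF a conj_in_h[OF T(1)]] by (simp add: cf_simps)
    moreover have "\<alpha> (conjugation T) = - \<alpha> (prm (Hc \<gamma>))"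
      unfolding cT by (rule dual_minus[OF root_dual[OF P_roots[OF a]] prm_h[OF Hc_in_h[OF r]]])
    ultimately show ?thesis using cf_E[OF a gP] by (simp add: cf_simps c_def split: if_splits)
  qed
  have split: "\<alpha> (prm (Hc \<gamma>)) = (of_real (Re (\<alpha> (Hc \<gamma>))) + \<i> * of_real (Re (\<alpha> (Ic (Hc \<gamma>))))) / 2
      \<and> \<alpha> (Hc \<gamma>) = of_real (Re (\<alpha> (Hc \<gamma>))) \<and> \<alpha> (Ic (Hc \<gamma>)) = of_real (Re (\<alpha> (Ic (Hc \<gamma>))))"
    if g: "\<gamma> \<in> R" and a: "\<alpha> \<in> R" for \<gamma> \<alpha>
  proof -
    have d: "\<alpha> \<in> dual h" "\<alpha> \<in> rdual" using a root_dual roots_rdual by auto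
    have H: "Hc \<gamma> \<in> h" "Ic (Hc \<gamma>) \<in> h" using Hc_in_h[OF g] Ic_h by auto
    have 1: "\<alpha> (Hc \<gamma>) = of_real (Re (\<alpha> (Hc \<gamma>)))" by (rule rdual_Hc_real[OF d(2) g])
    have "conjugation (Ic (Hc \<gamma>)) = - Ic (Hc \<gamma>)" using conj_Hc[OF g] Ic_simps by metis
    then have "- cnj (\<alpha> (Ic (Hc \<gamma>))) = - \<alpha> (Ic (Hc \<gamma>))"
      using rdual_conj[OF d(2) H(2)] dual_minus[OF d(1) H(2)] by simp
    then have 2: "\<alpha> (Ic (Hc \<gamma>)) = of_real (Re (\<alpha> (Ic (Hc \<gamma>))))" by (simp add: complex_eq_iff)
    have "\<alpha> (prm (Hc \<gamma>)) = (\<alpha> (Hc \<gamma>) + \<i> * \<alpha> (Ic (Hc \<gamma>))) / 2"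
      using H by (simp add: prm_def dual_scale[OF d(1)] dual_add[OF d(1)] h_closed(1,3))
    then show ?thesis using 1 2 by metis
  qed
  have off: "\<alpha> (Hc \<gamma>) = 0" "\<alpha> (Ic (Hc \<gamma>)) = 0" "cf \<gamma> w \<noteq> 0"
    if g: "\<gamma> \<in> \<Gamma>" "\<And>\<beta>. \<beta> \<in> S \<Longrightarrow> \<beta> - \<gamma> \<notin> P" and a: "\<alpha> \<in> S" "\<alpha> \<noteq> \<gamma>" for \<gamma> \<alpha>
  proof -
    have aP: "\<alpha> \<in> P" and gP: "\<gamma> \<in> P" using a g stem_P by (auto simp: S_def)
    show nz: "cf \<gamma> w \<noteq> 0" using key[OF g gP] by auto
    have "\<alpha> (prm (Hc \<gamma>)) = 0" using key[OF g aP] a nz by (simp add: S_def)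
    then have z: "Re (\<alpha> (Hc \<gamma>)) = 0" "Re (\<alpha> (Ic (Hc \<gamma>))) = 0"
      using split[OF P_roots[OF gP] P_roots[OF aP]] by (auto simp: complex_eq_iff)
    show "\<alpha> (Hc \<gamma>) = 0" "\<alpha> (Ic (Hc \<gamma>)) = 0"
      using split[OF P_roots[OF gP] P_roots[OF aP]] z by (metis of_real_0)+
  qed
  \<comment> \<open>A maximal root \<alpha> of the support outside the stem lies in the
    \<open>Phi\<close> of some \<epsilon>, and maximality gives \<open>top\<close> for \<epsilon>.
    Then \<alpha> would vanish on Hc \<epsilon>, where its value is 1.\<close>
  have SG: "S \<subseteq> \<Gamma>"
  proof (rule ccontr)
    assume "\<not> S \<subseteq> \<Gamma>"
    then have "S - \<Gamma> \<subseteq> P" "S - \<Gamma> \<noteq> {}" by (auto simp: S_def)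
    then obtain \<alpha> where \<alpha>: "\<alpha> \<in> S - \<Gamma>" and max: "\<And>\<beta>. \<beta> \<in> S - \<Gamma> \<Longrightarrow> \<beta> - \<alpha> \<notin> psum"
      using exists_maximal[of "S - \<Gamma>"] by blast
    then obtain \<epsilon> where \<epsilon>: "\<epsilon> \<in> \<Gamma>" "\<alpha> \<in> Phi P \<epsilon>" using stem_cases[of \<alpha>] by (auto simp: S_def)
    have "\<beta> - \<epsilon> \<notin> P" if b: "\<beta> \<in> S" for \<beta>
    proof
      assume be: "\<beta> - \<epsilon> \<in> P"
      show False
      proof (cases "\<beta> \<in> \<Gamma>")
        case True
        have "\<epsilon> \<in> Phi P \<beta>" using be stem_P[OF \<epsilon>(1)] by (simp add: Phi_iff)
        then show False using stem_not_Phi[OF \<epsilon>(1) True] by simp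
      next
        case False
        have "(\<beta> - \<epsilon>) + (\<epsilon> - \<alpha>) \<in> psum"
          using be \<epsilon>(2) P_psum by (intro psum_add) (auto simp: Phi_iff)
        then show False using max[of \<beta>] b False by simp
      qed
    qed
    moreover have "\<alpha> \<noteq> \<epsilon>" using \<alpha> \<epsilon> by blast
    ultimately have "\<alpha> (Hc \<epsilon>) = 0" using off(1)[OF \<epsilon>(1)] \<alpha> by blast
    then show False using Phi_coroot[OF \<epsilon>] by simp
  qed
  have top: "\<beta> - \<gamma> \<notin> P" if "\<beta> \<in> S" "\<gamma> \<in> \<Gamma>" for \<beta> \<gamma>
    using stem_diff_not_root[of \<beta> \<gamma>] that SG P_roots by blast
  have nz: "cf \<gamma> w \<noteq> 0" if "\<gamma> \<in> \<Gamma>" for \<gamma>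
    using key[OF that top[OF _ that] stem_P[OF that]] by auto
  show ?thesis
  proof (cases "\<delta> = \<gamma>")
    case False
    have "\<delta> \<in> S" using assms nz stem_P by (auto simp: S_def)
    then show ?thesis using off(2)[OF assms(1) top[OF _ assms(1)] _ False] by blast
  next
    case True
    have r: "\<gamma> \<in> R" using assms stem_root by blast
    define x where "x = Re (\<gamma> (Hc \<gamma>))"
    define y where "y = Re (\<gamma> (Ic (Hc \<gamma>)))"
    have s: "\<gamma> (prm (Hc \<gamma>)) = (of_real x + \<i> * of_real y) / 2" "\<gamma> (Ic (Hc \<gamma>)) = of_real y"
      using split[OF r r] by (auto simp: x_def y_def)
    \<comment> \<open>On the diagonal only the reality of |cf \<gamma> w|^2 is available, and it
      suffices to kill the imaginary part.\<close>
    have "1 = \<gamma> (prm (Hc \<gamma>)) * (cf \<gamma> w * cnj (cf \<gamma> w))"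
      using key[OF assms(1) top[OF _ assms(1)] stem_P[OF assms(1)]] by (simp add: mult_ac)
    also have "cf \<gamma> w * cnj (cf \<gamma> w) = of_real ((cmod (cf \<gamma> w))\<^sup>2)" by (rule complex_norm_square[symmetric])
    finally have "Im (\<gamma> (prm (Hc \<gamma>)) * of_real ((cmod (cf \<gamma> w))\<^sup>2)) = Im 1" by simp
    then have "y * (cmod (cf \<gamma> w))\<^sup>2 = 0" by (simp add: s)
    then show ?thesis using nz[OF assms(1)] s(2) True by simp
  qed
qed

end

section \<open>Sufficiency\<close>

lemma nplus_bracket:
  assumes "X \<in> nplus" "Y \<in> nplus"
  shows "\<lbrace>X,Y\<rbrace> \<in> nplus"
proof -
  have 1: "\<lbrace>X,Y\<rbrace> \<in> nplus" if X: "\<alpha> \<in> P" "X \<in> rs \<alpha>" and Y: "\<beta> \<in> P" "Y \<in> rs \<beta>" for X Y \<alpha> \<beta>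
  proof (cases "\<lbrace>X,Y\<rbrace> = 0")
    case False
    have "\<alpha> + \<beta> \<noteq> 0" using psum_add[OF P_psum[OF X(1)] P_psum[OF Y(1)]] psum_nonzero by auto
    then have "\<alpha> + \<beta> \<in> R"
      using rootI[OF rdual_add _ rs_bracket[OF X(2) Y(2)] False] X(1) Y(1) P_roots roots_rdual by blast
    then show ?thesis using P_add X Y rs_nplus rs_bracket by blast
  qed (simp add: nplus_closed(4))
  have 2: "\<lbrace>X,Y\<rbrace> \<in> nplus" if X: "\<alpha> \<in> P" "X \<in> rs \<alpha>" for X \<alpha>
  proof -
    have "Y \<in> cx.span (\<Union> (rs ` P))" using assms(2) by (simp add: nilradical_def)
    then show "\<lbrace>X,Y\<rbrace> \<in> nplus"
    proof (induction rule: cx.span_induct_alt)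
      case (step c Z Y)
      then obtain \<beta> where "\<beta> \<in> P" "Z \<in> rs \<beta>" by blast
      then show ?case using 1[OF X] step(2) nplus_closed(1,3) by (simp add: cb_simps)
    qed (simp add: nplus_closed(4))
  qed
  have "X \<in> cx.span (\<Union> (rs ` P))" using assms(1) by (simp add: nilradical_def)
  then show ?thesis
  proof (induction rule: cx.span_induct_alt)
    case (step c Z X)
    then obtain \<beta> where "\<beta> \<in> P" "Z \<in> rs \<beta>" by blast
    then show ?case using 2 step(2) nplus_closed(1,3) by (simp add: cb_simps)
  qed (simp add: nplus_closed(4))
qed

text \<open>Brackets in M land in \<open>nplus\<close>, so a map factoring through the h-component
  vanishes on them. Together with \<open>prp_bracket_conj_M_h\<close> this makes such a map with
  values in h a cocycle.\<close>

lemma hpart_M_bracket: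
  assumes "X \<in> M" "Y \<in> M"
  shows "hpart \<lbrace>X,Y\<rbrace> = 0"
proof -
  obtain H N where X: "X = H + N" "H \<in> h" "N \<in> nplus" using M_decomp[OF assms(1)] by metis
  obtain H' N' where Y: "Y = H' + N'" "H' \<in> h" "N' \<in> nplus" using M_decomp[OF assms(2)] by metis
  have "\<lbrace>X,Y\<rbrace> = \<lbrace>H,N'\<rbrace> + (- \<lbrace>H',N\<rbrace>) + \<lbrace>N,N'\<rbrace>"
    using h_commute[OF X(2) Y(2)] cb_anticomm[of N H'] by (simp add: X(1) Y(1) cb_simps)
  also have "\<dots> \<in> nplus"
    using X Y by (intro nplus_closed(1,5) bracket_h_nplus nplus_bracket)
  finally show ?thesis by (rule hpart_nplus)
qed

lemma prp_bracket_conj_M_h: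
  assumes "X \<in> M" "H \<in> h"
  shows "prp \<lbrace>conjugation X, H\<rbrace> = 0"
proof -
  obtain H' N where X: "X = H' + N" "H' \<in> h" "N \<in> nplus" using M_decomp[OF assms(1)] by metis
  have "\<lbrace>conjugation X, H\<rbrace> = conjugation (- \<lbrace>conjugation H, N\<rbrace>)"
    using h_commute[OF conj_in_h[OF X(2)] assms(2)] cb_anticomm[of H "conjugation N"]
    by (simp add: X(1) cb_simps conjugation_cb)
  moreover have "- \<lbrace>conjugation H, N\<rbrace> \<in> nplus"
    using X assms by (intro nplus_closed(5) bracket_h_nplus conj_in_h)
  ultimately show ?thesis using prp_conj_nplus by metis
qed

lemma dim_M:
  assumes "cpx_finite (B :: 'u cpx set)"
  shows "cx.dim (UNIV :: 'u cpx set) = 2 * cx.dim M"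
proof -
  interpret cpx_finite B by (rule assms)
  have "X \<in> {x + y |x y. x \<in> M \<and> y \<in> conjugation ` M}" for X
  proof -
    have "prm X \<in> conjugation ` M"
      by (simp add: in_conj_image conj_prm prp_in_M)
    then show ?thesis using prp_add_prm[of X, symmetric] prp_in_M[of X] by blast
  qed
  then have 1: "{x + y |x y. x \<in> M \<and> y \<in> conjugation ` M} = UNIV" by blast
  have "X = 0" if "X \<in> M" "X \<in> conjugation ` M" for X
  proof -
    have "conjugation X \<in> M" using that(2) by (simp add: in_conj_image)
    then show ?thesis using prp_M[OF that(1)] by (simp flip: prp_eq_0_iff)
  qed
  then have 2: "M \<inter> conjugation ` M = {0}" using M_closed(4) by (auto simp: in_conj_image)
  show ?thesis
    using dim_sums_Int[OF subspace_M subspace_conj[OF subspace_M]] unfolding 1 2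
    by (simp add: dim_conj)
qed

end

section \<open>The quaternionic structure built from the stem\<close>

locale isotropic_stem = borel_structure br ip h P \<Gamma> I
  for br :: "'u::real_vector \<Rightarrow> 'u \<Rightarrow> 'u" and ip and h :: "'u cpx set" and P \<Gamma> I +
  assumes stem_I: "\<forall>\<gamma>\<in>\<Gamma>. \<forall>\<delta>\<in>\<Gamma>. \<gamma> (Ic (Hc \<delta>)) = 0"
begin

text \<open>Coefficients of modulus one are forced by \<psi>^2 = -1, because \<gamma> takes the
  value 1 on \<open>prm (Hc \<gamma>)\<close>; the phases are set to 1.\<close>

definition wstem where "wstem = (\<Sum>\<gamma>\<in>\<Gamma>. E \<gamma>)"
text \<open>The coboundary of \<open>wstem\<close>, hence a cocycle. It exchanges
  \<open>Hp \<gamma>\<close> with E \<gamma> up to sign, and weight \<alpha> with weight \<gamma> -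
  \<alpha> on \<open>Phi P \<gamma>\<close>.\<close>

definition pairing where "pairing X = prp \<lbrace>conjugation X, wstem\<rbrace>"
definition Hp where "Hp \<gamma> = prp (Hc \<gamma>)"

text \<open>Vanishing of \<gamma> on the I-image of the coroot removes the imaginary part from both
  projections, so the \<open>Hp\<close> are dual to the stem.\<close>

lemma stem_prm:
  assumes "\<gamma> \<in> \<Gamma>" "\<delta> \<in> \<Gamma>"
  shows "\<gamma> (prm (Hc \<delta>)) = (if \<gamma> = \<delta> then 1 else 0)" "\<gamma> (Hp \<delta>) = (if \<gamma> = \<delta> then 1 else 0)"
proof -
  have d: "\<gamma> \<in> dual h" using root_dual[OF stem_root[OF assms(1)]] .
  have H: "Hc \<delta> \<in> h" "Ic (Hc \<delta>) \<in> h" using Hc_in_h[OF stem_root[OF assms(2)]] Ic_h by auto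
  have v: "\<gamma> (Hc \<delta>) = (if \<gamma> = \<delta> then 2 else 0)"
    using stem_orthogonal[OF assms] root_Hc_self[OF stem_root[OF assms(1)]] by auto
  have I0: "\<gamma> (Ic (Hc \<delta>)) = 0" using stem_I assms by blast
  show "\<gamma> (prm (Hc \<delta>)) = (if \<gamma> = \<delta> then 1 else 0)"
    using H v I0
    by (simp add: prm_def dual_scale[OF d] dual_add[OF d] h_closed(1,3))
  show "\<gamma> (Hp \<delta>) = (if \<gamma> = \<delta> then 1 else 0)"
    using H v I0
    by (simp add: Hp_def prp_def dual_scale[OF d] dual_diff[OF d] h_closed(2,3))
qed

lemma Hp_props: "\<gamma> \<in> \<Gamma> \<Longrightarrow> Hp \<gamma> \<in> h" "Hp \<gamma> \<in> M"
  using prp_h Hc_in_h stem_root prp_in_M by (auto simp: Hp_def)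

lemma pairing_simps:
  "pairing (X + Y) = pairing X + pairing Y"
  "pairing (c *\<^sub>C X) = cnj c *\<^sub>C pairing X"
  "pairing X \<in> M"
  by (simp_all add: pairing_def cb_simps prp_simps prp_in_M)

lemma pairing_h:
  assumes "H \<in> h"
  shows "pairing H = (\<Sum>\<delta>\<in>\<Gamma>. \<delta> (conjugation H) *\<^sub>C E \<delta>)"
proof -
  have "\<lbrace>conjugation H, wstem\<rbrace> = (\<Sum>\<delta>\<in>\<Gamma>. \<delta> (conjugation H) *\<^sub>C E \<delta>)"
    unfolding wstem_def cb_sum_right
    by (intro sum.cong refl rsD E_rs stem_root conj_in_h assms)
  moreover have "\<dots> \<in> M" by (intro M_closed(3,6) E_in_M stem_P)
  ultimately show ?thesis by (simp add: pairing_def prp_M)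
qed

lemma pairing_Hp:
  assumes "\<gamma> \<in> \<Gamma>"
  shows "pairing (Hp \<gamma>) = - E \<gamma>"
proof -
  have "conjugation (Hp \<gamma>) = - prm (Hc \<gamma>)"
    using conj_Hc[OF stem_root[OF assms]] by (simp add: Hp_def conj_prp prm_simps)
  then have val: "\<delta> (conjugation (Hp \<gamma>)) = (if \<delta> = \<gamma> then - 1 else 0)" if "\<delta> \<in> \<Gamma>" for \<delta>
    using stem_prm[OF that assms] dual_minus[OF root_dual[OF stem_root[OF that]] prm_h[OF Hc_in_h[OF stem_root[OF assms]]]]
    by simp
  have "pairing (Hp \<gamma>) = (\<Sum>\<delta>\<in>\<Gamma>. if \<delta> = \<gamma> then - E \<gamma> else 0)"
    unfolding pairing_h[OF Hp_props(1)[OF assms]]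
  proof (intro sum.cong refl)
    fix \<delta> assume "\<delta> \<in> \<Gamma>"
    from val[OF this] show "\<delta> (conjugation (Hp \<gamma>)) *\<^sub>C E \<delta> = (if \<delta> = \<gamma> then - E \<gamma> else 0)" by simp
  qed
  then show ?thesis using assms finite_stem by simp
qed

lemma pairing_E:
  assumes "\<gamma> \<in> \<Gamma>"
  shows "pairing (E \<gamma>) = Hp \<gamma>"
proof -
  have "pairing (E \<gamma>) = (\<Sum>\<delta>\<in>\<Gamma>. prp \<lbrace>F \<gamma>, E \<delta>\<rbrace>)"
    by (simp add: pairing_def wstem_def cb_sum_right prp_sum)
  also have "\<dots> = (\<Sum>\<delta>\<in>\<Gamma>. if \<delta> = \<gamma> then Hp \<gamma> else 0)"
  proof (intro sum.cong refl)
    fix \<delta> assume d: "\<delta> \<in> \<Gamma>"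
    show "prp \<lbrace>F \<gamma>, E \<delta>\<rbrace> = (if \<delta> = \<gamma> then Hp \<gamma> else 0)"
    proof (cases "\<delta> = \<gamma>")
      case False
      have "\<delta> - \<gamma> \<notin> P" using stem_diff_not_root[OF d assms] P_roots by blast
      then show ?thesis
        using prp_bracket_F_E[OF stem_P[OF d] stem_P[OF assms] False _ E_rs[OF stem_root[OF d]] E_rs[OF stem_root[OF assms]]]
          False by simp
    qed (use E_bracket stem_root assms in \<open>simp add: Hp_def\<close>)
  qed
  also have "\<dots> = Hp \<gamma>" using assms finite_stem by simp
  finally show ?thesis .
qed

text \<open>Only \<gamma> contributes: for another stem root \<delta>, disjointness of the
  \<open>Phi\<close> sets prevents \<delta> - \<alpha> from being positive, and \<open>prp\<close>
  kills the bracket.\<close>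

lemma pairing_Phi:
  assumes "\<gamma> \<in> \<Gamma>" "\<alpha> \<in> Phi P \<gamma>" "X \<in> rs \<alpha>"
  shows "pairing X = \<lbrace>conjugation X, E \<gamma>\<rbrace>" "pairing X \<in> rs (\<gamma> - \<alpha>)"
proof -
  have a: "\<alpha> \<in> P" "\<gamma> - \<alpha> \<in> P" using assms by (auto simp: Phi_iff)
  have "conjugation X \<in> rs (- \<alpha>)" using assms rs_conj roots_rdual P_roots a by blast
  then have rs: "\<lbrace>conjugation X, E \<gamma>\<rbrace> \<in> rs (\<gamma> - \<alpha>)"
    using rs_bracket[OF _ E_rs[OF stem_root[OF assms(1)]]] by fastforce
  have "pairing X = (\<Sum>\<delta>\<in>\<Gamma>. prp \<lbrace>conjugation X, E \<delta>\<rbrace>)"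
    by (simp add: pairing_def wstem_def cb_sum_right prp_sum)
  also have "\<dots> = (\<Sum>\<delta>\<in>\<Gamma>. if \<delta> = \<gamma> then \<lbrace>conjugation X, E \<gamma>\<rbrace> else 0)"
  proof (intro sum.cong refl)
    fix \<delta> assume d: "\<delta> \<in> \<Gamma>"
    show "prp \<lbrace>conjugation X, E \<delta>\<rbrace> = (if \<delta> = \<gamma> then \<lbrace>conjugation X, E \<gamma>\<rbrace> else 0)"
    proof (cases "\<delta> = \<gamma>")
      case True
      then show ?thesis using prp_M[OF nplus_M[OF rs_nplus[OF a(2) rs]]] by simp
    next
      case False
      have "\<delta> - \<alpha> \<notin> P"
        using Phi_disjoint[OF d assms(1) _ assms(2)] False a by (auto simp: Phi_iff)
      moreover have "\<delta> \<noteq> \<alpha>" using stem_not_Phi[OF d assms(1)] assms(2) by blast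
      ultimately show ?thesis
        using prp_bracket_F_E[OF stem_P[OF d] a(1) _ _ E_rs[OF stem_root[OF d]] assms(3)] False by simp
    qed
  qed
  also have "\<dots> = \<lbrace>conjugation X, E \<gamma>\<rbrace>" using assms finite_stem by simp
  finally show "pairing X = \<lbrace>conjugation X, E \<gamma>\<rbrace>" .
  then show "pairing X \<in> rs (\<gamma> - \<alpha>)" using rs by simp
qed

definition V where "V = cx.span (Hp ` \<Gamma> \<union> E ` P)"

lemma subspace_V: "cx.subspace V"
  by (simp add: V_def)

lemma V_base: "\<gamma> \<in> \<Gamma> \<Longrightarrow> Hp \<gamma> \<in> V" "\<alpha> \<in> P \<Longrightarrow> E \<alpha> \<in> V"
  unfolding V_def by (auto intro: cx.span_base)

lemma nplus_V: "nplus \<subseteq> V"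
  unfolding nilradical_def
proof (rule cx.span_minimal[OF _ subspace_V])
  show "\<Union> (rs ` P) \<subseteq> V"
    using rs_scale_E P_roots V_base(2) cx.subspace_scale[OF subspace_V] by fastforce
qed

lemma V_M: "V \<subseteq> M"
  unfolding V_def using Hp_props E_in_M by (intro cx.span_minimal subspace_M) auto

text \<open>The square is -1 on generators: clear on \<open>Hp \<gamma>\<close> and E \<gamma>,
  while on \<open>Phi P \<gamma>\<close> it is the scalar -\<alpha>(Hc \<gamma>) = -1. Every
  positive root falls under one of these cases.\<close>

lemma pairing_V:
  assumes "X \<in> V"
  shows "pairing X \<in> V \<and> pairing (pairing X) = - X"
  using assms unfolding V_def
proof (induction rule: cx.span_induct_alt)
  case base
  have "pairing 0 = 0" using pairing_simps(2)[of 0 0] by simp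
  then show ?case by (simp add: cx.span_zero)
next
  case (step c X Y)
  have "pairing X \<in> V \<and> pairing (pairing X) = - X"
  proof (cases "X \<in> Hp ` \<Gamma> \<or> X \<in> E ` \<Gamma>")
    case True
    have m: "pairing (- E \<gamma>) = - Hp \<gamma>" if "\<gamma> \<in> \<Gamma>" for \<gamma>
      using pairing_simps(2)[of "-1" "E \<gamma>"] pairing_E[OF that] by simp
    have n: "- E \<gamma> \<in> V" if "\<gamma> \<in> \<Gamma>" for \<gamma>
      by (rule cx.subspace_neg[OF subspace_V V_base(2)[OF stem_P[OF that]]])
    from True show ?thesis
      using pairing_Hp pairing_E m n V_base(1) by auto
  next
    case False
    then obtain \<alpha> where \<alpha>: "\<alpha> \<in> P" "X = E \<alpha>" "\<alpha> \<notin> \<Gamma>" using step(1) by blast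
    then obtain \<gamma> where \<gamma>: "\<gamma> \<in> \<Gamma>" "\<alpha> \<in> Phi P \<gamma>" using stem_cases by blast
    have X: "X \<in> rs \<alpha>" using \<alpha> E_rs P_roots by simp
    note 1 = pairing_Phi[OF \<gamma> X]
    have "pairing (pairing X) = - X"
      using pairing_Phi(1)[OF \<gamma>(1) Phi_reflect[OF \<gamma>(2)] 1(2)] Phi_twice[OF \<gamma> X] Phi_coroot[OF \<gamma>] 1(1)
      by simp
    moreover have "pairing X \<in> V" using rs_nplus[OF _ 1(2)] nplus_V \<gamma>(2) by (auto simp: Phi_iff)
    ultimately show ?thesis by simp
  qed
  with step(2) show ?case
    by (auto simp: pairing_simps V_def cx.span_add cx.span_scale)
qed

definition K where "K = {H \<in> h. H \<in> M \<and> (\<forall>\<gamma>\<in>\<Gamma>. \<gamma> H = 0)}"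

lemma subspace_K: "cx.subspace K"
  by (rule cx.subspaceI)
    (auto simp: K_def h_closed M_closed dual_add[OF root_dual[OF stem_root]]
      dual_scale[OF root_dual[OF stem_root]] dual_zero[OF root_dual[OF stem_root]])

text \<open>The projection of M onto \<open>K\<close> along \<open>V\<close>; subtracting the dual
  vectors \<open>Hp\<close> makes all stem roots vanish.\<close>

definition Q where "Q X = hpart X - (\<Sum>\<gamma>\<in>\<Gamma>. \<gamma> (hpart X) *\<^sub>C Hp \<gamma>)"

lemma Q_add: "X \<in> M \<Longrightarrow> Y \<in> M \<Longrightarrow> Q (X + Y) = Q X + Q Y"
proof -
  assume a: "X \<in> M" "Y \<in> M"
  have val: "\<gamma> (hpart X + hpart Y) = \<gamma> (hpart X) + \<gamma> (hpart Y)" if "\<gamma> \<in> \<Gamma>" for \<gamma>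
    using dual_add[OF root_dual[OF stem_root[OF that]]] hpart_M a by blast
  have "(\<Sum>\<gamma>\<in>\<Gamma>. \<gamma> (hpart X + hpart Y) *\<^sub>C Hp \<gamma>) = (\<Sum>\<gamma>\<in>\<Gamma>. (\<gamma> (hpart X) + \<gamma> (hpart Y)) *\<^sub>C Hp \<gamma>)"
    by (intro sum.cong refl arg_cong2[where f = cscale] val)
  also have "\<dots> = (\<Sum>\<gamma>\<in>\<Gamma>. \<gamma> (hpart X) *\<^sub>C Hp \<gamma>) + (\<Sum>\<gamma>\<in>\<Gamma>. \<gamma> (hpart Y) *\<^sub>C Hp \<gamma>)"
    by (simp add: cx.scale_left_distrib sum.distrib)
  finally have "(\<Sum>\<gamma>\<in>\<Gamma>. \<gamma> (hpart X + hpart Y) *\<^sub>C Hp \<gamma>)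
      = (\<Sum>\<gamma>\<in>\<Gamma>. \<gamma> (hpart X) *\<^sub>C Hp \<gamma>) + (\<Sum>\<gamma>\<in>\<Gamma>. \<gamma> (hpart Y) *\<^sub>C Hp \<gamma>)" .
  then show ?thesis by (simp add: Q_def hpart_simps)
qed

lemma Q_scale: "X \<in> M \<Longrightarrow> Q (c *\<^sub>C X) = c *\<^sub>C Q X"
proof -
  assume a: "X \<in> M"
  have val: "\<gamma> (c *\<^sub>C hpart X) = c * \<gamma> (hpart X)" if "\<gamma> \<in> \<Gamma>" for \<gamma>
    using dual_scale[OF root_dual[OF stem_root[OF that]]] hpart_M a by blast
  have "(\<Sum>\<gamma>\<in>\<Gamma>. \<gamma> (c *\<^sub>C hpart X) *\<^sub>C Hp \<gamma>) = (\<Sum>\<gamma>\<in>\<Gamma>. (c * \<gamma> (hpart X)) *\<^sub>C Hp \<gamma>)"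
    by (intro sum.cong refl arg_cong2[where f = cscale] val)
  then have "(\<Sum>\<gamma>\<in>\<Gamma>. \<gamma> (c *\<^sub>C hpart X) *\<^sub>C Hp \<gamma>) = c *\<^sub>C (\<Sum>\<gamma>\<in>\<Gamma>. \<gamma> (hpart X) *\<^sub>C Hp \<gamma>)"
    by (simp add: cx.scale_sum_right)
  then show ?thesis by (simp add: Q_def hpart_simps cx.scale_right_diff_distrib)
qed

lemma Q_K: "X \<in> K \<Longrightarrow> Q X = X"
proof -
  assume X: "X \<in> K"
  then have "(\<Sum>\<gamma>\<in>\<Gamma>. \<gamma> X *\<^sub>C Hp \<gamma>) = 0" by (intro sum.neutral) (simp add: K_def)
  then show ?thesis using X by (simp add: Q_def K_def hpart_h)
qed

lemma Q_hpart_0: "hpart X = 0 \<Longrightarrow> Q X = 0"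
proof -
  assume X: "hpart X = 0"
  have "(\<Sum>\<gamma>\<in>\<Gamma>. \<gamma> 0 *\<^sub>C Hp \<gamma>) = 0"
  proof (intro sum.neutral ballI)
    fix \<gamma> assume "\<gamma> \<in> \<Gamma>"
    from dual_zero[OF root_dual[OF stem_root[OF this]]] show "\<gamma> 0 *\<^sub>C Hp \<gamma> = 0" by simp
  qed
  then show ?thesis by (simp add: Q_def X)
qed

lemma Q_base: "X \<in> Hp ` \<Gamma> \<union> E ` P \<Longrightarrow> Q X = 0"
proof (erule UnE)
  assume "X \<in> Hp ` \<Gamma>"
  then obtain \<gamma> where \<gamma>: "\<gamma> \<in> \<Gamma>" "X = Hp \<gamma>" by blast
  have "(\<Sum>\<delta>\<in>\<Gamma>. \<delta> (hpart X) *\<^sub>C Hp \<delta>) = (\<Sum>\<delta>\<in>\<Gamma>. if \<delta> = \<gamma> then Hp \<gamma> else 0)"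
  proof (intro sum.cong refl)
    fix \<delta> assume "\<delta> \<in> \<Gamma>"
    from stem_prm(2)[OF this \<gamma>(1)] show "\<delta> (hpart X) *\<^sub>C Hp \<delta> = (if \<delta> = \<gamma> then Hp \<gamma> else 0)"
      using \<gamma> by (simp add: hpart_h Hp_props)
  qed
  then show ?thesis using \<gamma> finite_stem by (simp add: Q_def hpart_h Hp_props)
next
  assume "X \<in> E ` P"
  then have "hpart X = 0" using E_nplus hpart_nplus by blast
  then show ?thesis by (rule Q_hpart_0)
qed

lemma Q_V:
  assumes "X \<in> V"
  shows "Q X = 0"
proof -
  have "X \<in> M \<and> Q X = 0"
    using assms unfolding V_def
  proof (induction rule: cx.span_induct_alt)
    case base
    show ?case using M_closed(4) Q_hpart_0[OF hpart_h[OF h_closed(4)]] by simp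
  next
    case (step c X Y)
    have "X \<in> M" using step(1) Hp_props(2) E_in_M by auto
    then show ?case using step M_closed(1,3) Q_base by (simp add: Q_add Q_scale)
  qed
  then show ?thesis ..
qed

lemma Q_in_K:
  assumes "X \<in> M"
  shows "Q X \<in> K" "X - Q X \<in> V"
proof -
  have sh: "(\<Sum>\<gamma>\<in>\<Gamma>. \<gamma> (hpart X) *\<^sub>C Hp \<gamma>) \<in> h" and sM: "(\<Sum>\<gamma>\<in>\<Gamma>. \<gamma> (hpart X) *\<^sub>C Hp \<gamma>) \<in> M"
    using Hp_props by (auto intro!: cx.subspace_sum cx.subspace_scale subspace_h subspace_M)
  have X: "hpart X \<in> h" "hpart X \<in> M" "X - hpart X \<in> nplus" using hpart_M[OF assms] by auto
  have "\<delta> (Q X) = 0" if d: "\<delta> \<in> \<Gamma>" for \<delta>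
  proof -
    have dd: "\<delta> \<in> dual h" using root_dual[OF stem_root[OF d]] .
    have "\<delta> (\<Sum>\<gamma>\<in>\<Gamma>. \<gamma> (hpart X) *\<^sub>C Hp \<gamma>) = (\<Sum>\<gamma>\<in>\<Gamma>. \<delta> (\<gamma> (hpart X) *\<^sub>C Hp \<gamma>))"
      by (intro dual_sum dd h_closed(3) Hp_props)
    also have "\<dots> = (\<Sum>\<gamma>\<in>\<Gamma>. if \<gamma> = \<delta> then \<delta> (hpart X) else 0)"
      using stem_prm(2)[OF d] by (intro sum.cong) (auto simp: dual_scale[OF dd] Hp_props)
    also have "\<dots> = \<delta> (hpart X)" using d finite_stem by simp
    finally show ?thesis using dual_diff[OF dd X(1) sh] by (simp add: Q_def)
  qed
  then show "Q X \<in> K" using h_closed(2)[OF X(1) sh] M_closed(2)[OF X(2) sM] by (simp add: K_def Q_def)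
  have "X - Q X = (X - hpart X) + (\<Sum>\<gamma>\<in>\<Gamma>. \<gamma> (hpart X) *\<^sub>C Hp \<gamma>)" by (simp add: Q_def)
  also have "\<dots> \<in> V"
    using X(3) nplus_V V_base(1)
    by (intro cx.subspace_add[OF subspace_V] cx.subspace_sum[OF subspace_V] cx.subspace_scale[OF subspace_V]) auto
  finally show "X - Q X \<in> V" .
qed

lemma pairing_K: "X \<in> K \<Longrightarrow> pairing X = 0"
proof -
  assume X: "X \<in> K"
  then have val: "\<delta> (conjugation X) = 0" if "\<delta> \<in> \<Gamma>" for \<delta>
    using rdual_conj[OF roots_rdual[OF stem_root[OF that]], of X] that by (simp add: K_def)
  have "(\<Sum>\<delta>\<in>\<Gamma>. \<delta> (conjugation X) *\<^sub>C E \<delta>) = 0"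
  proof (intro sum.neutral ballI)
    fix \<delta> assume "\<delta> \<in> \<Gamma>"
    from val[OF this] show "\<delta> (conjugation X) *\<^sub>C E \<delta> = 0" by simp
  qed
  then show ?thesis using X pairing_h by (simp add: K_def)
qed

text \<open>Both summands are cocycles: \<open>pairing\<close> as a coboundary, and the one through
  j since it kills brackets and takes values in h. They act on the complementary spaces
  \<open>V\<close> and \<open>K\<close> separately, so their squares combine to -1.\<close>

lemma qstruct_of_K:
  assumes j: "\<And>X Y. j (X + Y) = j X + j Y" "\<And>c X. j (c *\<^sub>C X) = cnj c *\<^sub>C j X"
    "\<And>X. X \<in> K \<Longrightarrow> j X \<in> K" "\<And>X. X \<in> K \<Longrightarrow> j (j X) = - X"
  shows "qstruct (\<lambda>X. pairing X + j (Q X))"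
proof -
  define \<psi> where "\<psi> X = pairing X + j (Q X)" for X
  have j0: "j 0 = 0" using j(2)[of 0 0] by simp
  have p0: "pairing 0 = 0" using pairing_simps(2)[of 0 0] by simp
  have KM: "X \<in> M" if "X \<in> K" for X using that by (simp add: K_def)
  have \<psi>M: "\<psi> X \<in> M" if "X \<in> M" for X
    unfolding \<psi>_def by (intro M_closed(1) pairing_simps(3) KM j(3) Q_in_K that)
  have \<psi>add: "\<psi> (X + Y) = \<psi> X + \<psi> Y" if "X \<in> M" "Y \<in> M" for X Y
    using that by (simp add: \<psi>_def pairing_simps Q_add j)
  have \<psi>V: "\<psi> X = pairing X" if "X \<in> V" for X
    using Q_V[OF that] by (simp add: \<psi>_def j0)
  have \<psi>K: "\<psi> X = j X" if "X \<in> K" for X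
    using Q_K[OF that] pairing_K[OF that] by (simp add: \<psi>_def)
  have sq: "\<psi> (\<psi> X) = - X" if X: "X \<in> M" for X
  proof -
    define A where "A = Q X"
    define B where "B = X - Q X"
    have A: "A \<in> K" and B: "B \<in> V" using Q_in_K[OF X] by (auto simp: A_def B_def)
    have AB: "A \<in> M" "B \<in> M" "X = A + B" using A B KM V_M by (auto simp: A_def B_def)
    have "\<psi> (\<psi> X) = \<psi> (\<psi> A) + \<psi> (\<psi> B)" using AB by (simp add: \<psi>add \<psi>M)
    also have "\<psi> (\<psi> A) = - A" using A by (simp add: \<psi>K j)
    also have "\<psi> (\<psi> B) = - B" using pairing_V[OF B] B by (simp add: \<psi>V)
    finally show ?thesis using AB(3) by simp
  qed
  have coc: "\<psi> \<lbrace>X,Y\<rbrace> = prp (\<lbrace>conjugation X, \<psi> Y\<rbrace> + \<lbrace>\<psi> X, conjugation Y\<rbrace>)" if XY: "X \<in> M" "Y \<in> M" for X Y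
  proof -
    have "Q \<lbrace>X,Y\<rbrace> = 0" by (rule Q_hpart_0[OF hpart_M_bracket[OF XY]])
    then have "\<psi> \<lbrace>X,Y\<rbrace> = pairing \<lbrace>X,Y\<rbrace>" by (simp add: \<psi>_def j0)
    also have "\<dots> = prp (\<lbrace>conjugation X, pairing Y\<rbrace> + \<lbrace>pairing X, conjugation Y\<rbrace>)"
      unfolding pairing_def by (rule coboundary[OF XY])
    moreover have "j (Q X) \<in> h" "j (Q Y) \<in> h" using j(3) Q_in_K XY by (auto simp: K_def)
    then have "prp \<lbrace>conjugation X, j (Q Y)\<rbrace> = 0" "prp \<lbrace>j (Q X), conjugation Y\<rbrace> = 0"
      using prp_bracket_conj_M_h XY cb_anticomm[of "j (Q X)" "conjugation Y"] by (auto simp: prp_simps)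
    ultimately show ?thesis by (simp add: \<psi>_def cb_simps prp_simps)
  qed
  have "qstruct \<psi>"
    unfolding qstruct_def
  proof (intro ballI conjI allI)
    fix X c assume X: "X \<in> M"
    show "\<psi> X \<in> M" by (rule \<psi>M[OF X])
    show "\<psi> (\<psi> X) = - X" by (rule sq[OF X])
    show "\<psi> (c *\<^sub>C X) = cnj c *\<^sub>C \<psi> X"
      using X by (simp add: \<psi>_def pairing_simps Q_scale j cx.scale_right_distrib)
    fix Y assume Y: "Y \<in> M"
    show "\<psi> (X + Y) = \<psi> X + \<psi> Y" by (rule \<psi>add[OF X Y])
    show "\<psi> \<lbrace>X,Y\<rbrace> = prp (\<lbrace>conjugation X, \<psi> Y\<rbrace> + \<lbrace>\<psi> X, conjugation Y\<rbrace>)" by (rule coc[OF X Y])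
  qed
  then show ?thesis by (simp add: \<psi>_def[abs_def])
qed

text \<open>\<open>pairing\<close> already forces the dimension of \<open>V\<close> to be even, so
  an even dimension of M leaves an even one for \<open>K\<close>, on which j is then free to be
  chosen.\<close>

lemma admissible:
  assumes "cpx_finite (B :: 'u cpx set)" and evM: "even (cx.dim M)"
  shows "admissible br I"
proof -
  interpret cpx_finite B by (rule assms)
  have evV: "even (cx.dim V)"
    using pairing_V by (intro even_dim_quaternionic[of V pairing] subspace_V pairing_simps) blast+
  have "{x + y |x y. x \<in> K \<and> y \<in> V} = M"
  proof
    show "{x + y |x y. x \<in> K \<and> y \<in> V} \<subseteq> M" using V_M M_closed(1) by (auto simp: K_def)
    show "M \<subseteq> {x + y |x y. x \<in> K \<and> y \<in> V}"
    proof
      fix X assume "X \<in> M"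
      then have "Q X \<in> K" "X - Q X \<in> V" "X = Q X + (X - Q X)" using Q_in_K by auto
      then show "X \<in> {x + y |x y. x \<in> K \<and> y \<in> V}" by blast
    qed
  qed
  moreover have "X = 0" if "X \<in> K" "X \<in> V" for X
    using Q_K[OF that(1)] Q_V[OF that(2)] by simp
  then have "K \<inter> V = {0}"
    using cx.subspace_0[OF subspace_K] cx.subspace_0[OF subspace_V] by blast
  ultimately have "cx.dim M = cx.dim K + cx.dim V"
    using dim_sums_Int[OF subspace_K subspace_V] by simp
  then have evK: "even (cx.dim K)" using evM evV by simp
  obtain j where "\<And>X Y. j (X + Y) = j X + j Y" "\<And>c X. j (c *\<^sub>C X) = cnj c *\<^sub>C j X"
    "\<And>X. X \<in> K \<Longrightarrow> j X \<in> K" "\<And>X. X \<in> K \<Longrightarrow> j (j X) = - X"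
    using exists_quaternionic[OF subspace_K evK] by blast
  then have "qstruct (\<lambda>X. pairing X + j (Q X))" by (intro qstruct_of_K)
  then show "admissible br I" by (rule qstruct_admissible)
qed

end

lemma (in borel_structure) admissible_iff:
  "admissible br I \<longleftrightarrow>
    4 dvd dim (UNIV :: 'u set) \<and> (\<forall>\<gamma>\<in>\<Gamma>. \<forall>\<delta>\<in>\<Gamma>. \<gamma> (Ic (W br h \<delta>)) = 0)"
proof -
  obtain B :: "'u set" where B: "finite B" "span B = UNIV" using finite_spanning by blast
  obtain C :: "'u cpx set" where "finite_dimensional_vector_space cscale C" using dim_cpx(2)[OF B] by blast
  then have fin: "cpx_finite C" by (rule cpx_finite.intro)
  interpret cpx_finite C by (rule fin)
  \<comment> \<open>The real dimension of u is the complex dimension of g, and g is M plus its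
    conjugate; divisibility by 4 thus means that M has even dimension.\<close>
  have dim: "dim (UNIV :: 'u set) = 2 * cx.dim M" using dim_M[OF fin] dim_cpx(1)[OF B] by simp
  have W: "\<gamma> (Ic (W br h \<delta>)) = \<i> / 2 * \<gamma> (Ic (Hc \<delta>))" if "\<gamma> \<in> \<Gamma>" "\<delta> \<in> \<Gamma>" for \<gamma> \<delta>
    using dual_scale[OF root_dual[OF stem_root[OF that(1)]] Ic_h[OF Hc_in_h[OF stem_root[OF that(2)]]]]
    by (simp add: W_def Ic_simps)
  show ?thesis
  proof
    assume "admissible br I"
    then obtain \<psi> where \<psi>: "qstruct \<psi>" using matches_qstruct by (auto simp: admissible_def)
    have "even (cx.dim M)"
      by (rule even_dim_quaternionic[OF subspace_M \<psi>_M[OF \<psi>] \<psi>_\<psi>[OF \<psi>] \<psi>_scale[OF \<psi>] \<psi>_add[OF \<psi>]])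
    then have "4 dvd dim (UNIV :: 'u set)" unfolding dim by (auto elim!: evenE)
    moreover have "\<gamma> (Ic (W br h \<delta>)) = 0" if "\<gamma> \<in> \<Gamma>" "\<delta> \<in> \<Gamma>" for \<gamma> \<delta>
      using W[OF that] stem_conditions[OF \<psi> that(2,1)] by simp
    ultimately show "4 dvd dim (UNIV :: 'u set) \<and> (\<forall>\<gamma>\<in>\<Gamma>. \<forall>\<delta>\<in>\<Gamma>. \<gamma> (Ic (W br h \<delta>)) = 0)"
      by blast
  next
    assume r: "4 dvd dim (UNIV :: 'u set) \<and> (\<forall>\<gamma>\<in>\<Gamma>. \<forall>\<delta>\<in>\<Gamma>. \<gamma> (Ic (W br h \<delta>)) = 0)"
    have st: "\<forall>\<gamma>\<in>\<Gamma>. \<forall>\<delta>\<in>\<Gamma>. \<gamma> (Ic (Hc \<delta>)) = 0"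
    proof (intro ballI)
      fix \<gamma> \<delta> assume that: "\<gamma> \<in> \<Gamma>" "\<delta> \<in> \<Gamma>"
      have "\<gamma> (Ic (W br h \<delta>)) = 0" using r that by blast
      then show "\<gamma> (Ic (Hc \<delta>)) = 0" using W[OF that] by simp
    qed
    have "4 dvd 2 * cx.dim M" using r dim by simp
    then obtain k where "2 * cx.dim M = 4 * k" by (rule dvdE)
    then have "cx.dim M = 2 * k" by simp
    then have evM: "even (cx.dim M)" by simp
    interpret isotropic_stem br ip h P \<Gamma> I by unfold_locales (rule st)
    show "admissible br I" by (rule admissible[OF fin evM])
  qed
qed

theorem theorem4p27:
  fixes br :: "'u::real_vector \<Rightarrow> 'u \<Rightarrow> 'u"
    and h :: "'u cpx set"
    and P \<Gamma> :: "('u cpx \<Rightarrow> complex) set"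
    and I :: "'u \<Rightarrow> 'u"
  assumes "compact_lie_algebra br"
    and "cartan_subalgebra br h"
    and "conjugation ` h = h"
    and "positive_system br h P"
    and "is_stem P \<Gamma>"
    and "borel_complex_structure br h P I"
  shows "admissible br I \<longleftrightarrow>
    4 dvd dim (UNIV :: 'u set) \<and>
    (\<forall>\<gamma>\<in>\<Gamma>. \<forall>\<delta>\<in>\<Gamma>. \<gamma> (complexify I (W br h \<delta>)) = 0)"
proof -
  have br: "real_lie_algebra br" "\<exists>B :: 'u set. finite B \<and> span B = UNIV"
    and "\<exists>ip :: 'u \<Rightarrow> 'u \<Rightarrow> real. bilinear ip \<and> (\<forall>x y. ip x y = ip y x) \<and> (\<forall>x. x \<noteq> 0 \<longrightarrow> ip x x > 0) \<and>
        (\<forall>x y z. ip (br x y) z + ip y (br x z) = 0)"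
    using assms(1) by (simp_all only: compact_lie_algebra_def)
  then obtain ip :: "'u \<Rightarrow> 'u \<Rightarrow> real" where
    ip: "bilinear ip" "\<And>x y. ip x y = ip y x" "\<And>x. x \<noteq> 0 \<Longrightarrow> ip x x > 0"
      "\<And>x y z. ip (br x y) z + ip y (br x z) = 0"
    by auto
  interpret real_lie_algebra br by (rule br)
  interpret borel_structure br ip h P \<Gamma> I
    by unfold_locales (fact ip br assms)+
  show ?thesis by (rule admissible_iff)
qed

end
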